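(* Let $M^{2n+s}(f,Q,\xi_i,\eta^i,g)$ be a weak $\beta f$-Kenmotsu manifold with $\beta=\mathrm{const}\ne0$. Suppose that $(g,V)$ represents a $\ast$-$\eta$-Ricci soliton with constants $\lambda,\mu\in\mathbb{R}$, that is, $V$ is a vector field on $M$ and $$\tfrac12\,\pounds_V g+\mathrm{Ric}^\ast=\lambda\Big\{g-\sum_i\eta^i\otimes\eta^i\Big\}+(\lambda+\mu)\,\bar\eta\otimes\bar\eta ,$$ and that the potential vector field $V$ is a contact vector field, i.e. there exists $\sigma\in C^\infty(M)$ such that $\pounds_V\eta^i=\sigma\,\eta^i$ for all $1\le i\le s$. Then $V$ is strictly contact, i.e. $\sigma=0$, and $(M,g)$ is an $\eta$-Einstein manifold, $$\mathrm{Ric}=a\,g-a\sum_i\eta^i\otimes\eta^i+(a+b)\,\bar\eta\otimes\bar\eta ,$$ with $a=-2sn\beta^2$ and $b=2(s-1)n\beta^2$, of constant scalar curvature $r=-2sn(2n+1)\beta^2$.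
   Context: A weak metric $f$-structure on a smooth manifold $M^{2n+s}$ ($n>0$, $s>1$) is a set $(f,Q,\xi_i,\eta^i,g)$, where $f$ is a skew-symmetric $(1,1)$-tensor of rank $2n$, $Q$ is a self-adjoint nonsingular $(1,1)$-tensor, $\xi_i$ ($1\le i\le s$) are orthonormal vector fields, $\eta^i$ are dual 1-forms, and $g$ is a Riemannian metric, such that $f^2=-Q+\sum_i\eta^i\otimes\xi_i$, $\eta^i(\xi_j)=\delta^i_j$, $Q\xi_i=\xi_i$, and $g(fX,fY)=g(X,QY)-\sum_i\eta^i(X)\eta^i(Y)$ for all vector fields $X,Y$. Put $\bar\xi=\sum_i\xi_i$, $\bar\eta=\sum_i\eta^i$. The structure is normal if $[f,f](X,Y)+2\sum_i d\eta^i(X,Y)\,\xi_i=0$ for all $X,Y$, where $[f,f](X,Y)=f^2[X,Y]+[fX,fY]-f[fX,Y]-f[X,fY]$ and $d\omega(X,Y)=\tfrac12\{X(\omega(Y))-Y(\omega(X))-\omega([X,Y])\}$. A weak $\beta f$-Kenmotsu manifold is a weak metric $f$-manifold, normal (i.e. $[f,f](X,Y)+2\sum_i d\eta^i(X,Y)\,\xi_i=0$ for all vector fields $X,Y$), satisfying $(\nabla_Xf)Y=\beta\{g(fX,Y)\,\bar\xi-\bar\eta(Y)fX\}$ for all $X,Y$, where $\nabla$ is the Levi-Civita connection of $g$. Conventions: $R_{X,Y}=[\nabla_X,\nabla_Y]-\nabla_{[X,Y]}$; $\mathrm{Ric}(X,Y)=\mathrm{trace}(Z\mapsto R_{Z,X}Y)$;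 $r=\mathrm{trace}_g\,\mathrm{Ric}$; the $\ast$-Ricci tensor is $\mathrm{Ric}^\ast(X,Y)=\tfrac12\,\mathrm{trace}\{Z\mapsto R_{X,fY}fZ\}$; $\pounds$ is the Lie derivative. *)

theory Defs
  imports "HOL-Analysis.Analysis"
begin

primrec cont_diff_on ::
  "nat \<Rightarrow> 'e::euclidean_space set \<Rightarrow> ('e \<Rightarrow> 'f::real_normed_vector) \<Rightarrow> bool" where
  "cont_diff_on 0 S h \<longleftrightarrow> continuous_on S h"
| "cont_diff_on (Suc k) S h \<longleftrightarrow>
     (\<forall>x\<in>S. h differentiable (at x)) \<and>
     (\<forall>v. cont_diff_on k S (\<lambda>x. frechet_derivative h (at x) v))"

(* Only used for open S. *)
definition smooth_on :: "'e::euclidean_space set \<Rightarrow> ('e \<Rightarrow> 'f::real_normed_vector) \<Rightarrow> bool" where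
  "smooth_on S h \<longleftrightarrow> (\<forall>k. cont_diff_on k S h)"

(* A chart is a pair of its domain and its coordinate map; only the values of the map on the
   domain matter. *)
type_synonym ('a, 'm) chart = "'a set \<times> ('a \<Rightarrow> real ^ 'm)"

definition chart_dom :: "('a, 'm) chart \<Rightarrow> 'a set" where
  "chart_dom c = fst c"

definition chart_map :: "('a, 'm) chart \<Rightarrow> 'a \<Rightarrow> real ^ 'm" where
  "chart_map c = snd c"

definition chart_inv :: "('a, 'm) chart \<Rightarrow> real ^ 'm \<Rightarrow> 'a" where
  "chart_inv c = inv_into (chart_dom c) (chart_map c)"

definition is_chart :: "('a::topological_space, 'm::finite) chart \<Rightarrow> bool" where
  "is_chart c \<longleftrightarrow> open (chart_dom c) \<and> open (chart_map c ` chart_dom c) \<and>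
     homeomorphism (chart_dom c) (chart_map c ` chart_dom c) (chart_map c) (chart_inv c)"

(* The manifold is the whole type 'a, of dimension CARD('m).  The atlas need not be maximal. *)
definition smooth_atlas :: "('a::topological_space, 'm::finite) chart set \<Rightarrow> bool" where
  "smooth_atlas A \<longleftrightarrow> (\<forall>c\<in>A. is_chart c) \<and> (\<Union>c\<in>A. chart_dom c) = UNIV \<and>
     (\<forall>c\<in>A. \<forall>c'\<in>A. smooth_on (chart_map c ` (chart_dom c \<inter> chart_dom c'))
                               (chart_map c' \<circ> chart_inv c))"

definition smooth_fun :: "('a::topological_space, 'm::finite) chart set \<Rightarrow> ('a \<Rightarrow> real) \<Rightarrow> bool" where
  "smooth_fun A h \<longleftrightarrow> (\<forall>c\<in>A. smooth_on (chart_map c ` chart_dom c) (h \<circ> chart_inv c))"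

(* The tangent space at p is identified with real^'m by means of one chart around p, chosen
   once and for all; tangent vectors are converted to other charts by the derivative of the
   transition map. *)
definition chart_at :: "('a, 'm::finite) chart set \<Rightarrow> 'a \<Rightarrow> ('a, 'm) chart" where
  "chart_at A p = (SOME c. c \<in> A \<and> p \<in> chart_dom c)"

type_synonym ('a, 'm) vfield = "'a \<Rightarrow> real ^ 'm"

definition chart_components ::
  "('a, 'm::finite) chart set \<Rightarrow> ('a, 'm) chart \<Rightarrow> 'a \<Rightarrow> real ^ 'm \<Rightarrow> real ^ 'm" where
  "chart_components A c p v =
     frechet_derivative (chart_map c \<circ> chart_inv (chart_at A p)) (at (chart_map (chart_at A p) p)) v"

definition smooth_vfield :: "('a::topological_space, 'm::finite) chart set \<Rightarrow> ('a, 'm) vfield \<Rightarrow> bool" where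
  "smooth_vfield A X \<longleftrightarrow> (\<forall>c\<in>A. smooth_on (chart_map c ` chart_dom c)
     (\<lambda>x. chart_components A c (chart_inv c x) (X (chart_inv c x))))"

definition tangent_deriv :: "('a, 'm::finite) chart set \<Rightarrow> 'a \<Rightarrow> real ^ 'm \<Rightarrow> ('a \<Rightarrow> real) \<Rightarrow> real" where
  "tangent_deriv A p v h =
     frechet_derivative (h \<circ> chart_inv (chart_at A p)) (at (chart_map (chart_at A p) p)) v"

definition vderiv :: "('a, 'm::finite) chart set \<Rightarrow> ('a, 'm) vfield \<Rightarrow> ('a \<Rightarrow> real) \<Rightarrow> 'a \<Rightarrow> real" where
  "vderiv A X h p = tangent_deriv A p (X p) h"

(* [X,Y] = XY - YX as derivations; on smooth X, Y the description has exactly one solution. *)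
definition bracket ::
  "('a::topological_space, 'm::finite) chart set \<Rightarrow> ('a, 'm) vfield \<Rightarrow> ('a, 'm) vfield \<Rightarrow> ('a, 'm) vfield" where
  "bracket A X Y p = (THE v. \<forall>h. smooth_fun A h \<longrightarrow>
     tangent_deriv A p v h = vderiv A X (vderiv A Y h) p - vderiv A Y (vderiv A X h) p)"

(* A smooth vector field with prescribed value v at p; used to evaluate at single tangent
   vectors an expression that is function-linear in vector fields. *)
definition extend :: "('a::topological_space, 'm::finite) chart set \<Rightarrow> 'a \<Rightarrow> real ^ 'm \<Rightarrow> ('a, 'm) vfield" where
  "extend A p v = (SOME X. smooth_vfield A X \<and> X p = v)"

definition one_form ::
  "('a::topological_space, 'm::finite) chart set \<Rightarrow> ('a \<Rightarrow> real ^ 'm \<Rightarrow> real) \<Rightarrow> bool" where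
  "one_form A \<omega> \<longleftrightarrow> (\<forall>p. linear (\<omega> p)) \<and>
     (\<forall>X. smooth_vfield A X \<longrightarrow> smooth_fun A (\<lambda>p. \<omega> p (X p)))"

definition endo_field ::
  "('a::topological_space, 'm::finite) chart set \<Rightarrow> ('a \<Rightarrow> real ^ 'm \<Rightarrow> real ^ 'm) \<Rightarrow> bool" where
  "endo_field A T \<longleftrightarrow> (\<forall>p. linear (T p)) \<and>
     (\<forall>X. smooth_vfield A X \<longrightarrow> smooth_vfield A (\<lambda>p. T p (X p)))"

definition riemannian_metric ::
  "('a::topological_space, 'm::finite) chart set \<Rightarrow> ('a \<Rightarrow> real ^ 'm \<Rightarrow> real ^ 'm \<Rightarrow> real) \<Rightarrow> bool" where
  "riemannian_metric A g \<longleftrightarrow>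
     (\<forall>p. bilinear (g p) \<and> (\<forall>v w. g p v w = g p w v) \<and> (\<forall>v. v \<noteq> 0 \<longrightarrow> g p v v > 0)) \<and>
     (\<forall>X Y. smooth_vfield A X \<and> smooth_vfield A Y \<longrightarrow> smooth_fun A (\<lambda>p. g p (X p) (Y p)))"

definition d_form ::
  "('a::topological_space, 'm::finite) chart set \<Rightarrow> ('a \<Rightarrow> real ^ 'm \<Rightarrow> real) \<Rightarrow>
     ('a, 'm) vfield \<Rightarrow> ('a, 'm) vfield \<Rightarrow> 'a \<Rightarrow> real" where
  "d_form A \<omega> X Y p = (1/2) * (vderiv A X (\<lambda>q. \<omega> q (Y q)) p - vderiv A Y (\<lambda>q. \<omega> q (X q)) p
     - \<omega> p (bracket A X Y p))"

definition nijenhuis ::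
  "('a::topological_space, 'm::finite) chart set \<Rightarrow> ('a \<Rightarrow> real ^ 'm \<Rightarrow> real ^ 'm) \<Rightarrow>
     ('a, 'm) vfield \<Rightarrow> ('a, 'm) vfield \<Rightarrow> ('a, 'm) vfield" where
  "nijenhuis A f X Y p =
     f p (f p (bracket A X Y p)) + bracket A (\<lambda>q. f q (X q)) (\<lambda>q. f q (Y q)) p
     - f p (bracket A (\<lambda>q. f q (X q)) Y p) - f p (bracket A X (\<lambda>q. f q (Y q)) p)"

definition lie_one_form ::
  "('a::topological_space, 'm::finite) chart set \<Rightarrow> ('a, 'm) vfield \<Rightarrow> ('a \<Rightarrow> real ^ 'm \<Rightarrow> real) \<Rightarrow>
     ('a, 'm) vfield \<Rightarrow> 'a \<Rightarrow> real" where
  "lie_one_form A V \<omega> X p = vderiv A V (\<lambda>q. \<omega> q (X q)) p - \<omega> p (bracket A V X p)"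

definition lie_metric ::
  "('a::topological_space, 'm::finite) chart set \<Rightarrow> ('a, 'm) vfield \<Rightarrow>
     ('a \<Rightarrow> real ^ 'm \<Rightarrow> real ^ 'm \<Rightarrow> real) \<Rightarrow> ('a, 'm) vfield \<Rightarrow> ('a, 'm) vfield \<Rightarrow> 'a \<Rightarrow> real" where
  "lie_metric A V g X Y p = vderiv A V (\<lambda>q. g q (X q) (Y q)) p
     - g p (bracket A V X p) (Y p) - g p (X p) (bracket A V Y p)"

definition affine_connection ::
  "('a::topological_space, 'm::finite) chart set \<Rightarrow>
     (('a, 'm) vfield \<Rightarrow> ('a, 'm) vfield \<Rightarrow> ('a, 'm) vfield) \<Rightarrow> bool" where
  "affine_connection A D \<longleftrightarrow>
     (\<forall>X Y. smooth_vfield A X \<and> smooth_vfield A Y \<longrightarrow> smooth_vfield A (D X Y)) \<and>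
     (\<forall>X Y Z. smooth_vfield A X \<and> smooth_vfield A Y \<and> smooth_vfield A Z \<longrightarrow>
        (\<forall>p. D (\<lambda>q. X q + Y q) Z p = D X Z p + D Y Z p \<and>
             D X (\<lambda>q. Y q + Z q) p = D X Y p + D X Z p)) \<and>
     (\<forall>h X Y. smooth_fun A h \<and> smooth_vfield A X \<and> smooth_vfield A Y \<longrightarrow>
        (\<forall>p. D (\<lambda>q. h q *\<^sub>R X q) Y p = h p *\<^sub>R D X Y p \<and>
             D X (\<lambda>q. h q *\<^sub>R Y q) p = vderiv A X h p *\<^sub>R Y p + h p *\<^sub>R D X Y p))"

definition levi_civita ::
  "('a::topological_space, 'm::finite) chart set \<Rightarrow> ('a \<Rightarrow> real ^ 'm \<Rightarrow> real ^ 'm \<Rightarrow> real) \<Rightarrow>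
     (('a, 'm) vfield \<Rightarrow> ('a, 'm) vfield \<Rightarrow> ('a, 'm) vfield) \<Rightarrow> bool" where
  "levi_civita A g D \<longleftrightarrow> affine_connection A D \<and>
     (\<forall>X Y. smooth_vfield A X \<and> smooth_vfield A Y \<longrightarrow>
        (\<forall>p. D X Y p - D Y X p = bracket A X Y p)) \<and>
     (\<forall>X Y Z. smooth_vfield A X \<and> smooth_vfield A Y \<and> smooth_vfield A Z \<longrightarrow>
        (\<forall>p. vderiv A X (\<lambda>q. g q (Y q) (Z q)) p = g p (D X Y p) (Z p) + g p (Y p) (D X Z p)))"

definition curvature ::
  "('a::topological_space, 'm::finite) chart set \<Rightarrow>
     (('a, 'm) vfield \<Rightarrow> ('a, 'm) vfield \<Rightarrow> ('a, 'm) vfield) \<Rightarrow>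
     ('a, 'm) vfield \<Rightarrow> ('a, 'm) vfield \<Rightarrow> ('a, 'm) vfield \<Rightarrow> ('a, 'm) vfield" where
  "curvature A D X Y Z p = D X (D Y Z) p - D Y (D X Z) p - D (bracket A X Y) Z p"

definition curvature_at ::
  "('a::topological_space, 'm::finite) chart set \<Rightarrow>
     (('a, 'm) vfield \<Rightarrow> ('a, 'm) vfield \<Rightarrow> ('a, 'm) vfield) \<Rightarrow>
     'a \<Rightarrow> real ^ 'm \<Rightarrow> real ^ 'm \<Rightarrow> real ^ 'm \<Rightarrow> real ^ 'm" where
  "curvature_at A D p u v w = curvature A D (extend A p u) (extend A p v) (extend A p w) p"

definition endo_trace :: "(real ^ 'm::finite \<Rightarrow> real ^ 'm) \<Rightarrow> real" where
  "endo_trace T = trace (matrix T)"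

definition ricci ::
  "('a::topological_space, 'm::finite) chart set \<Rightarrow>
     (('a, 'm) vfield \<Rightarrow> ('a, 'm) vfield \<Rightarrow> ('a, 'm) vfield) \<Rightarrow>
     'a \<Rightarrow> real ^ 'm \<Rightarrow> real ^ 'm \<Rightarrow> real" where
  "ricci A D p v w = endo_trace (\<lambda>z. curvature_at A D p z v w)"

definition star_ricci ::
  "('a::topological_space, 'm::finite) chart set \<Rightarrow>
     (('a, 'm) vfield \<Rightarrow> ('a, 'm) vfield \<Rightarrow> ('a, 'm) vfield) \<Rightarrow>
     ('a \<Rightarrow> real ^ 'm \<Rightarrow> real ^ 'm) \<Rightarrow> 'a \<Rightarrow> real ^ 'm \<Rightarrow> real ^ 'm \<Rightarrow> real" where
  "star_ricci A D f p v w = (1/2) * endo_trace (\<lambda>z. curvature_at A D p v (f p w) (f p z))"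

(* g^{ij} B_{ij} for bilinear forms g and B on the tangent space *)
definition metric_trace ::
  "(real ^ 'm::finite \<Rightarrow> real ^ 'm \<Rightarrow> real) \<Rightarrow> (real ^ 'm \<Rightarrow> real ^ 'm \<Rightarrow> real) \<Rightarrow> real" where
  "metric_trace g B = (\<Sum>i\<in>UNIV. \<Sum>j\<in>UNIV.
     matrix_inv (\<chi> k l. g (axis k 1) (axis l 1)) $ i $ j * B (axis i 1) (axis j 1))"

definition scalar_curvature ::
  "('a::topological_space, 'm::finite) chart set \<Rightarrow> ('a \<Rightarrow> real ^ 'm \<Rightarrow> real ^ 'm \<Rightarrow> real) \<Rightarrow>
     (('a, 'm) vfield \<Rightarrow> ('a, 'm) vfield \<Rightarrow> ('a, 'm) vfield) \<Rightarrow> 'a \<Rightarrow> real" where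
  "scalar_curvature A g D p = metric_trace (g p) (ricci A D p)"

text \<open>The families \<open>\<xi>\<close> and \<open>\<eta>\<close> are indexed by \<open>{1..s}\<close>; values at other indices are irrelevant.\<close>

definition xi_bar :: "nat \<Rightarrow> (nat \<Rightarrow> ('a, 'm::finite) vfield) \<Rightarrow> ('a, 'm) vfield" where
  "xi_bar s \<xi> p = (\<Sum>i=1..s. \<xi> i p)"

definition eta_bar :: "nat \<Rightarrow> (nat \<Rightarrow> 'a \<Rightarrow> real ^ 'm::finite \<Rightarrow> real) \<Rightarrow> 'a \<Rightarrow> real ^ 'm \<Rightarrow> real" where
  "eta_bar s \<eta> p v = (\<Sum>i=1..s. \<eta> i p v)"

definition weak_metric_f_structure ::
  "('a::topological_space, 'm::finite) chart set \<Rightarrow> nat \<Rightarrow> nat \<Rightarrow>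
     ('a \<Rightarrow> real ^ 'm \<Rightarrow> real ^ 'm) \<Rightarrow> ('a \<Rightarrow> real ^ 'm \<Rightarrow> real ^ 'm) \<Rightarrow>
     (nat \<Rightarrow> ('a, 'm) vfield) \<Rightarrow> (nat \<Rightarrow> 'a \<Rightarrow> real ^ 'm \<Rightarrow> real) \<Rightarrow>
     ('a \<Rightarrow> real ^ 'm \<Rightarrow> real ^ 'm \<Rightarrow> real) \<Rightarrow> bool" where
  "weak_metric_f_structure A n s f Q \<xi> \<eta> g \<longleftrightarrow>
     n > 0 \<and> s > 1 \<and> CARD('m) = 2 * n + s \<and>
     riemannian_metric A g \<and> endo_field A f \<and> endo_field A Q \<and>
     (\<forall>i\<in>{1..s}. smooth_vfield A (\<xi> i) \<and> one_form A (\<eta> i)) \<and>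
     (\<forall>p.
       (\<forall>v w. g p (f p v) w = - g p v (f p w)) \<and> dim (range (f p)) = 2 * n \<and>
       (\<forall>v w. g p (Q p v) w = g p v (Q p w)) \<and> bij (Q p) \<and>
       (\<forall>i\<in>{1..s}. \<forall>j\<in>{1..s}. g p (\<xi> i p) (\<xi> j p) = (if i = j then 1 else 0)) \<and>
       (\<forall>i\<in>{1..s}. \<forall>j\<in>{1..s}. \<eta> i p (\<xi> j p) = (if i = j then 1 else 0)) \<and>
       (\<forall>i\<in>{1..s}. Q p (\<xi> i p) = \<xi> i p) \<and>
       (\<forall>v. f p (f p v) = - Q p v + (\<Sum>i=1..s. \<eta> i p v *\<^sub>R \<xi> i p)) \<and>
       (\<forall>v w. g p (f p v) (f p w) = g p v (Q p w) - (\<Sum>i=1..s. \<eta> i p v * \<eta> i p w)))"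

definition normal_structure ::
  "('a::topological_space, 'm::finite) chart set \<Rightarrow> nat \<Rightarrow> ('a \<Rightarrow> real ^ 'm \<Rightarrow> real ^ 'm) \<Rightarrow>
     (nat \<Rightarrow> ('a, 'm) vfield) \<Rightarrow> (nat \<Rightarrow> 'a \<Rightarrow> real ^ 'm \<Rightarrow> real) \<Rightarrow> bool" where
  "normal_structure A s f \<xi> \<eta> \<longleftrightarrow>
     (\<forall>X Y. smooth_vfield A X \<and> smooth_vfield A Y \<longrightarrow>
        (\<forall>p. nijenhuis A f X Y p + 2 *\<^sub>R (\<Sum>i=1..s. d_form A (\<eta> i) X Y p *\<^sub>R \<xi> i p) = 0))"

definition weak_beta_f_Kenmotsu ::
  "('a::topological_space, 'm::finite) chart set \<Rightarrow> nat \<Rightarrow> nat \<Rightarrow>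
     ('a \<Rightarrow> real ^ 'm \<Rightarrow> real ^ 'm) \<Rightarrow> ('a \<Rightarrow> real ^ 'm \<Rightarrow> real ^ 'm) \<Rightarrow>
     (nat \<Rightarrow> ('a, 'm) vfield) \<Rightarrow> (nat \<Rightarrow> 'a \<Rightarrow> real ^ 'm \<Rightarrow> real) \<Rightarrow>
     ('a \<Rightarrow> real ^ 'm \<Rightarrow> real ^ 'm \<Rightarrow> real) \<Rightarrow>
     (('a, 'm) vfield \<Rightarrow> ('a, 'm) vfield \<Rightarrow> ('a, 'm) vfield) \<Rightarrow> ('a \<Rightarrow> real) \<Rightarrow> bool" where
  "weak_beta_f_Kenmotsu A n s f Q \<xi> \<eta> g D \<beta> \<longleftrightarrow>
     weak_metric_f_structure A n s f Q \<xi> \<eta> g \<and> normal_structure A s f \<xi> \<eta> \<and>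
     levi_civita A g D \<and> smooth_fun A \<beta> \<and>
     (\<forall>X Y. smooth_vfield A X \<and> smooth_vfield A Y \<longrightarrow>
        (\<forall>p. D X (\<lambda>q. f q (Y q)) p - f p (D X Y p) =
             \<beta> p *\<^sub>R (g p (f p (X p)) (Y p) *\<^sub>R xi_bar s \<xi> p - eta_bar s \<eta> p (Y p) *\<^sub>R f p (X p))))"

definition star_eta_ricci_soliton ::
  "('a::topological_space, 'm::finite) chart set \<Rightarrow> nat \<Rightarrow> ('a \<Rightarrow> real ^ 'm \<Rightarrow> real ^ 'm) \<Rightarrow>
     (nat \<Rightarrow> 'a \<Rightarrow> real ^ 'm \<Rightarrow> real) \<Rightarrow> ('a \<Rightarrow> real ^ 'm \<Rightarrow> real ^ 'm \<Rightarrow> real) \<Rightarrow>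
     (('a, 'm) vfield \<Rightarrow> ('a, 'm) vfield \<Rightarrow> ('a, 'm) vfield) \<Rightarrow> ('a, 'm) vfield \<Rightarrow>
     real \<Rightarrow> real \<Rightarrow> bool" where
  "star_eta_ricci_soliton A s f \<eta> g D V l \<mu> \<longleftrightarrow>
     smooth_vfield A V \<and>
     (\<forall>X Y. smooth_vfield A X \<and> smooth_vfield A Y \<longrightarrow>
        (\<forall>p. (1/2) * lie_metric A V g X Y p + star_ricci A D f p (X p) (Y p) =
             l * (g p (X p) (Y p) - (\<Sum>i=1..s. \<eta> i p (X p) * \<eta> i p (Y p)))
             + (l + \<mu>) * (eta_bar s \<eta> p (X p) * eta_bar s \<eta> p (Y p))))"

definition contact_vfield ::
  "('a::topological_space, 'm::finite) chart set \<Rightarrow> nat \<Rightarrow> (nat \<Rightarrow> 'a \<Rightarrow> real ^ 'm \<Rightarrow> real) \<Rightarrow>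
     ('a, 'm) vfield \<Rightarrow> ('a \<Rightarrow> real) \<Rightarrow> bool" where
  "contact_vfield A s \<eta> V \<sigma> \<longleftrightarrow> smooth_vfield A V \<and> smooth_fun A \<sigma> \<and>
     (\<forall>i\<in>{1..s}. \<forall>X. smooth_vfield A X \<longrightarrow>
        (\<forall>p. lie_one_form A V (\<eta> i) X p = \<sigma> p * \<eta> i p (X p)))"

definition eta_Einstein ::
  "('a::topological_space, 'm::finite) chart set \<Rightarrow> nat \<Rightarrow>
     (nat \<Rightarrow> 'a \<Rightarrow> real ^ 'm \<Rightarrow> real) \<Rightarrow> ('a \<Rightarrow> real ^ 'm \<Rightarrow> real ^ 'm \<Rightarrow> real) \<Rightarrow>
     (('a, 'm) vfield \<Rightarrow> ('a, 'm) vfield \<Rightarrow> ('a, 'm) vfield) \<Rightarrow> ('a \<Rightarrow> real) \<Rightarrow> ('a \<Rightarrow> real) \<Rightarrow> bool" where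
  "eta_Einstein A s \<eta> g D a b \<longleftrightarrow> smooth_fun A a \<and> smooth_fun A b \<and>
     (\<forall>p v w. ricci A D p v w = a p * g p v w - a p * (\<Sum>i=1..s. \<eta> i p v * \<eta> i p w)
        + (a p + b p) * (eta_bar s \<eta> p v * eta_bar s \<eta> p w))"

end

theory Submission
  imports Defs
begin

text \<open>
  Put \<open>h X = X - \<Sum>\<^sub>i \<eta>\<^sup>i(X) \<xi>\<^sub>i\<close>. Normality and the formula for \<open>\<nabla>f\<close> give
  \<open>\<nabla>\<^sub>X \<xi>\<^sub>i = \<beta> h X\<close>, hence \<open>R\<^sub>X\<^sub>,\<^sub>Y \<xi>\<^sub>i\<close> and the commutator of \<open>R\<^sub>X\<^sub>,\<^sub>Y\<close> with \<open>f\<close>.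
  Both are matched by an explicit model curvature, that of the metric product of a flat factor
  and a space of constant curvature \<open>- s \<beta>\<^sup>2\<close>. The difference between the curvature and the model
  therefore behaves like a Kaehler curvature tensor, and the first Bianchi identity turns its
  contribution to the star-Ricci tensor into its Ricci contraction composed with \<open>Q\<close>.

  As \<open>s > 1\<close>, evaluating the soliton equation on pairs \<open>\<xi>\<^sub>i, \<xi>\<^sub>j\<close> forces \<open>\<sigma> = \<lambda> + \<mu> = 0\<close>, and
  then \<open>[V, \<xi>\<^sub>i] = 0\<close>. The Lie derivatives along \<open>\<xi>\<^sub>1\<close> and \<open>V\<close> thus commute. Applied to the soliton
  equation, \<open>\<pounds>\<close> along \<open>\<xi>\<^sub>1\<close> yields \<open>\<pounds> Ric\<^sup>* = 2 \<beta> Ric\<^sup>*\<close>; computed from the curvature it yields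
  \<open>\<pounds> Ric\<^sup>* = - 2 s \<beta>\<^sup>3 g(f\<cdot>, f\<cdot>)\<close>. So \<open>Ric\<^sup>* = - s \<beta>\<^sup>2 g(f\<cdot>, f\<cdot>)\<close>, the Ricci contraction of the
  difference tensor vanishes, and \<open>Ric\<close> is that of the model.
\<close>

section \<open>Real analysis: calculus of smooth maps, mixed partial derivatives, cut-offs\<close>

section \<open>Smooth maps between Euclidean spaces\<close>

text \<open>An adapted basis with \<open>f f = -id\<close> on the range of \<open>f\<close> is not
  at hand, since \<open>f f\<close> is \<open>-Q\<close> there; hence the comparison with a model
  that already contains every term obstructing commutation with \<open>f\<close>. The model is read
  off from \<nabla>\<xi>: each \<xi>_i - \<xi>_j is parallel, which gives a flat factor of dimension
  s - 1, and along the unit field \<open>xb / sqrt s\<close> the other 2n directions expand at rate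
  \<beta> sqrt s, as in hyperbolic (2n+1)-space of curvature -s \<beta>^2. Its Ricci tensor and
  trace are the source of a, b and r.

  The Lie derivative argument compares weights. Along \<xi>_1 the horizontal metric scales at rate
  2\<beta>, while the part of star-Ricci beyond the model is invariant, as a Kaehler Ricci tensor is
  under homothety. The soliton equation forces the rate 2\<beta> on it too, so it vanishes because
  \<beta> is not 0.

  The analytic half is dictated by the definitions: brackets are characterised through globally
  smooth functions and curvature is evaluated on chosen extensions, so bump functions, symmetric
  second derivatives and pointwise tensoriality must be supplied.\<close>

lemma has_derivative_cong_open:
  assumes "open S" "\<And>y. y \<in> S \<Longrightarrow> h y = h' y" "x \<in> S"
  shows "(h has_derivative F) (at x) \<longleftrightarrow> (h' has_derivative F) (at x)"
  using assms by (metis (mono_tags, lifting) has_derivative_transform_within_open)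

lemma frechet_derivative_cong_open:
  assumes "open S" "\<And>y. y \<in> S \<Longrightarrow> h y = h' y" "x \<in> S"
  shows "frechet_derivative h (at x) = frechet_derivative h' (at x)"
  using has_derivative_cong_open[OF assms] by (simp add: frechet_derivative_def)

lemma cont_diff_on_cong:
  assumes "open S" "\<And>x. x \<in> S \<Longrightarrow> h x = h' x" "cont_diff_on k S h"
  shows "cont_diff_on k S h'"
  using assms(2,3)
proof (induction k arbitrary: h h')
  case 0
  then show ?case by (simp cong: continuous_on_cong)
next
  case (Suc k)
  have d: "(h has_derivative F) (at x) \<longleftrightarrow> (h' has_derivative F) (at x)" if "x \<in> S" for x F
    using has_derivative_cong_open assms(1) Suc.prems(1) that by blast
  have "h' differentiable (at x)" if "x \<in> S" for x
    using Suc.prems(2) d that by (auto simp: differentiable_def)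
  moreover have "cont_diff_on k S (\<lambda>x. frechet_derivative h' (at x) v)" for v
  proof (rule Suc.IH)
    show "frechet_derivative h (at x) v = frechet_derivative h' (at x) v" if "x \<in> S" for x
      using d[OF that] by (simp add: frechet_derivative_def)
    show "cont_diff_on k S (\<lambda>x. frechet_derivative h (at x) v)" using Suc.prems(2) by simp
  qed
  ultimately show ?case by simp
qed

lemma cont_diff_on_subset: "cont_diff_on k S h \<Longrightarrow> T \<subseteq> S \<Longrightarrow> cont_diff_on k T h"
  by (induction k arbitrary: h) (auto intro: continuous_on_subset)

lemma cont_diff_on_Suc_D: "cont_diff_on (Suc k) S h \<Longrightarrow> cont_diff_on k S h"
proof (induction k arbitrary: h)
  case 0
  then show ?case
    by (auto intro!: continuous_at_imp_continuous_on differentiable_imp_continuous_within)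
next
  case (Suc k)
  then show ?case by (metis cont_diff_on.simps(2))
qed

lemma cont_diff_on_Un:
  assumes "open S" "open T" "cont_diff_on k S h" "cont_diff_on k T h"
  shows "cont_diff_on k (S \<union> T) h"
  using assms(3,4)
  by (induction k arbitrary: h) (auto intro: continuous_on_open_Un assms(1,2))

text \<open>Lets each closure proof name its own derivative: by uniqueness the candidate
  \<open>H x\<close> is the Frechet derivative at every point of \<open>S\<close>, and openness of
  \<open>S\<close> carries its regularity over.\<close>

lemma cont_diff_on_SucI:
  assumes "open S" "\<And>x. x \<in> S \<Longrightarrow> (h has_derivative H x) (at x)"
    and "\<And>v. cont_diff_on k S (\<lambda>x. H x v)"
  shows "cont_diff_on (Suc k) S h"
proof -
  have "frechet_derivative h (at x) = H x" if "x \<in> S" for x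
    using assms(2) that frechet_derivative_at by force
  with assms show ?thesis
    by (auto simp: differentiable_def intro: cont_diff_on_cong[OF assms(1) _ assms(3)])
qed

lemma cont_diff_on_Suc_has_derivative:
  "cont_diff_on (Suc k) S h \<Longrightarrow> x \<in> S \<Longrightarrow> (h has_derivative frechet_derivative h (at x)) (at x)"
  by (simp add: frechet_derivative_works)

lemma cont_diff_on_const [simp]: "open S \<Longrightarrow> cont_diff_on k S (\<lambda>x. c)"
proof (induction k arbitrary: c)
  case (Suc k)
  show ?case by (rule cont_diff_on_SucI[where H = "\<lambda>x v. 0"]) (use Suc in \<open>auto\<close>)
qed simp

lemma cont_diff_on_linear:
  assumes "open S" "bounded_linear L" "cont_diff_on k S h"
  shows "cont_diff_on k S (\<lambda>x. L (h x))"
  using assms(3)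
proof (induction k arbitrary: h)
  case 0
  then show ?case using assms(2) by (auto intro: bounded_linear.continuous_on)
next
  case (Suc k)
  show ?case
  proof (rule cont_diff_on_SucI[where H = "\<lambda>x v. L (frechet_derivative h (at x) v)"])
    show "((\<lambda>x. L (h x)) has_derivative (\<lambda>v. L (frechet_derivative h (at x) v))) (at x)" if "x \<in> S" for x
      using bounded_linear.has_derivative[OF assms(2) cont_diff_on_Suc_has_derivative[OF Suc.prems that]] .
  qed (use Suc assms(1) in auto)
qed

lemma cont_diff_on_add:
  assumes "open S" "cont_diff_on k S h" "cont_diff_on k S h'"
  shows "cont_diff_on k S (\<lambda>x. h x + h' x)"
  using assms(2,3)
proof (induction k arbitrary: h h')
  case 0
  then show ?case by (auto intro: continuous_on_add)
next
  case (Suc k)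
  show ?case
  proof (rule cont_diff_on_SucI[where H = "\<lambda>x v. frechet_derivative h (at x) v + frechet_derivative h' (at x) v"])
    show "((\<lambda>x. h x + h' x) has_derivative
        (\<lambda>v. frechet_derivative h (at x) v + frechet_derivative h' (at x) v)) (at x)" if "x \<in> S" for x
      using Suc.prems that by (intro has_derivative_add cont_diff_on_Suc_has_derivative)
  qed (use Suc assms(1) in auto)
qed

lemma cont_diff_on_sum:
  assumes "open S" "\<And>i. i \<in> I \<Longrightarrow> cont_diff_on k S (h i)"
  shows "cont_diff_on k S (\<lambda>x. \<Sum>i\<in>I. h i x)"
  using assms(2)
  by (induction I rule: infinite_finite_induct) (auto simp: assms(1) intro!: cont_diff_on_add)

lemma cont_diff_on_scaleR:
  assumes "open S" "cont_diff_on k S h" "cont_diff_on k S h'"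
  shows "cont_diff_on k S (\<lambda>x. h x *\<^sub>R h' x)"
  using assms(2,3)
proof (induction k arbitrary: h h')
  case 0
  then show ?case by (auto intro: continuous_on_scaleR)
next
  case (Suc k)
  show ?case
  proof (rule cont_diff_on_SucI[where H = "\<lambda>x v. h x *\<^sub>R frechet_derivative h' (at x) v
      + frechet_derivative h (at x) v *\<^sub>R h' x"])
    show "((\<lambda>x. h x *\<^sub>R h' x) has_derivative
        (\<lambda>v. h x *\<^sub>R frechet_derivative h' (at x) v + frechet_derivative h (at x) v *\<^sub>R h' x)) (at x)"
      if "x \<in> S" for x
      using Suc.prems that by (intro has_derivative_scaleR cont_diff_on_Suc_has_derivative)
    show "cont_diff_on k S (\<lambda>x. h x *\<^sub>R frechet_derivative h' (at x) v
      + frechet_derivative h (at x) v *\<^sub>R h' x)" for v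
      using Suc.prems cont_diff_on_Suc_D[OF Suc.prems(1)] cont_diff_on_Suc_D[OF Suc.prems(2)]
      by (intro cont_diff_on_add Suc.IH assms(1)) auto
  qed (use assms(1) in auto)
qed

lemma cont_diff_on_mult:
  fixes h h' :: "_ \<Rightarrow> real"
  assumes "open S" "cont_diff_on k S h" "cont_diff_on k S h'"
  shows "cont_diff_on k S (\<lambda>x. h x * h' x)"
  using cont_diff_on_scaleR[OF assms] by simp

text \<open>\<open>cont_diff_on\<close> controls the derivative only in a fixed direction. Expanding
  a direction that varies with the point over the basis reduces to finitely many fixed ones.\<close>

lemma linear_Basis_expansion:
  fixes L :: "'e::euclidean_space \<Rightarrow> 'f::real_normed_vector"
  assumes "linear L"
  shows "L w = (\<Sum>b\<in>Basis. (w \<bullet> b) *\<^sub>R L b)"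
proof -
  have "L w = L (\<Sum>b\<in>Basis. (w \<bullet> b) *\<^sub>R b)" by (simp add: euclidean_representation)
  then show ?thesis by (simp add: linear_sum[OF assms] linear_scale[OF assms])
qed

lemma cont_diff_on_compose:
  fixes u :: "'d::euclidean_space \<Rightarrow> 'e::euclidean_space"
  assumes "open S" "open T" "cont_diff_on k S u" "u ` S \<subseteq> T" "cont_diff_on k T h"
  shows "cont_diff_on k S (\<lambda>x. h (u x))"
  \<comment> \<open>The inner map stays fixed and \<open>h\<close> varies: the induction hypothesis
    is applied to the partial derivatives of \<open>h\<close> composed with the same
    \<open>u\<close>.\<close>
  using assms(3,5)
proof (induction k arbitrary: h)
  case 0
  then show ?case using assms(4) continuous_on_compose2 by (metis cont_diff_on.simps(1))
next
  case (Suc k)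
  show ?case
  proof (rule cont_diff_on_SucI[where H = "\<lambda>x v. \<Sum>b\<in>Basis.
      (frechet_derivative u (at x) v \<bullet> b) *\<^sub>R frechet_derivative h (at (u x)) b"])
    show "((\<lambda>x. h (u x)) has_derivative
        (\<lambda>v. \<Sum>b\<in>Basis. (frechet_derivative u (at x) v \<bullet> b) *\<^sub>R frechet_derivative h (at (u x)) b)) (at x)"
      if "x \<in> S" for x
    proof -
      have hd: "(h has_derivative frechet_derivative h (at (u x))) (at (u x))"
        by (rule cont_diff_on_Suc_has_derivative[OF Suc.prems(2)]) (use assms(4) that in auto)
      have "((\<lambda>x. h (u x)) has_derivative
          (\<lambda>v. frechet_derivative h (at (u x)) (frechet_derivative u (at x) v))) (at x)"
        using has_derivative_compose[OF cont_diff_on_Suc_has_derivative[OF Suc.prems(1) that] hd] .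
      moreover have "(\<lambda>v. frechet_derivative h (at (u x)) (frechet_derivative u (at x) v))
          = (\<lambda>v. \<Sum>b\<in>Basis. (frechet_derivative u (at x) v \<bullet> b) *\<^sub>R frechet_derivative h (at (u x)) b)"
        by (rule ext) (rule linear_Basis_expansion[OF has_derivative_linear[OF hd]])
      ultimately show ?thesis by (simp only:)
    qed
    show "cont_diff_on k S (\<lambda>x. \<Sum>b\<in>Basis.
        (frechet_derivative u (at x) v \<bullet> b) *\<^sub>R frechet_derivative h (at (u x)) b)" for v
      using Suc.prems assms(1) cont_diff_on_Suc_D[OF Suc.prems(1)]
      by (intro cont_diff_on_sum cont_diff_on_scaleR Suc.IH
          cont_diff_on_linear[OF _ bounded_linear_inner_left]) auto
  qed (use assms(1) in auto)
qed

lemma cont_diff_on_inverse: "cont_diff_on k {0<..} (inverse :: real \<Rightarrow> real)"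
proof (induction k)
  case 0
  then show ?case by (auto intro!: continuous_intros)
next
  case (Suc k)
  show ?case
  proof (rule cont_diff_on_SucI[where H = "\<lambda>x v. (inverse x * inverse x) * (- v)"])
    show "(inverse has_derivative (\<lambda>v. inverse x * inverse x * - v)) (at x)" if "x \<in> {0<..}" for x :: real
      using that by (auto intro!: derivative_eq_intros)
    show "cont_diff_on k {0<..} (\<lambda>x. inverse x * inverse x * - v)" for v :: real
      using Suc by (intro cont_diff_on_mult) auto
  qed auto
qed

lemma cont_diff_on_id: "open S \<Longrightarrow> cont_diff_on k S (\<lambda>x. x)"
proof (cases k)
  case (Suc m)
  assume "open S"
  then show ?thesis unfolding Suc
    by (intro cont_diff_on_SucI[where H = "\<lambda>x v. v"]) auto
qed simp

lemma smooth_on_cong: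
  "open S \<Longrightarrow> (\<And>x. x \<in> S \<Longrightarrow> h x = h' x) \<Longrightarrow> smooth_on S h \<Longrightarrow> smooth_on S h'"
  unfolding smooth_on_def by (blast intro: cont_diff_on_cong)

lemma smooth_on_subset: "smooth_on S h \<Longrightarrow> T \<subseteq> S \<Longrightarrow> smooth_on T h"
  unfolding smooth_on_def by (blast intro: cont_diff_on_subset)

lemma smooth_on_Un: "open S \<Longrightarrow> open T \<Longrightarrow> smooth_on S h \<Longrightarrow> smooth_on T h \<Longrightarrow> smooth_on (S \<union> T) h"
  unfolding smooth_on_def by (blast intro: cont_diff_on_Un)

lemma smooth_on_const: "open S \<Longrightarrow> smooth_on S (\<lambda>x. c)"
  unfolding smooth_on_def by simp

lemma smooth_on_id: "open S \<Longrightarrow> smooth_on S (\<lambda>x. x)"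
  unfolding smooth_on_def by (simp add: cont_diff_on_id)

lemma smooth_on_linear: "open S \<Longrightarrow> bounded_linear L \<Longrightarrow> smooth_on S h \<Longrightarrow> smooth_on S (\<lambda>x. L (h x))"
  unfolding smooth_on_def by (blast intro: cont_diff_on_linear)

lemma smooth_on_add: "open S \<Longrightarrow> smooth_on S h \<Longrightarrow> smooth_on S h' \<Longrightarrow> smooth_on S (\<lambda>x. h x + h' x)"
  unfolding smooth_on_def by (blast intro: cont_diff_on_add)

lemma smooth_on_sum:
  "open S \<Longrightarrow> (\<And>i. i \<in> I \<Longrightarrow> smooth_on S (h i)) \<Longrightarrow> smooth_on S (\<lambda>x. \<Sum>i\<in>I. h i x)"
  unfolding smooth_on_def by (blast intro: cont_diff_on_sum)

lemma smooth_on_scaleR: "open S \<Longrightarrow> smooth_on S h \<Longrightarrow> smooth_on S h' \<Longrightarrow> smooth_on S (\<lambda>x. h x *\<^sub>R h' x)"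
  unfolding smooth_on_def by (blast intro: cont_diff_on_scaleR)

lemma smooth_on_mult:
  fixes h h' :: "_ \<Rightarrow> real"
  shows "open S \<Longrightarrow> smooth_on S h \<Longrightarrow> smooth_on S h' \<Longrightarrow> smooth_on S (\<lambda>x. h x * h' x)"
  unfolding smooth_on_def by (blast intro: cont_diff_on_mult)

lemma smooth_on_compose:
  fixes u :: "'d::euclidean_space \<Rightarrow> 'e::euclidean_space"
  shows "open S \<Longrightarrow> open T \<Longrightarrow> smooth_on S u \<Longrightarrow> u ` S \<subseteq> T \<Longrightarrow> smooth_on T h
    \<Longrightarrow> smooth_on S (\<lambda>x. h (u x))"
  unfolding smooth_on_def by (blast intro: cont_diff_on_compose)

lemma smooth_on_has_derivative:
  "smooth_on S h \<Longrightarrow> x \<in> S \<Longrightarrow> (h has_derivative frechet_derivative h (at x)) (at x)"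
  unfolding smooth_on_def using cont_diff_on_Suc_has_derivative by blast

lemma smooth_on_frechet_derivative:
  "smooth_on S h \<Longrightarrow> smooth_on S (\<lambda>x. frechet_derivative h (at x) v)"
  unfolding smooth_on_def by (metis cont_diff_on.simps(2))

lemma smooth_on_imp_continuous_on: "smooth_on S h \<Longrightarrow> continuous_on S h"
  unfolding smooth_on_def by (metis cont_diff_on.simps(1))

text \<open>In coordinates this is the derivative of \<open>h\<close> along a vector field
  \<open>w\<close>; it yields smoothness of \<open>X h\<close> and of brackets.\<close>

lemma smooth_on_frechet_derivative_apply:
  fixes h :: "'e::euclidean_space \<Rightarrow> 'f::real_normed_vector"
  assumes "open S" "smooth_on S h" "smooth_on S w"
  shows "smooth_on S (\<lambda>x. frechet_derivative h (at x) (w x))"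
proof (rule smooth_on_cong[OF assms(1)])
  show "(\<Sum>b\<in>Basis. (w x \<bullet> b) *\<^sub>R frechet_derivative h (at x) b) = frechet_derivative h (at x) (w x)"
    if "x \<in> S" for x
    using linear_Basis_expansion has_derivative_linear smooth_on_has_derivative[OF assms(2) that] by metis
  show "smooth_on S (\<lambda>x. \<Sum>b\<in>Basis. (w x \<bullet> b) *\<^sub>R frechet_derivative h (at x) b)"
    by (intro smooth_on_sum smooth_on_scaleR smooth_on_linear[OF _ bounded_linear_inner_left]
        smooth_on_frechet_derivative assms)
qed

section \<open>Symmetry of second derivatives\<close>

text \<open>The mean value theorem is applied twice, in direction \<open>a\<close> to the increment
  of \<open>h\<close> over \<open>s b\<close>, then in direction \<open>b\<close> to the resulting
  derivative. The second difference itself does not distinguish \<open>a\<close> from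
  \<open>b\<close>.\<close>

lemma second_difference_mean_value:
  fixes h :: "'e::euclidean_space \<Rightarrow> real"
  assumes sm: "smooth_on S h" and s: "s > 0"
    and cube: "\<And>u v. 0 \<le> u \<Longrightarrow> u \<le> s \<Longrightarrow> 0 \<le> v \<Longrightarrow> v \<le> s \<Longrightarrow> x + u *\<^sub>R a + v *\<^sub>R b \<in> S"
  shows "\<exists>u v. 0 < u \<and> u < s \<and> 0 < v \<and> v < s \<and>
    h (x + s *\<^sub>R a + s *\<^sub>R b) - h (x + s *\<^sub>R a) - h (x + s *\<^sub>R b) + h x
      = s * s * frechet_derivative (\<lambda>y. frechet_derivative h (at y) a) (at (x + u *\<^sub>R a + v *\<^sub>R b)) b"
proof -
  let ?D = "\<lambda>y. frechet_derivative h (at y)"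
  let ?\<phi> = "\<lambda>u. h (x + u *\<^sub>R a + s *\<^sub>R b) - h (x + u *\<^sub>R a)"
  have d: "((\<lambda>u. h (x + u *\<^sub>R a + c *\<^sub>R b)) has_real_derivative ?D (x + u *\<^sub>R a + c *\<^sub>R b) a) (at u)"
    if "0 \<le> u" "u \<le> s" "0 \<le> c" "c \<le> s" for u c
  proof -
    have "((\<lambda>u. h (x + u *\<^sub>R a + c *\<^sub>R b)) has_derivative
        (\<lambda>t. ?D (x + u *\<^sub>R a + c *\<^sub>R b) (t *\<^sub>R a))) (at u)"
      by (rule has_derivative_compose[where g = h])
        (use smooth_on_has_derivative[OF sm cube[OF that]] in \<open>auto intro!: derivative_eq_intros\<close>)
    moreover have "(\<lambda>t. ?D (x + u *\<^sub>R a + c *\<^sub>R b) (t *\<^sub>R a)) = (*) (?D (x + u *\<^sub>R a + c *\<^sub>R b) a)"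
      using has_derivative_linear[OF smooth_on_has_derivative[OF sm cube[OF that]]]
      by (simp add: linear_scale fun_eq_iff)
    ultimately show ?thesis by (simp add: has_field_derivative_def)
  qed
  have d\<phi>: "(?\<phi> has_real_derivative (?D (x + u *\<^sub>R a + s *\<^sub>R b) a - ?D (x + u *\<^sub>R a) a)) (at u)"
    if "0 \<le> u" "u \<le> s" for u
    using DERIV_diff[OF d[of u s] d[of u 0]] that s by simp
  obtain u where u: "0 < u" "u < s"
    and e1: "?\<phi> s - ?\<phi> 0 = (s - 0) * (?D (x + u *\<^sub>R a + s *\<^sub>R b) a - ?D (x + u *\<^sub>R a) a)"
    using MVT2[OF s, of ?\<phi> "\<lambda>u. ?D (x + u *\<^sub>R a + s *\<^sub>R b) a - ?D (x + u *\<^sub>R a) a"] d\<phi> by blast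
  let ?\<psi> = "\<lambda>v. ?D (x + u *\<^sub>R a + v *\<^sub>R b) a"
  let ?DD = "\<lambda>y. frechet_derivative (\<lambda>y. ?D y a) (at y)"
  have d\<psi>: "(?\<psi> has_real_derivative ?DD (x + u *\<^sub>R a + v *\<^sub>R b) b) (at v)" if "0 \<le> v" "v \<le> s" for v
  proof -
    have 1: "((\<lambda>y. ?D y a) has_derivative ?DD (x + u *\<^sub>R a + v *\<^sub>R b)) (at (x + u *\<^sub>R a + v *\<^sub>R b))"
      using u that by (intro smooth_on_has_derivative[OF smooth_on_frechet_derivative[OF sm]] cube) auto
    have "(?\<psi> has_derivative (\<lambda>t. ?DD (x + u *\<^sub>R a + v *\<^sub>R b) (t *\<^sub>R b))) (at v)"
      by (rule has_derivative_compose[where g = "\<lambda>y. ?D y a"])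
        (use 1 in \<open>auto intro!: derivative_eq_intros\<close>)
    moreover have "(\<lambda>t. ?DD (x + u *\<^sub>R a + v *\<^sub>R b) (t *\<^sub>R b)) = (*) (?DD (x + u *\<^sub>R a + v *\<^sub>R b) b)"
      using has_derivative_linear[OF 1] by (simp add: linear_scale fun_eq_iff)
    ultimately show ?thesis by (simp add: has_field_derivative_def)
  qed
  obtain v where v: "0 < v" "v < s"
    and e2: "?\<psi> s - ?\<psi> 0 = (s - 0) * ?DD (x + u *\<^sub>R a + v *\<^sub>R b) b"
    using MVT2[OF s, of ?\<psi> "\<lambda>v. ?DD (x + u *\<^sub>R a + v *\<^sub>R b) b"] d\<psi> by blast
  show ?thesis
    using u v e1 e2 by (intro exI[of _ u] exI[of _ v]) simp
qed

text \<open>The normalised second difference equals either mixed derivative at nearby points, so by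
  continuity it converges to both of them.\<close>

lemma second_derivative_symmetric:
  fixes h :: "'e::euclidean_space \<Rightarrow> real"
  assumes S: "open S" and sm: "smooth_on S h" and x: "x \<in> S"
  shows "frechet_derivative (\<lambda>y. frechet_derivative h (at y) a) (at x) b
       = frechet_derivative (\<lambda>y. frechet_derivative h (at y) b) (at x) a"
proof -
  define H where "H = (\<lambda>a b y. frechet_derivative (\<lambda>y. frechet_derivative h (at y) a) (at y) b)"
  have cont: "isCont (H a b) x" for a b
    unfolding H_def
    using smooth_on_imp_continuous_on[OF smooth_on_frechet_derivative[OF smooth_on_frechet_derivative[OF sm]]]
      S x continuous_on_eq_continuous_at by blast
  obtain r where r: "r > 0" "ball x r \<subseteq> S" using S x openE by blast
  \<comment> \<open>A null sequence small enough for the parallelogram spanned by \<open>s n\<close>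
    times \<open>a\<close> and \<open>b\<close> to stay in the ball; the added 1 keeps the
    denominator positive if \<open>a\<close> and \<open>b\<close> vanish.\<close>
  define s where "s = (\<lambda>n::nat. r / (norm a + norm b + 1) / (real n + 1))"
  have pos: "norm a + norm b + 1 > 0" by (smt (verit) norm_ge_zero)
  have s0: "s n > 0" for n using r pos unfolding s_def by (intro divide_pos_pos) auto
  have sr: "s n * (norm a + norm b) < r" for n
  proof -
    have "s n \<le> r / (norm a + norm b + 1)"
      unfolding s_def using r pos by (simp add: divide_le_eq)
    then have "s n * (norm a + norm b + 1) \<le> r" using pos by (simp add: pos_le_divide_eq)
    then show ?thesis using s0[of n] by (simp add: algebra_simps)
  qed
  have s_lim: "s \<longlonglongrightarrow> 0"
    unfolding s_def
    using tendsto_mult[OF tendsto_const[of "r / (norm a + norm b + 1)"] LIMSEQ_inverse_real_of_nat]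
    by (simp add: divide_inverse add.commute)
  have nrm: "norm (u *\<^sub>R a + v *\<^sub>R b) \<le> s n * (norm a + norm b)"
    if "0 \<le> u" "u \<le> s n" "0 \<le> v" "v \<le> s n" for u v n
  proof -
    have "norm (u *\<^sub>R a + v *\<^sub>R b) \<le> u * norm a + v * norm b"
      by (rule norm_triangle_le) (use that in simp)
    also have "\<dots> \<le> s n * norm a + s n * norm b" using that by (intro add_mono mult_right_mono) auto
    finally show ?thesis by (simp add: algebra_simps)
  qed
  have inS: "x + u *\<^sub>R a + v *\<^sub>R b \<in> S" if "0 \<le> u" "u \<le> s n" "0 \<le> v" "v \<le> s n" for u v n
  proof -
    have "norm (u *\<^sub>R a + v *\<^sub>R b) < r" using nrm[OF that] sr[of n] by linarith
    then have "x + u *\<^sub>R a + v *\<^sub>R b \<in> ball x r" by (metis add.assoc add_diff_cancel_left' dist_commute dist_norm mem_ball)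
    with r show ?thesis by blast
  qed
  have inS': "x + u *\<^sub>R b + v *\<^sub>R a \<in> S" if "0 \<le> u" "u \<le> s n" "0 \<le> v" "v \<le> s n" for u v n
    using inS[OF that(3,4,1,2)] by (simp add: add.assoc add.commute[of "u *\<^sub>R b"])
  define \<Delta> where "\<Delta> = (\<lambda>n. h (x + s n *\<^sub>R a + s n *\<^sub>R b) - h (x + s n *\<^sub>R a) - h (x + s n *\<^sub>R b) + h x)"
  have key: "\<exists>y. dist y x \<le> s n * (norm a + norm b) \<and> \<Delta> n = s n * s n * H a b y" for n
  proof -
    obtain u v where uv: "0 < u" "u < s n" "0 < v" "v < s n"
      "\<Delta> n = s n * s n * H a b (x + u *\<^sub>R a + v *\<^sub>R b)"
      unfolding \<Delta>_def H_def using second_difference_mean_value[OF sm s0[of n], of x a b] inS[of _ n] by blast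
    show ?thesis
      by (rule exI[of _ "x + u *\<^sub>R a + v *\<^sub>R b"])
        (use uv nrm[of u n v] in \<open>auto simp: dist_norm add.assoc\<close>)
  qed
  have key': "\<exists>y. dist y x \<le> s n * (norm a + norm b) \<and> \<Delta> n = s n * s n * H b a y" for n
  proof -
    obtain u v where uv: "0 < u" "u < s n" "0 < v" "v < s n"
      "h (x + s n *\<^sub>R b + s n *\<^sub>R a) - h (x + s n *\<^sub>R b) - h (x + s n *\<^sub>R a) + h x
        = s n * s n * H b a (x + u *\<^sub>R b + v *\<^sub>R a)"
      unfolding H_def using second_difference_mean_value[OF sm s0[of n], of x b a] inS'[of _ n] by blast
    show ?thesis
      by (rule exI[of _ "x + u *\<^sub>R b + v *\<^sub>R a"])
        (use uv nrm[of v n u] in \<open>auto simp: dist_norm \<Delta>_def algebra_simps\<close>)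
  qed
  have bound_lim: "(\<lambda>n. s n * (norm a + norm b)) \<longlonglongrightarrow> 0"
    using tendsto_mult_right[OF s_lim, of "norm a + norm b"] by simp
  have lim: "(\<lambda>n. \<Delta> n / (s n * s n)) \<longlonglongrightarrow> H c d x"
    if k: "\<And>n. \<exists>y. dist y x \<le> s n * (norm a + norm b) \<and> \<Delta> n = s n * s n * H c d y" for c d
  proof -
    obtain y where y: "\<And>n. dist (y n) x \<le> s n * (norm a + norm b)" "\<And>n. \<Delta> n = s n * s n * H c d (y n)"
      using k by metis
    have "(\<lambda>n. dist (y n) x) \<longlonglongrightarrow> 0"
      by (rule tendsto_sandwich[OF _ _ tendsto_const bound_lim]) (use y in auto)
    then have "y \<longlonglongrightarrow> x" using tendsto_dist_iff by blast
    then have "(\<lambda>n. H c d (y n)) \<longlonglongrightarrow> H c d x" using cont isCont_tendsto_compose by blast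
    moreover have "H c d (y n) = \<Delta> n / (s n * s n)" for n using y(2)[of n] s0[of n] by simp
    ultimately show ?thesis by simp
  qed
  show ?thesis
    using LIMSEQ_unique[OF lim[OF key] lim[OF key']] by (simp add: H_def)
qed

section \<open>Bump functions\<close>

text \<open>The case \<open>n = 0\<close> is the classical function flat at 0. The factors
  \<open>inverse x ^ n\<close> make the family closed under differentiation up to linear
  combinations, so one induction treats all derivatives.\<close>

definition flat_exp :: "nat \<Rightarrow> real \<Rightarrow> real" where
  "flat_exp n x = (if x > 0 then inverse x ^ n * exp (- inverse x) else 0)"

lemma flat_exp_tendsto_0: "(flat_exp n \<longlongrightarrow> 0) (at 0)"
proof -
  have r: "((\<lambda>x. inverse x ^ n * exp (- inverse x)) \<longlongrightarrow> (0::real)) (at_right 0)"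
  proof -
    have "((\<lambda>y::real. y ^ n / exp y) \<longlongrightarrow> 0) at_top" by (rule tendsto_power_div_exp_0)
    from filterlim_compose[OF this filterlim_inverse_at_top_right]
    show ?thesis by (simp add: exp_minus divide_inverse)
  qed
  have "(flat_exp n \<longlongrightarrow> 0) (at_right 0)"
    using r by (rule Lim_transform_eventually) (auto simp: flat_exp_def eventually_at_filter)
  moreover have "(flat_exp n \<longlongrightarrow> 0) (at_left 0)"
    by (rule Lim_transform_eventually[OF tendsto_const]) (auto simp: flat_exp_def eventually_at_filter)
  ultimately show ?thesis using filterlim_split_at by blast
qed

lemma flat_exp_derivative:
  "(flat_exp n has_real_derivative (flat_exp (n + 2) x - real n * flat_exp (n + 1) x)) (at x)"
proof (cases x "0::real" rule: linorder_cases)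
  case less
  have "((\<lambda>x. 0) has_real_derivative 0) (at x)" by simp
  then have "(flat_exp n has_real_derivative 0) (at x)"
    by (rule has_field_derivative_transform_within_open[where S = "{..<0}"]) (use less in \<open>auto simp: flat_exp_def\<close>)
  then show ?thesis using less by (simp add: flat_exp_def)
next
  case equal
  \<comment> \<open>At 0 the difference quotient of \<open>flat_exp n\<close> is
    \<open>flat_exp (n + 1)\<close>, whose limit is known.\<close>
  have "((\<lambda>y. (flat_exp n y - flat_exp n 0) / (y - 0)) \<longlongrightarrow> 0) (at 0)"
    by (rule Lim_transform_eventually[OF flat_exp_tendsto_0[of "n + 1"]])
      (auto simp: flat_exp_def divide_inverse)
  then show ?thesis using equal by (simp add: has_field_derivative_iff flat_exp_def)
next
  case greater
  have i: "(inverse has_real_derivative - (inverse x * inverse x)) (at x)"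
    using greater by (auto intro!: derivative_eq_intros)
  have e: "((\<lambda>x. exp (- inverse x)) has_real_derivative exp (- inverse x) * (inverse x * inverse x)) (at x)"
    using greater by (auto intro!: derivative_eq_intros)
  have "((\<lambda>x. inverse x ^ n * exp (- inverse x)) has_real_derivative
      (flat_exp (n + 2) x - real n * flat_exp (n + 1) x)) (at x)"
  proof (cases n)
    case 0
    then show ?thesis using e greater by (simp add: flat_exp_def mult.commute mult.left_commute)
  next
    case (Suc m)
    have "((\<lambda>x. inverse x ^ Suc m) has_real_derivative
        (1 + real m) * (- (inverse x * inverse x) * inverse x ^ m)) (at x)"
      using DERIV_power_Suc[OF i] by simp
    from DERIV_mult[OF this e] show ?thesis
      using greater unfolding Suc by (simp add: flat_exp_def algebra_simps)
  qed
  then show ?thesis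
    by (rule has_field_derivative_transform_within_open[where S = "{0<..}"])
      (use greater in \<open>auto simp: flat_exp_def\<close>)
qed

lemma smooth_on_flat_exp: "smooth_on UNIV (flat_exp n)"
proof -
  have "cont_diff_on k UNIV (flat_exp n)" for k
  proof (induction k arbitrary: n)
    case 0
    show ?case
      by (auto intro!: continuous_at_imp_continuous_on DERIV_isCont flat_exp_derivative)
  next
    case (Suc k)
    show ?case
    proof (rule cont_diff_on_SucI[where H = "\<lambda>x v. (flat_exp (n + 2) x + (- real n) * flat_exp (n + 1) x) * v"])
      show "(flat_exp n has_derivative
          (*) (flat_exp (n + 2) x + (- real n) * flat_exp (n + 1) x)) (at x)" for x
        using flat_exp_derivative[of n x] by (simp add: has_field_derivative_def)
      show "cont_diff_on k UNIV (\<lambda>x. (flat_exp (n + 2) x + (- real n) * flat_exp (n + 1) x) * v)" for v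
        by (intro cont_diff_on_mult cont_diff_on_add Suc) auto
    qed auto
  qed
  then show ?thesis by (simp add: smooth_on_def)
qed

definition smooth_step :: "real \<Rightarrow> real" where
  "smooth_step t = flat_exp 0 t * inverse (flat_exp 0 t + flat_exp 0 (1 - t))"

lemma smooth_step_eq_0: "t \<le> 0 \<Longrightarrow> smooth_step t = 0"
  by (simp add: smooth_step_def flat_exp_def)

lemma smooth_step_eq_1: "t \<ge> 1 \<Longrightarrow> smooth_step t = 1"
  by (simp add: smooth_step_def flat_exp_def)

lemma smooth_on_smooth_step: "smooth_on UNIV smooth_step"
proof -
  \<comment> \<open>At least one of \<open>t\<close> and \<open>1 - t\<close> is positive.\<close>
  have pos: "flat_exp 0 t + flat_exp 0 (1 - t) > 0" for t
    unfolding flat_exp_def by (auto intro: add_pos_pos add_pos_nonneg add_nonneg_pos)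
  have "smooth_on UNIV (\<lambda>t::real. 1 + - t)"
    by (rule smooth_on_add[OF _ smooth_on_const smooth_on_linear[OF _ bounded_linear_minus[OF bounded_linear_ident] smooth_on_id]]) auto
  from smooth_on_compose[OF open_UNIV open_UNIV this _ smooth_on_flat_exp]
  have "smooth_on UNIV (\<lambda>t. flat_exp 0 (1 - t))" by simp
  then have "smooth_on UNIV (\<lambda>t. flat_exp 0 t + flat_exp 0 (1 - t))"
    by (intro smooth_on_add smooth_on_flat_exp) auto
  moreover have "smooth_on {0<..} (inverse :: real \<Rightarrow> real)"
    by (simp add: smooth_on_def cont_diff_on_inverse)
  ultimately have "smooth_on UNIV (\<lambda>t. inverse (flat_exp 0 t + flat_exp 0 (1 - t)))"
    using pos by (intro smooth_on_compose[of UNIV "{0<..}" _ inverse]) auto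
  then have "smooth_on UNIV (\<lambda>t. smooth_step t)"
    unfolding smooth_step_def by (intro smooth_on_mult smooth_on_flat_exp) auto
  then show ?thesis by simp
qed

text \<open>The argument of the step is at least 1 within radius \<open>r\<close> and at most 0
  beyond \<open>sqrt 2 * r\<close>, hence outside \<open>ball a (2 * r)\<close>. The squared norm
  keeps it smooth at the centre.\<close>

definition ball_bump :: "'e::euclidean_space \<Rightarrow> real \<Rightarrow> 'e \<Rightarrow> real" where
  "ball_bump a r x = smooth_step (2 - (x - a) \<bullet> (x - a) / r\<^sup>2)"

lemma ball_bump_eq_1:
  assumes "r > 0" "x \<in> ball a r"
  shows "ball_bump a r x = 1"
proof -
  have "(x - a) \<bullet> (x - a) \<le> r\<^sup>2"
    using assms by (simp add: dot_square_norm dist_norm norm_minus_commute power_mono)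
  then show ?thesis using assms(1) by (simp add: ball_bump_def smooth_step_eq_1 divide_le_eq)
qed

lemma ball_bump_eq_0:
  assumes "r > 0" "x \<notin> ball a (2 * r)"
  shows "ball_bump a r x = 0"
proof -
  have "(2 * r)\<^sup>2 \<le> (norm (x - a))\<^sup>2"
    using assms by (intro power_mono) (auto simp: dist_norm norm_minus_commute)
  then have "2 * r\<^sup>2 \<le> (x - a) \<bullet> (x - a)"
    using assms(1) by (simp add: dot_square_norm power_mult_distrib) (smt (verit) zero_le_power2)
  then show ?thesis using assms(1) by (simp add: ball_bump_def smooth_step_eq_0 le_divide_eq)
qed

lemma smooth_on_ball_bump: "smooth_on UNIV (ball_bump (a :: 'e::euclidean_space) r)"
proof -
  have c: "smooth_on UNIV (\<lambda>x::'e. (x - a) \<bullet> b)" for b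
    using smooth_on_linear[OF _ bounded_linear_inner_left[of b]
        smooth_on_add[OF _ smooth_on_id smooth_on_const[of UNIV "- a"]]] by simp
  have 1: "smooth_on UNIV (\<lambda>x::'e. 2 + (- inverse (r\<^sup>2)) * (\<Sum>b\<in>Basis. ((x - a) \<bullet> b) * ((x - a) \<bullet> b)))"
    by (intro smooth_on_add smooth_on_mult smooth_on_sum c smooth_on_const) auto
  have eq: "2 + (- inverse (r\<^sup>2)) * (\<Sum>b\<in>Basis. ((x - a) \<bullet> b) * ((x - a) \<bullet> b))
      = 2 - (x - a) \<bullet> (x - a) / r\<^sup>2" for x :: 'e
  proof -
    have "2 + (- inverse c) * S = 2 - S / c" for c S :: real by (simp add: divide_inverse)
    from this[of "r\<^sup>2" "(x - a) \<bullet> (x - a)"] show ?thesis by (simp only: euclidean_inner[of "x - a" "x - a"])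
  qed
  have "smooth_on UNIV (\<lambda>x::'e. 2 - (x - a) \<bullet> (x - a) / r\<^sup>2)"
    by (rule smooth_on_cong[OF open_UNIV eq 1])
  from smooth_on_compose[OF open_UNIV open_UNIV this _ smooth_on_smooth_step]
  have "smooth_on UNIV (\<lambda>x. ball_bump a r x)" by (simp add: ball_bump_def)
  then show ?thesis by simp
qed

section \<open>Linear algebra of a single tangent space\<close>

section \<open>Traces of endomorphisms\<close>

lemma endo_trace_alt: "endo_trace T = (\<Sum>i\<in>UNIV. T (axis i 1) $ i)"
  by (simp add: endo_trace_def trace_def matrix_def)

lemma endo_trace_add: "endo_trace (\<lambda>v. S v + T v) = endo_trace S + endo_trace T"
  and endo_trace_diff: "endo_trace (\<lambda>v. S v - T v) = endo_trace S - endo_trace T"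
  and endo_trace_minus: "endo_trace (\<lambda>v. - T v) = - endo_trace T"
  and endo_trace_scaleR: "endo_trace (\<lambda>v. k *\<^sub>R T v) = k * endo_trace T"
  by (simp_all add: endo_trace_alt sum.distrib sum_subtractf sum_negf sum_distrib_left)

lemma endo_trace_sum: "endo_trace (\<lambda>v. \<Sum>i\<in>I. T i v) = (\<Sum>i\<in>I. endo_trace (T i))"
  by (simp add: endo_trace_alt) (subst sum.swap, rule refl)

lemma vec_eq_sum_axis: "(v :: real ^ 'm) = (\<Sum>i\<in>UNIV. v $ i *\<^sub>R axis i 1)"
  by (simp add: vec_eq_iff axis_def if_distrib cong: if_cong)

lemma linear_eq_sum_axis:
  assumes "linear L"
  shows "L v = (\<Sum>i\<in>UNIV. v $ i *\<^sub>R L (axis i 1))"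
proof -
  have "L v = L (\<Sum>i\<in>UNIV. v $ i *\<^sub>R axis i 1)" by (rule arg_cong[OF vec_eq_sum_axis])
  also have "\<dots> = (\<Sum>i\<in>UNIV. v $ i *\<^sub>R L (axis i 1))"
    by (simp only: linear_sum[OF assms] linear_scale[OF assms])
  finally show ?thesis .
qed

lemma endo_trace_rank_one:
  assumes "linear \<phi>"
  shows "endo_trace (\<lambda>v. \<phi> v *\<^sub>R w) = \<phi> w"
  unfolding endo_trace_alt linear_eq_sum_axis[OF assms, of w] by (simp add: mult.commute)

text \<open>The resolution of the identity writes \<open>T\<close> as a sum of rank-one maps
  \<open>\<theta> j\<close> times \<open>T (E j)\<close>. It serves to take traces in a local frame,
  with the differentials of the coordinates as dual forms.\<close>

lemma endo_trace_dual:
  assumes T: "linear T" and \<theta>: "\<And>j. linear (\<theta> j)" and e: "\<And>v. v = (\<Sum>j\<in>J. \<theta> j v *\<^sub>R E j)"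
  shows "endo_trace T = (\<Sum>j\<in>J. \<theta> j (T (E j)))"
proof -
  have "T v = (\<Sum>j\<in>J. \<theta> j v *\<^sub>R T (E j))" for v
  proof -
    have "T v = T (\<Sum>j\<in>J. \<theta> j v *\<^sub>R E j)" by (rule arg_cong[OF e])
    also have "\<dots> = (\<Sum>j\<in>J. \<theta> j v *\<^sub>R T (E j))"
      by (simp only: linear_sum[OF T] linear_scale[OF T])
    finally show ?thesis .
  qed
  then have "T = (\<lambda>v. \<Sum>j\<in>J. \<theta> j v *\<^sub>R T (E j))" by blast
  then have "endo_trace T = endo_trace (\<lambda>v. \<Sum>j\<in>J. \<theta> j v *\<^sub>R T (E j))" by (rule arg_cong)
  then show ?thesis by (simp only: endo_trace_sum endo_trace_rank_one[OF \<theta>])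
qed

lemma endo_trace_commute:
  assumes "linear S" "linear T"
  shows "endo_trace (\<lambda>v. S (T v)) = endo_trace (\<lambda>v. T (S v))"
  using matrix_compose[OF assms(2,1)] matrix_compose[OF assms] trace_mul_sym[of "matrix S" "matrix T"]
  by (simp add: endo_trace_def comp_def)

lemma endo_trace_ident: "endo_trace (\<lambda>v :: real ^ 'm. v) = real CARD('m)"
  by (simp add: endo_trace_alt)

section \<open>Algebraic curvature tensors\<close>

locale pos_def_form =
  fixes g :: "real ^ 'm \<Rightarrow> real ^ 'm \<Rightarrow> real"
  assumes bilinear: "bilinear g" and sym: "g v w = g w v" and pos: "v \<noteq> 0 \<Longrightarrow> g v v > 0"
begin

lemmas form_expand = bilinear_ladd[OF bilinear] bilinear_radd[OF bilinear] bilinear_lsub[OF bilinear]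
  bilinear_rsub[OF bilinear] bilinear_lmul[OF bilinear] bilinear_rmul[OF bilinear]
  bilinear_lneg[OF bilinear] bilinear_rneg[OF bilinear] bilinear_lzero[OF bilinear] bilinear_rzero[OF bilinear]

lemma linear_form: "linear (g v)" "linear (\<lambda>v. g v w)"
  using bilinear by (simp_all add: bilinear_def)

lemma form_eqI:
  assumes "\<And>w. g v w = g v' w"
  shows "v = v'"
proof (rule ccontr)
  assume "v \<noteq> v'"
  then have "g (v - v') (v - v') > 0" using pos[of "v - v'"] by simp
  then show False using assms[of "v - v'"] by (simp add: form_expand)
qed

lemma form_sum_axis: "g v w = (\<Sum>i\<in>UNIV. w $ i * g v (axis i 1))"
  using linear_eq_sum_axis[OF linear_form(1), of v w] by simp

text \<open>Conjugation by the Gram map \<open>G\<close> turns the \<open>g\<close>-adjoint into the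
  Euclidean adjoint, and neither conjugation nor transposition changes a trace.\<close>

lemma endo_trace_adjoint:
  assumes S: "linear S" and T: "linear T" and ad: "\<And>v w. g (S v) w = g v (T w)"
  shows "endo_trace S = endo_trace T"
proof -
  define G where "G = (\<lambda>v. \<chi> i. g v (axis i 1))"
  have G: "linear G" unfolding G_def by (rule linearI) (simp_all add: vec_eq_iff form_expand)
  have Gi: "G v \<bullet> w = g v w" for v w
    unfolding form_sum_axis[of v w] by (simp add: G_def inner_vec_def mult.commute)
  have "inj G"
  proof (rule injI)
    fix v w assume "G v = G w"
    then show "v = w" by (intro form_eqI) (simp flip: Gi)
  qed
  then obtain H where H: "linear H" "\<And>v. H (G v) = v" "\<And>v. G (H v) = v"
    using linear_injective_isomorphism[OF G] by blast
  have GS: "G (S v) = adjoint T (G v)" for v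
  proof (rule vector_eq_ldot[THEN iffD1], rule allI)
    fix w
    have "w \<bullet> G (S v) = G v \<bullet> T w" by (simp only: inner_commute[of w] Gi ad)
    also have "\<dots> = w \<bullet> adjoint T (G v)" by (simp only: adjoint_works[OF T] inner_commute[of "G v"])
    finally show "w \<bullet> G (S v) = w \<bullet> adjoint T (G v)" .
  qed
  have "endo_trace S = endo_trace (\<lambda>v. H (G (S v)))" by (simp add: H)
  also have "\<dots> = endo_trace (\<lambda>v. G (S (H v)))"
    by (rule endo_trace_commute[OF H(1) linear_compose[OF S G, unfolded comp_def]])
  also have "\<dots> = endo_trace (adjoint T)" by (simp add: GS H)
  also have "\<dots> = endo_trace T"
  proof -
    have "adjoint T (axis i 1) $ i = T (axis i 1) $ i" for i
    proof -
      have "adjoint T (axis i 1) $ i = axis i 1 \<bullet> adjoint T (axis i 1)" by (simp add: inner_axis')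
      also have "\<dots> = T (axis i 1) \<bullet> axis i 1" by (simp add: adjoint_works[OF T])
      also have "\<dots> = T (axis i 1) $ i" by (simp add: inner_axis)
      finally show ?thesis .
    qed
    then show ?thesis by (simp add: endo_trace_alt)
  qed
  finally show ?thesis .
qed

text \<open>The inverse Gram matrix cancels the Gram matrix contained in \<open>g v (T w)\<close>.
  This reduces the scalar curvature to the trace of the Ricci operator.\<close>

lemma metric_trace_endo:
  assumes T: "linear T"
  shows "metric_trace g (\<lambda>v w. g v (T w)) = endo_trace T"
proof -
  define G where "G = (\<chi> k l. g (axis k 1) (axis l 1))"
  have Gv: "G *v v = (\<chi> k. g (axis k 1) v)" for v
    unfolding form_sum_axis[of _ v] by (simp add: G_def matrix_vector_mult_def vec_eq_iff mult.commute)
  have "invertible G"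
    unfolding invertible_left_inverse matrix_left_invertible_ker
  proof (intro allI impI)
    fix v assume "G *v v = 0"
    then have "g (axis k 1) v = 0" for k unfolding Gv by (simp add: vec_eq_iff)
    then have "g v v = 0" by (simp add: form_sum_axis[of v v] sym[of v "axis _ 1"])
    then show "v = 0" using pos[of v] by (cases "v = 0") auto
  qed
  then have "G ** matrix_inv G = mat 1"
    unfolding invertible_def matrix_inv_def by (rule someI2_ex) blast
  then have inv: "(\<Sum>i\<in>UNIV. G $ k $ i * matrix_inv G $ i $ j) = (if k = j then 1 else 0)" for k j
    by (simp add: vec_eq_iff matrix_matrix_mult_def mat_def)
  have "metric_trace g (\<lambda>v w. g v (T w))
      = (\<Sum>i\<in>UNIV. \<Sum>j\<in>UNIV. \<Sum>k\<in>UNIV. T (axis j 1) $ k * (G $ k $ i * matrix_inv G $ i $ j))"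
    unfolding metric_trace_def form_sum_axis[of _ "T _"]
    by (simp add: G_def[symmetric] sum_distrib_left) (simp add: G_def sym mult_ac)
  also have "\<dots> = (\<Sum>j\<in>UNIV. \<Sum>k\<in>UNIV. \<Sum>i\<in>UNIV. T (axis j 1) $ k * (G $ k $ i * matrix_inv G $ i $ j))"
    by (subst sum.swap, rule sum.cong[OF refl], subst sum.swap, rule refl)
  also have "\<dots> = endo_trace T"
    by (simp add: sum_distrib_left[symmetric] inv endo_trace_alt if_distrib cong: if_cong)
  finally show ?thesis .
qed

end

text \<open>The pointwise symmetries are isolated because two tensors have them: the curvature and
  its difference from the model.\<close>

locale algebraic_curvature = pos_def_form g for g :: "real ^ 'm \<Rightarrow> real ^ 'm \<Rightarrow> real" +
  fixes R :: "real ^ 'm \<Rightarrow> real ^ 'm \<Rightarrow> real ^ 'm \<Rightarrow> real ^ 'm"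
  assumes linear_1: "linear (\<lambda>u. R u v w)" and linear_2: "linear (\<lambda>v. R u v w)"
    and linear_3: "linear (\<lambda>w. R u v w)"
    and skew: "R u v w = - R v u w"
    and bianchi: "R u v w + R v w u + R w u v = 0"
    and skew_form: "g (R u v w) z = - g (R u v z) w"
begin

definition ric :: "real ^ 'm \<Rightarrow> real ^ 'm \<Rightarrow> real" where
  "ric x y = endo_trace (\<lambda>z. R z x y)"

text \<open>The octahedron argument: a linear combination of the four Bianchi sums for the cyclic
  shifts of \<open>u v w z\<close>, reduced by the two antisymmetries.\<close>

lemma pair_symmetry: "g (R u v w) z = g (R w z u) v"
proof -
  have b: "g (R a b c) d + g (R b c a) d + g (R c a b) d = 0" for a b c d
  proof -
    have "g (R a b c + R b c a + R c a b) d = 0" by (simp only: bianchi form_expand(9))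
    then show ?thesis by (simp only: form_expand(1))
  qed
  have s: "g (R a b c) d = - g (R b a c) d" for a b c d
    unfolding skew[of a b c] by (simp only: form_expand(7))
  show ?thesis
    using b[of u v w z] b[of v w z u] b[of w z u v] b[of z u v w]
      s[of u v w z] s[of v w u z] s[of w u v z] s[of v w z u] s[of w z v u] s[of z v w u]
      s[of w z u v] s[of z u w v] s[of u w z v] s[of z u v w] s[of u v z w] s[of v z u w]
      skew_form[of u v w z] skew_form[of v w u z] skew_form[of w u v z]
      skew_form[of w z u v] skew_form[of z u w v] skew_form[of v z u w]
    by linarith
qed

text \<open>By pair symmetry the two endomorphisms under the trace are adjoint to each other with
  respect to \<open>g\<close>.\<close>

lemma ric_sym: "ric x y = ric y x"
  unfolding ric_def
proof (rule endo_trace_adjoint[OF linear_1 linear_1])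
  fix v w
  have "g (R v x y) w = g (R y w v) x" by (rule pair_symmetry)
  also have "\<dots> = - g (R w y v) x" unfolding skew[of y w v] by (simp only: form_expand(7))
  also have "\<dots> = g (R w y x) v" using skew_form[of w y v x] by simp
  finally show "g (R v x y) w = g v (R w y x)" by (simp only: sym[of v])
qed

lemma linear_ric: "linear (ric x)"
proof (rule linearI)
  show "ric x (y + y') = ric x y + ric x y'" for y y'
    unfolding ric_def linear_add[OF linear_3] by (rule endo_trace_add)
  show "ric x (k *\<^sub>R y) = k *\<^sub>R ric x y" for k y
    unfolding ric_def linear_scale[OF linear_3] by (simp add: endo_trace_scaleR)
qed

text \<open>The Kaehler identity between star-Ricci and Ricci, with \<open>f f\<close> in the place
  of \<open>-id\<close>. Bianchi splits the integrand into two terms, each contributing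
  \<open>- ric x (f (f y))\<close>.\<close>

lemma star_trace:
  assumes f: "linear f" and fskew: "\<And>v w. g (f v) w = - g v (f w)"
    and Rf: "\<And>u v w. R u v (f w) = f (R u v w)"
  shows "endo_trace (\<lambda>z. R x (f y) (f z)) = - 2 * ric x (f (f y))"
proof -
  \<comment> \<open>Commutation concerns the last argument only; pair symmetry transports it to the
    first two, where \<open>f\<close> changes sides with a sign.\<close>
  have move: "R (f u) v w = - R u (f v) w" for u v w
  proof (rule form_eqI)
    fix z
    have "g (R (f u) v w) z = g (R w z (f u)) v" by (rule pair_symmetry)
    also have "\<dots> = - g (R w z u) (f v)" by (simp only: Rf fskew)
    also have "\<dots> = - g (R u (f v) w) z" by (simp only: pair_symmetry[of u "f v" w z])
    finally show "g (R (f u) v w) z = g (- R u (f v) w) z" by (simp only: form_expand(7))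
  qed
  have A: "linear (\<lambda>z. f (R z x y))" using linear_compose[OF linear_1 f] by (simp add: comp_def)
  have e: "R x (f y) (f z) = - R z (f (f y)) x - f (R (f z) x y)" for z
  proof -
    have "R x (f y) (f z) = (R x (f y) (f z) + R (f y) (f z) x + R (f z) x (f y)) - R (f y) (f z) x - R (f z) x (f y)"
      by simp
    also have "\<dots> = - R (f y) (f z) x - f (R (f z) x y)" unfolding bianchi by (simp only: Rf diff_0)
    also have "R (f y) (f z) x = R z (f (f y)) x"
      using move[of "f y" z x] skew[of "f (f y)" z x] by simp
    finally show ?thesis .
  qed
  \<comment> \<open>The inner \<open>f\<close> is moved around the trace, so that both copies of
    \<open>f\<close> act on the value and can then be pulled into the last argument.\<close>
  have "endo_trace (\<lambda>z. f (R (f z) x y)) = endo_trace (\<lambda>z. f (f (R z x y)))"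
    by (rule endo_trace_commute[OF A f])
  also have "\<dots> = ric x (f (f y))" by (simp add: ric_def Rf)
  finally have "endo_trace (\<lambda>z. f (R (f z) x y)) = ric x (f (f y))" .
  then show ?thesis
    unfolding e endo_trace_diff endo_trace_minus using ric_sym[of "f (f y)" x] by (simp add: ric_def)
qed

end

section \<open>Calculus on a manifold given by an atlas\<close>

section \<open>Charts\<close>

locale smooth_manifold =
  fixes A :: "('a::t2_space, 'm::finite) chart set"
  assumes atlas: "smooth_atlas A"
begin

lemma open_chart_dom: "c \<in> A \<Longrightarrow> open (chart_dom c)"
  and open_chart_image: "c \<in> A \<Longrightarrow> open (chart_map c ` chart_dom c)"
  and chart_homeomorphism:
    "c \<in> A \<Longrightarrow> homeomorphism (chart_dom c) (chart_map c ` chart_dom c) (chart_map c) (chart_inv c)"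
  using atlas unfolding smooth_atlas_def is_chart_def by blast+

lemma chart_inv_map: "c \<in> A \<Longrightarrow> p \<in> chart_dom c \<Longrightarrow> chart_inv c (chart_map c p) = p"
  using chart_homeomorphism unfolding homeomorphism_def by blast

lemma chart_map_inv: "c \<in> A \<Longrightarrow> x \<in> chart_map c ` chart_dom c \<Longrightarrow> chart_map c (chart_inv c x) = x"
  using chart_homeomorphism unfolding homeomorphism_def by blast

lemma chart_inv_dom: "c \<in> A \<Longrightarrow> x \<in> chart_map c ` chart_dom c \<Longrightarrow> chart_inv c x \<in> chart_dom c"
  using chart_inv_map[of c] by auto

lemma open_chart_map_image:
  assumes "c \<in> A" "open U" "U \<subseteq> chart_dom c"
  shows "open (chart_map c ` U)"
proof -
  have "chart_map c ` U = chart_inv c -` U \<inter> chart_map c ` chart_dom c"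
    using assms chart_inv_map[OF assms(1)] by (auto simp: image_iff)
  moreover have "continuous_on (chart_map c ` chart_dom c) (chart_inv c)"
    using chart_homeomorphism[OF assms(1)] unfolding homeomorphism_def by blast
  ultimately show ?thesis
    using open_chart_image[OF assms(1)] assms(2) by (metis continuous_on_open_vimage)
qed

lemma chart_at_in: "chart_at A p \<in> A" "p \<in> chart_dom (chart_at A p)"
proof -
  have "\<exists>c. c \<in> A \<and> p \<in> chart_dom c" using atlas unfolding smooth_atlas_def by blast
  then have "chart_at A p \<in> A \<and> p \<in> chart_dom (chart_at A p)" unfolding chart_at_def by (rule someI_ex)
  then show "chart_at A p \<in> A" "p \<in> chart_dom (chart_at A p)" by auto
qed

definition trans_deriv :: "('a, 'm) chart \<Rightarrow> ('a, 'm) chart \<Rightarrow> 'a \<Rightarrow> real ^ 'm \<Rightarrow> real ^ 'm" where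
  "trans_deriv c c' q = frechet_derivative (chart_map c' \<circ> chart_inv c) (at (chart_map c q))"

lemma open_overlap: "c \<in> A \<Longrightarrow> c' \<in> A \<Longrightarrow> open (chart_map c ` (chart_dom c \<inter> chart_dom c'))"
  by (intro open_chart_map_image) (auto intro: open_chart_dom)

lemma smooth_transition:
  "c \<in> A \<Longrightarrow> c' \<in> A \<Longrightarrow> smooth_on (chart_map c ` (chart_dom c \<inter> chart_dom c')) (chart_map c' \<circ> chart_inv c)"
  using atlas unfolding smooth_atlas_def by blast

lemma trans_deriv_has_derivative:
  assumes "c \<in> A" "c' \<in> A" "q \<in> chart_dom c" "q \<in> chart_dom c'"
  shows "((chart_map c' \<circ> chart_inv c) has_derivative trans_deriv c c' q) (at (chart_map c q))"
  unfolding trans_deriv_def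
  by (rule smooth_on_has_derivative[OF smooth_transition]) (use assms in auto)

lemma linear_trans_deriv:
  assumes "c \<in> A" "c' \<in> A" "q \<in> chart_dom c" "q \<in> chart_dom c'"
  shows "linear (trans_deriv c c' q)"
  by (rule has_derivative_linear[OF trans_deriv_has_derivative[OF assms]])

lemma chart_change_has_derivative:
  assumes "c \<in> A" "c' \<in> A" "q \<in> chart_dom c" "q \<in> chart_dom c'"
    and "((h \<circ> chart_inv c') has_derivative H) (at (chart_map c' q))"
  shows "((h \<circ> chart_inv c) has_derivative (\<lambda>v. H (trans_deriv c c' q v))) (at (chart_map c q))"
proof -
  have "((h \<circ> chart_inv c') has_derivative H) (at ((chart_map c' \<circ> chart_inv c) (chart_map c q)))"
    using assms by (simp add: chart_inv_map)
  from has_derivative_compose[OF trans_deriv_has_derivative[OF assms(1-4)] this]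
  have "((\<lambda>x. (h \<circ> chart_inv c') ((chart_map c' \<circ> chart_inv c) x)) has_derivative
      (\<lambda>v. H (trans_deriv c c' q v))) (at (chart_map c q))" .
  moreover have "(h \<circ> chart_inv c') ((chart_map c' \<circ> chart_inv c) x) = (h \<circ> chart_inv c) x"
    if "x \<in> chart_map c ` (chart_dom c \<inter> chart_dom c')" for x
    using that chart_inv_map[OF assms(1)] chart_inv_map[OF assms(2)] by auto
  ultimately show ?thesis
    using has_derivative_cong_open[OF open_overlap[OF assms(1,2)],
        of "\<lambda>x. (h \<circ> chart_inv c') ((chart_map c' \<circ> chart_inv c) x)" "h \<circ> chart_inv c" "chart_map c q"]
      assms(3,4) by blast
qed

lemma trans_deriv_trans:
  assumes "c \<in> A" "c' \<in> A" "c'' \<in> A" "q \<in> chart_dom c" "q \<in> chart_dom c'" "q \<in> chart_dom c''"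
  shows "trans_deriv c' c'' q (trans_deriv c c' q v) = trans_deriv c c'' q v"
proof -
  have "((chart_map c'' \<circ> chart_inv c) has_derivative (\<lambda>v. trans_deriv c' c'' q (trans_deriv c c' q v)))
      (at (chart_map c q))"
    by (rule chart_change_has_derivative) (use assms trans_deriv_has_derivative in auto)
  moreover have "((chart_map c'' \<circ> chart_inv c) has_derivative trans_deriv c c'' q) (at (chart_map c q))"
    using assms by (intro trans_deriv_has_derivative)
  ultimately show ?thesis using has_derivative_unique by metis
qed

lemma trans_deriv_refl:
  assumes "c \<in> A" "q \<in> chart_dom c"
  shows "trans_deriv c c q v = v"
proof -
  have "((\<lambda>x. x) has_derivative (\<lambda>v. v)) (at (chart_map c q))" by simp
  moreover have "((\<lambda>x. x) has_derivative F) (at (chart_map c q))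
      \<longleftrightarrow> ((chart_map c \<circ> chart_inv c) has_derivative F) (at (chart_map c q))" for F
    by (rule has_derivative_cong_open[OF open_chart_image[OF assms(1)]])
      (use assms chart_map_inv[OF assms(1)] in auto)
  ultimately have "((chart_map c \<circ> chart_inv c) has_derivative (\<lambda>v. v)) (at (chart_map c q))" by blast
  then show ?thesis
    using trans_deriv_has_derivative[OF assms(1,1,2,2)] has_derivative_unique by metis
qed

lemma chart_components_eq: "chart_components A c p v = trans_deriv (chart_at A p) c p v"
  by (simp add: chart_components_def trans_deriv_def)

lemma linear_chart_components:
  "c \<in> A \<Longrightarrow> p \<in> chart_dom c \<Longrightarrow> linear (chart_components A c p)"
  using linear_trans_deriv[OF chart_at_in(1) _ chart_at_in(2)]
  by (simp add: chart_components_eq[abs_def])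

text \<open>The inverse of \<open>chart_components\<close>: \<open>w\<close> is read as components
  in chart \<open>c\<close>, and the result lives in the identification of the tangent space by
  \<open>chart_at A p\<close>.\<close>

definition chart_vec :: "('a, 'm) chart \<Rightarrow> 'a \<Rightarrow> real ^ 'm \<Rightarrow> real ^ 'm" where
  "chart_vec c p w = trans_deriv c (chart_at A p) p w"

lemma chart_components_vec:
  "c \<in> A \<Longrightarrow> c' \<in> A \<Longrightarrow> p \<in> chart_dom c \<Longrightarrow> p \<in> chart_dom c' \<Longrightarrow>
    chart_components A c' p (chart_vec c p w) = trans_deriv c c' p w"
  by (simp add: chart_components_eq chart_vec_def trans_deriv_trans chart_at_in)

lemma chart_vec_components:
  "c \<in> A \<Longrightarrow> p \<in> chart_dom c \<Longrightarrow> chart_vec c p (chart_components A c p v) = v"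
  by (simp add: chart_components_eq chart_vec_def trans_deriv_trans trans_deriv_refl chart_at_in)

lemma linear_chart_vec: "c \<in> A \<Longrightarrow> p \<in> chart_dom c \<Longrightarrow> linear (chart_vec c p)"
  using linear_trans_deriv[OF _ chart_at_in(1) _ chart_at_in(2)]
  by (simp add: chart_vec_def[abs_def])

section \<open>Smooth functions and vector fields\<close>

lemma smooth_fun_chart: "smooth_fun A h \<Longrightarrow> c \<in> A \<Longrightarrow> smooth_on (chart_map c ` chart_dom c) (h \<circ> chart_inv c)"
  by (simp add: smooth_fun_def)

lemma smooth_fun_has_derivative:
  assumes "smooth_fun A h" "c \<in> A" "p \<in> chart_dom c"
  shows "((h \<circ> chart_inv c) has_derivative frechet_derivative (h \<circ> chart_inv c) (at (chart_map c p)))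
    (at (chart_map c p))"
  by (rule smooth_on_has_derivative[OF smooth_fun_chart]) (use assms in auto)

text \<open>The chart chosen by \<open>chart_at\<close> may jump from point to point. Passing to one
  fixed chart \<open>c\<close> is what makes the dependence on \<open>p\<close> accessible to
  calculus.\<close>

lemma tangent_deriv_chart:
  assumes "smooth_fun A h" "c \<in> A" "p \<in> chart_dom c"
  shows "tangent_deriv A p v h = frechet_derivative (h \<circ> chart_inv c) (at (chart_map c p)) (chart_components A c p v)"
proof -
  let ?c = "chart_at A p"
  have "((h \<circ> chart_inv ?c) has_derivative
      (\<lambda>v. frechet_derivative (h \<circ> chart_inv c) (at (chart_map c p)) (trans_deriv ?c c p v))) (at (chart_map ?c p))"
    using assms by (intro chart_change_has_derivative chart_at_in smooth_fun_has_derivative)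
  then show ?thesis
    unfolding tangent_deriv_def chart_components_eq using frechet_derivative_at by metis
qed

definition field_in :: "('a, 'm) chart \<Rightarrow> ('a, 'm) vfield \<Rightarrow> real ^ 'm \<Rightarrow> real ^ 'm" where
  "field_in c X x = chart_components A c (chart_inv c x) (X (chart_inv c x))"

lemma smooth_vfield_chart: "smooth_vfield A X \<Longrightarrow> c \<in> A \<Longrightarrow> smooth_on (chart_map c ` chart_dom c) (field_in c X)"
  by (simp add: smooth_vfield_def field_in_def[abs_def])

lemma vderiv_chart:
  assumes "smooth_fun A h" "c \<in> A" "x \<in> chart_map c ` chart_dom c"
  shows "vderiv A X h (chart_inv c x) = frechet_derivative (h \<circ> chart_inv c) (at x) (field_in c X x)"
  using tangent_deriv_chart[OF assms(1,2) chart_inv_dom[OF assms(2,3)]] assms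
  by (simp add: vderiv_def field_in_def chart_map_inv)

lemma smooth_fun_vderiv [intro]:
  assumes "smooth_vfield A X" "smooth_fun A h"
  shows "smooth_fun A (vderiv A X h)"
  unfolding smooth_fun_def
proof
  fix c assume c: "c \<in> A"
  show "smooth_on (chart_map c ` chart_dom c) (vderiv A X h \<circ> chart_inv c)"
    by (rule smooth_on_cong[OF open_chart_image[OF c] _
          smooth_on_frechet_derivative_apply[OF open_chart_image[OF c] smooth_fun_chart[OF assms(2) c]
            smooth_vfield_chart[OF assms(1) c]]])
      (use vderiv_chart[OF assms(2) c] in auto)
qed

lemma smooth_fun_const [intro]: "smooth_fun A (\<lambda>q. k)"
  unfolding smooth_fun_def comp_def by (auto intro: smooth_on_const open_chart_image)

lemma smooth_fun_add [intro]: "smooth_fun A h \<Longrightarrow> smooth_fun A h' \<Longrightarrow> smooth_fun A (\<lambda>q. h q + h' q)"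
  unfolding smooth_fun_def comp_def by (auto intro: smooth_on_add open_chart_image)

lemma smooth_fun_mult [intro]: "smooth_fun A h \<Longrightarrow> smooth_fun A h' \<Longrightarrow> smooth_fun A (\<lambda>q. h q * h' q)"
  unfolding smooth_fun_def comp_def by (auto intro: smooth_on_mult open_chart_image)

lemma smooth_fun_uminus [intro]: "smooth_fun A h \<Longrightarrow> smooth_fun A (\<lambda>q. - h q)"
  using smooth_fun_mult[OF smooth_fun_const[of "-1"]] by simp

lemma smooth_fun_diff [intro]: "smooth_fun A h \<Longrightarrow> smooth_fun A h' \<Longrightarrow> smooth_fun A (\<lambda>q. h q - h' q)"
  using smooth_fun_add[OF _ smooth_fun_uminus] by simp

lemma smooth_fun_sum [intro]: "(\<And>i. i \<in> I \<Longrightarrow> smooth_fun A (h i)) \<Longrightarrow> smooth_fun A (\<lambda>q. \<Sum>i\<in>I. h i q)"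
  by (induction I rule: infinite_finite_induct) auto

lemma smooth_vfield_scaleR [intro]:
  assumes "smooth_fun A h" "smooth_vfield A X"
  shows "smooth_vfield A (\<lambda>q. h q *\<^sub>R X q)"
  unfolding smooth_vfield_def
proof
  fix c assume c: "c \<in> A"
  show "smooth_on (chart_map c ` chart_dom c)
      (\<lambda>x. chart_components A c (chart_inv c x) (h (chart_inv c x) *\<^sub>R X (chart_inv c x)))"
    by (rule smooth_on_cong[OF open_chart_image[OF c] _
          smooth_on_scaleR[OF open_chart_image[OF c] smooth_fun_chart[OF assms(1) c] smooth_vfield_chart[OF assms(2) c]]])
      (use linear_scale[OF linear_chart_components[OF c chart_inv_dom[OF c]]] in \<open>auto simp: field_in_def\<close>)
qed

lemma smooth_vfield_add [intro]:
  assumes "smooth_vfield A X" "smooth_vfield A Y"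
  shows "smooth_vfield A (\<lambda>q. X q + Y q)"
  unfolding smooth_vfield_def
proof
  fix c assume c: "c \<in> A"
  show "smooth_on (chart_map c ` chart_dom c)
      (\<lambda>x. chart_components A c (chart_inv c x) (X (chart_inv c x) + Y (chart_inv c x)))"
    by (rule smooth_on_cong[OF open_chart_image[OF c] _
          smooth_on_add[OF open_chart_image[OF c] smooth_vfield_chart[OF assms(1) c] smooth_vfield_chart[OF assms(2) c]]])
      (use linear_add[OF linear_chart_components[OF c chart_inv_dom[OF c]]] in \<open>auto simp: field_in_def\<close>)
qed

lemma smooth_vfield_zero [intro]: "smooth_vfield A (\<lambda>q. 0)"
  unfolding smooth_vfield_def
proof
  fix c assume c: "c \<in> A"
  show "smooth_on (chart_map c ` chart_dom c) (\<lambda>x. chart_components A c (chart_inv c x) 0)"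
    by (rule smooth_on_cong[OF open_chart_image[OF c] _ smooth_on_const[OF open_chart_image[OF c]]])
      (use linear_0[OF linear_chart_components[OF c chart_inv_dom[OF c]]] in auto)
qed

lemma smooth_vfield_scaleR_const [intro]: "smooth_vfield A X \<Longrightarrow> smooth_vfield A (\<lambda>q. k *\<^sub>R X q)"
  by auto

lemma smooth_vfield_uminus [intro]: "smooth_vfield A X \<Longrightarrow> smooth_vfield A (\<lambda>q. - X q)"
  using smooth_vfield_scaleR_const[of X "-1"] by simp

lemma smooth_vfield_diff [intro]: "smooth_vfield A X \<Longrightarrow> smooth_vfield A Y \<Longrightarrow> smooth_vfield A (\<lambda>q. X q - Y q)"
  using smooth_vfield_add[OF _ smooth_vfield_uminus] by simp

lemma smooth_vfield_sum [intro]: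
  "(\<And>i. i \<in> I \<Longrightarrow> smooth_vfield A (X i)) \<Longrightarrow> smooth_vfield A (\<lambda>q. \<Sum>i\<in>I. X i q)"
  by (induction I rule: infinite_finite_induct) auto

lemma linear_tangent_deriv:
  assumes "smooth_fun A h"
  shows "linear (\<lambda>v. tangent_deriv A p v h)"
  unfolding tangent_deriv_def
  by (rule has_derivative_linear[OF smooth_fun_has_derivative[OF assms chart_at_in]])

lemma tangent_deriv_eqI:
  assumes "((h \<circ> chart_inv (chart_at A p)) has_derivative H) (at (chart_map (chart_at A p) p))"
  shows "tangent_deriv A p v h = H v"
  using frechet_derivative_at[OF assms] by (simp add: tangent_deriv_def)

lemma tangent_deriv_const [simp]: "tangent_deriv A p v (\<lambda>q. k) = 0"
  by (simp add: tangent_deriv_def comp_def)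

lemma tangent_deriv_add:
  assumes "smooth_fun A h" "smooth_fun A h'"
  shows "tangent_deriv A p v (\<lambda>q. h q + h' q) = tangent_deriv A p v h + tangent_deriv A p v h'"
  unfolding tangent_deriv_def[of A p v h] tangent_deriv_def[of A p v h']
  by (rule tangent_deriv_eqI)
    (use has_derivative_add[OF smooth_fun_has_derivative[OF assms(1) chart_at_in]
        smooth_fun_has_derivative[OF assms(2) chart_at_in]] in \<open>simp add: comp_def\<close>)

lemma tangent_deriv_mult:
  assumes "smooth_fun A h" "smooth_fun A h'"
  shows "tangent_deriv A p v (\<lambda>q. h q * h' q) = h p * tangent_deriv A p v h' + tangent_deriv A p v h * h' p"
  unfolding tangent_deriv_def[of A p v h] tangent_deriv_def[of A p v h']
  by (rule tangent_deriv_eqI)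
    (use has_derivative_mult[OF smooth_fun_has_derivative[OF assms(1) chart_at_in]
        smooth_fun_has_derivative[OF assms(2) chart_at_in], of p] in \<open>simp add: comp_def chart_inv_map[OF chart_at_in]\<close>)

lemma tangent_deriv_cong:
  assumes "open U" "p \<in> U" "\<And>q. q \<in> U \<Longrightarrow> h q = h' q"
  shows "tangent_deriv A p v h = tangent_deriv A p v h'"
proof -
  let ?c = "chart_at A p"
  have "open (chart_map ?c ` (U \<inter> chart_dom ?c))"
    by (intro open_chart_map_image) (auto intro: assms open_chart_dom chart_at_in)
  then have "frechet_derivative (h \<circ> chart_inv ?c) (at (chart_map ?c p))
      = frechet_derivative (h' \<circ> chart_inv ?c) (at (chart_map ?c p))"
    by (rule frechet_derivative_cong_open) (use assms chart_at_in[of p] chart_inv_map[OF chart_at_in(1)] in auto)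
  then show ?thesis by (simp add: tangent_deriv_def)
qed

lemma vderiv_const [simp]: "vderiv A X (\<lambda>q. k) p = 0"
  by (simp add: vderiv_def)

lemma vderiv_add: "smooth_fun A h \<Longrightarrow> smooth_fun A h' \<Longrightarrow>
    vderiv A X (\<lambda>q. h q + h' q) p = vderiv A X h p + vderiv A X h' p"
  by (simp add: vderiv_def tangent_deriv_add)

lemma vderiv_mult: "smooth_fun A h \<Longrightarrow> smooth_fun A h' \<Longrightarrow>
    vderiv A X (\<lambda>q. h q * h' q) p = h p * vderiv A X h' p + vderiv A X h p * h' p"
  by (simp add: vderiv_def tangent_deriv_mult)

lemma vderiv_cmult: "smooth_fun A h \<Longrightarrow> vderiv A X (\<lambda>q. k * h q) p = k * vderiv A X h p"
  by (simp add: vderiv_mult[OF smooth_fun_const])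

lemma vderiv_diff: "smooth_fun A h \<Longrightarrow> smooth_fun A h' \<Longrightarrow>
    vderiv A X (\<lambda>q. h q - h' q) p = vderiv A X h p - vderiv A X h' p"
  using vderiv_add[of h "\<lambda>q. - h' q" X p] vderiv_cmult[of h' X "-1" p] smooth_fun_uminus[of h'] by simp

lemma vderiv_sum: "(\<And>i. i \<in> I \<Longrightarrow> smooth_fun A (h i)) \<Longrightarrow>
    vderiv A X (\<lambda>q. \<Sum>i\<in>I. h i q) p = (\<Sum>i\<in>I. vderiv A X (h i) p)"
  by (induction I rule: infinite_finite_induct) (auto simp: vderiv_add smooth_fun_sum)

lemma vderiv_field_add: "smooth_fun A h \<Longrightarrow> vderiv A (\<lambda>q. X q + Y q) h p = vderiv A X h p + vderiv A Y h p"
  using linear_add[OF linear_tangent_deriv] by (simp add: vderiv_def)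

lemma vderiv_field_scaleR: "smooth_fun A h \<Longrightarrow> vderiv A (\<lambda>q. k q *\<^sub>R X q) h p = k p * vderiv A X h p"
  using linear_scale[OF linear_tangent_deriv] by (simp add: vderiv_def)

section \<open>Cut-offs and local frames\<close>

lemma smooth_on_chart_cutoff:
  assumes c: "c \<in> A" and c': "c' \<in> A" and K: "cball a r \<subseteq> chart_map c ` chart_dom c"
    and h: "smooth_on (chart_map c' ` (chart_dom c' \<inter> chart_dom c)) h"
    and 0: "\<And>q. q \<in> chart_dom c' \<Longrightarrow> q \<notin> chart_inv c ` cball a r \<Longrightarrow> h (chart_map c' q) = 0"
  shows "smooth_on (chart_map c' ` chart_dom c') h"
proof -
  let ?K = "chart_inv c ` cball a r"
  have "continuous_on (cball a r) (chart_inv c)"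
    by (rule continuous_on_subset[OF _ K]) (use chart_homeomorphism[OF c] in \<open>auto simp: homeomorphism_def\<close>)
  then have "closed ?K" by (intro compact_imp_closed compact_continuous_image) auto
  then have op: "open (chart_map c' ` (chart_dom c' - ?K))"
    by (intro open_chart_map_image open_Diff open_chart_dom c') auto
  have Kdom: "?K \<subseteq> chart_dom c" using chart_inv_dom[OF c] K by blast
  have "smooth_on (chart_map c' ` (chart_dom c' - ?K)) h"
    by (rule smooth_on_cong[OF op _ smooth_on_const[OF op, of 0]]) (use 0 in auto)
  from smooth_on_Un[OF op open_overlap[OF c' c] this h]
  have "smooth_on (chart_map c' ` (chart_dom c' - ?K) \<union> chart_map c' ` (chart_dom c' \<inter> chart_dom c)) h" .
  moreover have "chart_map c' ` (chart_dom c' - ?K) \<union> chart_map c' ` (chart_dom c' \<inter> chart_dom c)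
      = chart_map c' ` chart_dom c'"
    unfolding image_Un[symmetric] by (rule arg_cong[where f = "image (chart_map c')"]) (use Kdom in blast)
  ultimately show ?thesis by simp
qed

lemma smooth_fun_cutoff:
  assumes c: "c \<in> A" and k: "smooth_on (chart_map c ` chart_dom c) k"
    and K: "cball a r \<subseteq> chart_map c ` chart_dom c"
    and 0: "\<And>x. x \<notin> cball a r \<Longrightarrow> k x = 0"
  shows "smooth_fun A (\<lambda>q. if q \<in> chart_dom c then k (chart_map c q) else 0)"
  unfolding smooth_fun_def
proof
  fix c' assume c': "c' \<in> A"
  let ?h = "(\<lambda>q. if q \<in> chart_dom c then k (chart_map c q) else 0) \<circ> chart_inv c'"
  let ?t = "chart_map c \<circ> chart_inv c'"
  have out: "k (chart_map c q) = 0" if "q \<in> chart_dom c" "q \<notin> chart_inv c ` cball a r" for q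
  proof (rule 0, rule notI)
    assume "chart_map c q \<in> cball a r"
    from imageI[OF this, of "chart_inv c"] show False using that by (simp only: chart_inv_map[OF c])
  qed
  have tim: "?t ` (chart_map c' ` (chart_dom c' \<inter> chart_dom c)) \<subseteq> chart_map c ` chart_dom c"
    using chart_inv_map[OF c'] by auto
  have "smooth_on (chart_map c' ` (chart_dom c' \<inter> chart_dom c)) (\<lambda>x. k (?t x))"
    by (rule smooth_on_compose[OF open_overlap[OF c' c] open_chart_image[OF c] smooth_transition[OF c' c] tim k])
  then have "smooth_on (chart_map c' ` (chart_dom c' \<inter> chart_dom c)) ?h"
  proof (rule smooth_on_cong[OF open_overlap[OF c' c], rotated])
    fix x assume "x \<in> chart_map c' ` (chart_dom c' \<inter> chart_dom c)"
    then obtain q where "x = chart_map c' q" "q \<in> chart_dom c'" "q \<in> chart_dom c" by blast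
    then show "k (?t x) = ?h x" by (simp add: chart_inv_map[OF c'])
  qed
  then show "smooth_on (chart_map c' ` chart_dom c') ?h"
  proof (rule smooth_on_chart_cutoff[OF c c' K])
    fix q assume "q \<in> chart_dom c'" "q \<notin> chart_inv c ` cball a r"
    then show "?h (chart_map c' q) = 0"
      using out[of q] by (cases "q \<in> chart_dom c") (simp_all add: chart_inv_map[OF c'])
  qed
qed

lemma smooth_vfield_cutoff:
  assumes c: "c \<in> A" and k: "smooth_on (chart_map c ` chart_dom c) k"
    and K: "cball a r \<subseteq> chart_map c ` chart_dom c"
    and 0: "\<And>x. x \<notin> cball a r \<Longrightarrow> k x = 0"
  shows "smooth_vfield A (\<lambda>q. if q \<in> chart_dom c then k (chart_map c q) *\<^sub>R chart_vec c q w else 0)"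
  unfolding smooth_vfield_def
proof
  fix c' assume c': "c' \<in> A"
  let ?h = "\<lambda>x. chart_components A c' (chart_inv c' x) (if chart_inv c' x \<in> chart_dom c
      then k (chart_map c (chart_inv c' x)) *\<^sub>R chart_vec c (chart_inv c' x) w else 0)"
  let ?t = "chart_map c \<circ> chart_inv c'"
  note t = smooth_transition[OF c' c]
  have out: "k (chart_map c q) = 0" if "q \<in> chart_dom c" "q \<notin> chart_inv c ` cball a r" for q
  proof (rule 0, rule notI)
    assume "chart_map c q \<in> cball a r"
    from imageI[OF this, of "chart_inv c"] show False using that by (simp only: chart_inv_map[OF c])
  qed
  have tim: "?t ` (chart_map c' ` (chart_dom c' \<inter> chart_dom c)) \<subseteq> chart_map c ` (chart_dom c \<inter> chart_dom c')"
    using chart_inv_map[OF c'] by auto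
  then have tim': "?t ` (chart_map c' ` (chart_dom c' \<inter> chart_dom c)) \<subseteq> chart_map c ` chart_dom c"
    by blast
  have "smooth_on (chart_map c' ` (chart_dom c' \<inter> chart_dom c))
      (\<lambda>x. k (?t x) *\<^sub>R frechet_derivative (chart_map c' \<circ> chart_inv c) (at (?t x)) w)"
    by (rule smooth_on_scaleR[OF open_overlap[OF c' c]
          smooth_on_compose[OF open_overlap[OF c' c] open_chart_image[OF c] t tim' k]
          smooth_on_compose[OF open_overlap[OF c' c] open_overlap[OF c c'] t tim
            smooth_on_frechet_derivative[OF smooth_transition[OF c c']]]])
  then have "smooth_on (chart_map c' ` (chart_dom c' \<inter> chart_dom c)) ?h"
  proof (rule smooth_on_cong[OF open_overlap[OF c' c], rotated])
    fix x assume "x \<in> chart_map c' ` (chart_dom c' \<inter> chart_dom c)"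
    then obtain q where q: "x = chart_map c' q" "q \<in> chart_dom c'" "q \<in> chart_dom c" by blast
    show "k (?t x) *\<^sub>R frechet_derivative (chart_map c' \<circ> chart_inv c) (at (?t x)) w = ?h x"
      using q by (simp add: chart_inv_map[OF c'] linear_scale[OF linear_chart_components[OF c']]
          chart_components_vec[OF c c'] trans_deriv_def)
  qed
  then show "smooth_on (chart_map c' ` chart_dom c') ?h"
  proof (rule smooth_on_chart_cutoff[OF c c' K])
    fix q assume "q \<in> chart_dom c'" "q \<notin> chart_inv c ` cball a r"
    then show "?h (chart_map c' q) = 0"
      using out[of q] linear_0[OF linear_chart_components[OF c']]
      by (cases "q \<in> chart_dom c") (simp_all add: chart_inv_map[OF c'])
  qed
qed

lemma chart_ball:
  assumes "c \<in> A" "p \<in> chart_dom c" "open U" "p \<in> U"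
  obtains r where "r > 0" "cball (chart_map c p) (2 * r) \<subseteq> chart_map c ` (U \<inter> chart_dom c)"
proof -
  have "open (chart_map c ` (U \<inter> chart_dom c))"
    using assms by (intro open_chart_map_image) (auto intro: open_chart_dom)
  moreover have "chart_map c p \<in> chart_map c ` (U \<inter> chart_dom c)" using assms by auto
  ultimately obtain e where "e > 0" "cball (chart_map c p) e \<subseteq> chart_map c ` (U \<inter> chart_dom c)"
    using open_contains_cball by blast
  then show thesis using that[of "e / 2"] by simp
qed

lemma bump_function:
  assumes "open U" "p \<in> U"
  obtains bump where "smooth_fun A bump" "bump p = 1" "\<And>q. q \<notin> U \<Longrightarrow> bump q = 0"
proof -
  define c where "c = chart_at A p"
  have c: "c \<in> A" "p \<in> chart_dom c" using chart_at_in by (auto simp: c_def)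
  obtain r where r: "r > 0" "cball (chart_map c p) (2 * r) \<subseteq> chart_map c ` (U \<inter> chart_dom c)"
    using chart_ball[OF c assms] .
  let ?b = "ball_bump (chart_map c p) r"
  define bump where "bump = (\<lambda>q. if q \<in> chart_dom c then ?b (chart_map c q) else 0)"
  have out: "?b x = 0" if "x \<notin> cball (chart_map c p) (2 * r)" for x
    using that r(1) by (intro ball_bump_eq_0[OF r(1)]) auto
  have "smooth_fun A bump"
    unfolding bump_def
    by (rule smooth_fun_cutoff[OF c(1) smooth_on_subset[OF smooth_on_ball_bump subset_UNIV] _ out]) (use r in auto)
  moreover have "bump p = 1" using c ball_bump_eq_1[OF r(1), of "chart_map c p" "chart_map c p"] r(1) by (auto simp: bump_def)
  moreover have "bump q = 0" if "q \<notin> U" for q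
  proof (cases "q \<in> chart_dom c")
    case True
    have "chart_map c q \<notin> chart_map c ` (U \<inter> chart_dom c)"
    proof
      assume "chart_map c q \<in> chart_map c ` (U \<inter> chart_dom c)"
      then obtain q' where q': "chart_map c q = chart_map c q'" "q' \<in> U" "q' \<in> chart_dom c" by blast
      have "chart_inv c (chart_map c q) = chart_inv c (chart_map c q')" by (simp only: q'(1))
      then have "q = q'" using True q'(3) by (simp only: chart_inv_map[OF c(1)])
      with q'(2) that show False by simp
    qed
    then have "chart_map c q \<notin> cball (chart_map c p) (2 * r)" using r(2) by blast
    then show ?thesis using True out by (simp only: bump_def if_True)
  qed (simp add: bump_def)
  ultimately show thesis using that by blast
qed

text \<open>The fields and functions are globally smooth, so the global definitions apply to them,
  but only on \<open>U\<close> are they a coordinate frame and its coordinates.\<close>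

definition local_frame :: "'a set \<Rightarrow> ('m \<Rightarrow> ('a, 'm) vfield) \<Rightarrow> ('m \<Rightarrow> 'a \<Rightarrow> real) \<Rightarrow> bool" where
  "local_frame U E u \<longleftrightarrow> open U \<and> (\<forall>j. smooth_vfield A (E j)) \<and> (\<forall>j. smooth_fun A (u j)) \<and>
    (\<forall>q\<in>U. \<forall>j k. tangent_deriv A q (E j q) (u k) = (if j = k then 1 else 0)) \<and>
    (\<forall>q\<in>U. \<forall>v. v = (\<Sum>j\<in>UNIV. tangent_deriv A q v (u j) *\<^sub>R E j q))"

lemma local_frameD:
  assumes "local_frame U E u"
  shows "open U" "\<And>j. smooth_vfield A (E j)" "\<And>j. smooth_fun A (u j)"
    "\<And>q j k. q \<in> U \<Longrightarrow> tangent_deriv A q (E j q) (u k) = (if j = k then 1 else 0)"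
    "\<And>q v. q \<in> U \<Longrightarrow> v = (\<Sum>j\<in>UNIV. tangent_deriv A q v (u j) *\<^sub>R E j q)"
  using assms unfolding local_frame_def by blast+

lemma exists_local_frame: "\<exists>U E u. p \<in> U \<and> local_frame U E u"
proof -
  define c where "c = chart_at A p"
  have c: "c \<in> A" "p \<in> chart_dom c" using chart_at_in by (auto simp: c_def)
  obtain r where r: "r > 0" "cball (chart_map c p) (2 * r) \<subseteq> chart_map c ` (UNIV \<inter> chart_dom c)"
    using chart_ball[OF c open_UNIV] by auto
  let ?b = "ball_bump (chart_map c p) r"
  have out: "?b x = 0" if "x \<notin> cball (chart_map c p) (2 * r)" for x
    using that r(1) by (intro ball_bump_eq_0[OF r(1)]) auto
  have bs: "smooth_on (chart_map c ` chart_dom c) ?b" by (rule smooth_on_subset[OF smooth_on_ball_bump]) auto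
  define E :: "'m \<Rightarrow> ('a, 'm) vfield" where
    "E = (\<lambda>j q. if q \<in> chart_dom c then ?b (chart_map c q) *\<^sub>R chart_vec c q (axis j 1) else 0)"
  define u where
    "u = (\<lambda>j q. if q \<in> chart_dom c then (\<lambda>x. ?b x * (x $ j)) (chart_map c q) else 0)"
  \<comment> \<open>On this set the bump is identically 1, so the cut-off fields and functions agree
    with the genuine coordinate ones.\<close>
  define W where "W = chart_dom c \<inter> chart_map c -` ball (chart_map c p) r"
  have "continuous_on (chart_dom c) (chart_map c)"
    using chart_homeomorphism[OF c(1)] unfolding homeomorphism_def by blast
  then have Wo: "open W"
    unfolding W_def using open_chart_dom[OF c(1)] continuous_open_preimage open_ball by blast
  have Wp: "p \<in> W" using c r(1) by (simp add: W_def)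
  have Es: "smooth_vfield A (E j)" for j
    unfolding E_def by (rule smooth_vfield_cutoff[OF c(1) bs _ out]) (use r in auto)
  have us: "smooth_fun A (u j)" for j
    unfolding u_def
    by (rule smooth_fun_cutoff[OF c(1)])
      (use r out smooth_on_mult[OF open_chart_image[OF c(1)] bs
         smooth_on_linear[OF open_chart_image[OF c(1)] bounded_linear_vec_nth smooth_on_id[OF open_chart_image[OF c(1)]]]]
       in auto)
  have td: "tangent_deriv A q v (u k) = chart_components A c q v $ k" if "q \<in> W" for q v k
  proof -
    have q: "q \<in> chart_dom c" "chart_map c q \<in> ball (chart_map c p) r" using that by (auto simp: W_def)
    have "ball (chart_map c p) r \<subseteq> cball (chart_map c p) (2 * r)" using r(1) by auto
    then have im: "ball (chart_map c p) r \<subseteq> chart_map c ` chart_dom c" using r(2) by auto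
    have "((\<lambda>x. x $ k) has_derivative (\<lambda>x. x $ k)) (at (chart_map c q))"
      by (rule bounded_linear_imp_has_derivative[OF bounded_linear_vec_nth])
    moreover have "x $ k = (u k \<circ> chart_inv c) x" if "x \<in> ball (chart_map c p) r" for x
      using that im ball_bump_eq_1[OF r(1), of x "chart_map c p"] chart_inv_dom[OF c(1)] chart_map_inv[OF c(1)]
      by (auto simp: u_def subset_iff)
    ultimately have "((u k \<circ> chart_inv c) has_derivative (\<lambda>x. x $ k)) (at (chart_map c q))"
      using has_derivative_cong_open[OF open_ball _ q(2), of "\<lambda>x. x $ k" "u k \<circ> chart_inv c"] by blast
    then show ?thesis
      unfolding tangent_deriv_chart[OF us c(1) q(1)] by (simp add: frechet_derivative_at[symmetric])
  qed
  have E: "E j q = chart_vec c q (axis j 1)" if "q \<in> W" for q j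
    using that ball_bump_eq_1[OF r(1), of "chart_map c q" "chart_map c p"] by (auto simp: W_def E_def)
  have d: "tangent_deriv A q (E j q) (u k) = (if j = k then 1 else 0)" if "q \<in> W" for q j k
  proof -
    have "chart_components A c q (chart_vec c q (axis j 1)) = axis j 1"
      using that c(1) by (simp add: W_def chart_components_vec trans_deriv_refl)
    then show ?thesis using that by (simp add: td E axis_def)
  qed
  have e: "v = (\<Sum>j\<in>UNIV. tangent_deriv A q v (u j) *\<^sub>R E j q)" if "q \<in> W" for q v
  proof -
    have q: "q \<in> chart_dom c" using that by (auto simp: W_def)
    let ?w = "chart_components A c q v"
    have "?w = (\<Sum>j\<in>UNIV. ?w $ j *\<^sub>R axis j 1)"
      by (simp add: vec_eq_iff axis_def if_distrib cong: if_cong)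
    then have "chart_vec c q ?w = chart_vec c q (\<Sum>j\<in>UNIV. ?w $ j *\<^sub>R axis j 1)" by simp
    also have "\<dots> = (\<Sum>j\<in>UNIV. ?w $ j *\<^sub>R chart_vec c q (axis j 1))"
      by (simp only: linear_sum[OF linear_chart_vec[OF c(1) q]] linear_scale[OF linear_chart_vec[OF c(1) q]])
    finally show ?thesis using chart_vec_components[OF c(1) q] that by (simp add: td E)
  qed
  have "local_frame W E u" unfolding local_frame_def using Wo Es us d e by blast
  with Wp show ?thesis by blast
qed

lemma exists_extension: "\<exists>X. smooth_vfield A X \<and> X p = v"
proof -
  obtain U E u where p: "p \<in> U" and F: "local_frame U E u" using exists_local_frame by blast
  let ?X = "\<lambda>q. \<Sum>j\<in>UNIV. tangent_deriv A p v (u j) *\<^sub>R E j q"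
  have "smooth_vfield A ?X" by (intro smooth_vfield_sum smooth_vfield_scaleR_const local_frameD(2)[OF F])
  moreover have "?X p = v" by (rule local_frameD(5)[OF F p, symmetric])
  ultimately show ?thesis by blast
qed

lemma smooth_extend [intro]: "smooth_vfield A (extend A p v)"
  and extend_at [simp]: "extend A p v p = v"
  using someI_ex[OF exists_extension[of p v]] by (auto simp: extend_def)

text \<open>The globally smooth functions include local coordinates around \<open>p\<close>, hence
  separate tangent vectors. This is the uniqueness that the description of the bracket
  needs.\<close>

lemma tangent_eqI:
  assumes "\<And>h. smooth_fun A h \<Longrightarrow> tangent_deriv A p v h = tangent_deriv A p w h"
  shows "v = w"
proof -
  obtain U E u where p: "p \<in> U" and F: "local_frame U E u" using exists_local_frame by blast
  have "v = (\<Sum>j\<in>UNIV. tangent_deriv A p v (u j) *\<^sub>R E j p)" by (rule local_frameD(5)[OF F p])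
  also have "\<dots> = (\<Sum>j\<in>UNIV. tangent_deriv A p w (u j) *\<^sub>R E j p)"
    by (simp only: assms[OF local_frameD(3)[OF F]])
  also have "\<dots> = w" by (rule local_frameD(5)[OF F p, symmetric])
  finally show ?thesis .
qed

section \<open>The Lie bracket\<close>

text \<open>Separates the first-order part from the Hessian part; the latter will cancel in the
  commutator.\<close>

lemma vderiv_vderiv_chart:
  assumes X: "smooth_vfield A X" and Y: "smooth_vfield A Y" and h: "smooth_fun A h"
    and c: "c \<in> A" and p: "p \<in> chart_dom c"
  defines "x \<equiv> chart_map c p" and "h' \<equiv> h \<circ> chart_inv c"
  shows "vderiv A X (vderiv A Y h) p =
    frechet_derivative h' (at x) (frechet_derivative (field_in c Y) (at x) (field_in c X x))
    + (\<Sum>b\<in>Basis. \<Sum>a\<in>Basis. (field_in c Y x \<bullet> b) * (field_in c X x \<bullet> a) *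
        frechet_derivative (\<lambda>y. frechet_derivative h' (at y) b) (at x) a)"
proof -
  let ?S = "chart_map c ` chart_dom c" and ?D = "\<lambda>y. frechet_derivative h' (at y)"
  let ?Y = "field_in c Y" and ?X = "field_in c X"
  have S: "open ?S" and x: "x \<in> ?S" using open_chart_image[OF c] p by (auto simp: x_def)
  have hs: "smooth_on ?S h'" unfolding h'_def by (rule smooth_fun_chart[OF h c])
  note dY = smooth_on_has_derivative[OF smooth_vfield_chart[OF Y c] x]
  note dD = smooth_on_has_derivative[OF smooth_on_frechet_derivative[OF hs] x]
  have eq: "(\<Sum>b\<in>Basis. (?Y y \<bullet> b) * ?D y b) = (vderiv A Y h \<circ> chart_inv c) y" if "y \<in> ?S" for y
    using vderiv_chart[OF h c that] linear_Basis_expansion[OF has_derivative_linear[OF smooth_on_has_derivative[OF hs that]], of "?Y y"]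
    by (simp add: h'_def)
  have "((\<lambda>y. \<Sum>b\<in>Basis. (?Y y \<bullet> b) * ?D y b) has_derivative
      (\<lambda>v. \<Sum>b\<in>Basis. (?Y x \<bullet> b) * frechet_derivative (\<lambda>y. ?D y b) (at x) v
        + (frechet_derivative ?Y (at x) v \<bullet> b) * ?D x b)) (at x)"
    by (intro has_derivative_sum has_derivative_mult has_derivative_inner_left dY dD)
  then have "((vderiv A Y h \<circ> chart_inv c) has_derivative
      (\<lambda>v. \<Sum>b\<in>Basis. (?Y x \<bullet> b) * frechet_derivative (\<lambda>y. ?D y b) (at x) v
        + (frechet_derivative ?Y (at x) v \<bullet> b) * ?D x b)) (at x)"
    by (rule has_derivative_cong_open[OF S _ x, THEN iffD1, rotated]) (rule eq)
  then have 1: "frechet_derivative (vderiv A Y h \<circ> chart_inv c) (at x) v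
      = (\<Sum>b\<in>Basis. (?Y x \<bullet> b) * frechet_derivative (\<lambda>y. ?D y b) (at x) v)
        + (\<Sum>b\<in>Basis. (frechet_derivative ?Y (at x) v \<bullet> b) * ?D x b)" for v
    by (simp add: frechet_derivative_at[symmetric] sum.distrib)
  have 2: "(\<Sum>b\<in>Basis. (w \<bullet> b) * ?D x b) = ?D x w" for w
    using linear_Basis_expansion[OF has_derivative_linear[OF smooth_on_has_derivative[OF hs x]], of w] by simp
  have 3: "frechet_derivative (\<lambda>y. ?D y b) (at x) v
      = (\<Sum>a\<in>Basis. (v \<bullet> a) * frechet_derivative (\<lambda>y. ?D y b) (at x) a)" for v b
    using linear_Basis_expansion[OF has_derivative_linear[OF dD], of b v] by simp
  have "vderiv A X (vderiv A Y h) p = frechet_derivative (vderiv A Y h \<circ> chart_inv c) (at x) (?X x)"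
    using vderiv_chart[OF smooth_fun_vderiv[OF Y h] c x] p by (simp add: x_def chart_inv_map[OF c])
  also have "\<dots> = (\<Sum>b\<in>Basis. (?Y x \<bullet> b) * frechet_derivative (\<lambda>y. ?D y b) (at x) (?X x))
        + ?D x (frechet_derivative ?Y (at x) (?X x))"
    by (simp only: 1 2)
  also have "(\<Sum>b\<in>Basis. (?Y x \<bullet> b) * frechet_derivative (\<lambda>y. ?D y b) (at x) (?X x))
    = (\<Sum>b\<in>Basis. \<Sum>a\<in>Basis. (?Y x \<bullet> b) * (?X x \<bullet> a) * frechet_derivative (\<lambda>y. ?D y b) (at x) a)"
    by (intro sum.cong refl) (simp only: 3[where v = "?X x"] sum_distrib_left mult.assoc)
  finally show ?thesis by simp
qed

text \<open>With the Hessian terms cancelled, the commutator is differentiation along the vector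
  with components \<open>w c\<close>, so the description defining the bracket has a solution. The
  formula in an arbitrary chart is kept because it gives smoothness of the bracket.\<close>

lemma
  assumes X: "smooth_vfield A X" and Y: "smooth_vfield A Y"
  shows tangent_deriv_bracket: "\<And>h. smooth_fun A h \<Longrightarrow>
      tangent_deriv A p (bracket A X Y p) h = vderiv A X (vderiv A Y h) p - vderiv A Y (vderiv A X h) p"
    and chart_components_bracket: "\<And>c. c \<in> A \<Longrightarrow> p \<in> chart_dom c \<Longrightarrow>
      chart_components A c p (bracket A X Y p) =
        frechet_derivative (field_in c Y) (at (chart_map c p)) (field_in c X (chart_map c p))
        - frechet_derivative (field_in c X) (at (chart_map c p)) (field_in c Y (chart_map c p))"
proof -
  define w where "w = (\<lambda>c. frechet_derivative (field_in c Y) (at (chart_map c p)) (field_in c X (chart_map c p))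
        - frechet_derivative (field_in c X) (at (chart_map c p)) (field_in c Y (chart_map c p)))"
  have key: "tangent_deriv A p (chart_vec c p (w c)) h = vderiv A X (vderiv A Y h) p - vderiv A Y (vderiv A X h) p"
    if h: "smooth_fun A h" and c: "c \<in> A" "p \<in> chart_dom c" for h c
  proof -
    let ?x = "chart_map c p" and ?h = "h \<circ> chart_inv c"
    have hs: "smooth_on (chart_map c ` chart_dom c) ?h" by (rule smooth_fun_chart[OF h c(1)])
    have x: "?x \<in> chart_map c ` chart_dom c" using c by auto
    have lin: "linear (frechet_derivative ?h (at ?x))"
      by (rule has_derivative_linear[OF smooth_on_has_derivative[OF hs x]])
    let ?H = "\<lambda>b a. frechet_derivative (\<lambda>y. frechet_derivative ?h (at y) b) (at ?x) a"
    have "(field_in c Y ?x \<bullet> b) * (field_in c X ?x \<bullet> a) * ?H b a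
        = (field_in c X ?x \<bullet> a) * (field_in c Y ?x \<bullet> b) * ?H a b" for a b
      using second_derivative_symmetric[OF open_chart_image[OF c(1)] hs x, of a b] by simp
    note sw = this
    have sym: "(\<Sum>b\<in>Basis. \<Sum>a\<in>Basis. (field_in c Y ?x \<bullet> b) * (field_in c X ?x \<bullet> a) * ?H b a)
      = (\<Sum>b\<in>Basis. \<Sum>a\<in>Basis. (field_in c X ?x \<bullet> b) * (field_in c Y ?x \<bullet> a) * ?H b a)"
      by (subst sum.swap) (intro sum.cong refl sw)
    have "chart_components A c p (chart_vec c p (w c)) = w c"
      using c by (simp add: chart_components_vec trans_deriv_refl)
    then have "tangent_deriv A p (chart_vec c p (w c)) h = frechet_derivative ?h (at ?x) (w c)"
      using tangent_deriv_chart[OF h c] by simp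
    then show ?thesis
      unfolding vderiv_vderiv_chart[OF X Y h c] vderiv_vderiv_chart[OF Y X h c] sym w_def
      by (simp add: linear_diff[OF lin])
  qed
  let ?v = "chart_vec (chart_at A p) p (w (chart_at A p))"
  have b: "bracket A X Y p = ?v"
    unfolding bracket_def
  proof (rule the_equality)
    show "\<forall>h. smooth_fun A h \<longrightarrow> tangent_deriv A p ?v h = vderiv A X (vderiv A Y h) p - vderiv A Y (vderiv A X h) p"
      using key chart_at_in by blast
    show "v = ?v" if "\<forall>h. smooth_fun A h \<longrightarrow>
        tangent_deriv A p v h = vderiv A X (vderiv A Y h) p - vderiv A Y (vderiv A X h) p" for v
      by (rule tangent_eqI[of p]) (use that key[OF _ chart_at_in] in simp)
  qed
  show 1: "tangent_deriv A p (bracket A X Y p) h = vderiv A X (vderiv A Y h) p - vderiv A Y (vderiv A X h) p"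
    if "smooth_fun A h" for h
    unfolding b by (rule key[OF that chart_at_in])
  show "chart_components A c p (bracket A X Y p) =
        frechet_derivative (field_in c Y) (at (chart_map c p)) (field_in c X (chart_map c p))
        - frechet_derivative (field_in c X) (at (chart_map c p)) (field_in c Y (chart_map c p))"
    if c: "c \<in> A" "p \<in> chart_dom c" for c
  proof -
    have "bracket A X Y p = chart_vec c p (w c)" by (rule tangent_eqI[of p]) (use 1 key[OF _ c] in simp)
    then show ?thesis using c by (simp add: chart_components_vec trans_deriv_refl w_def)
  qed
qed

lemma vderiv_bracket:
  "smooth_vfield A X \<Longrightarrow> smooth_vfield A Y \<Longrightarrow> smooth_fun A h \<Longrightarrow>
    vderiv A (bracket A X Y) h p = vderiv A X (vderiv A Y h) p - vderiv A Y (vderiv A X h) p"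
  by (simp add: vderiv_def[of A "bracket A X Y"] tangent_deriv_bracket)

lemma smooth_vfield_bracket [intro]:
  assumes X: "smooth_vfield A X" and Y: "smooth_vfield A Y"
  shows "smooth_vfield A (bracket A X Y)"
  unfolding smooth_vfield_def
proof
  fix c assume c: "c \<in> A"
  note S = open_chart_image[OF c]
  note Xs = smooth_vfield_chart[OF X c] and Ys = smooth_vfield_chart[OF Y c]
  have "smooth_on (chart_map c ` chart_dom c) (\<lambda>x. frechet_derivative (field_in c Y) (at x) (field_in c X x)
      + (-1) *\<^sub>R frechet_derivative (field_in c X) (at x) (field_in c Y x))"
    by (rule smooth_on_add[OF S smooth_on_frechet_derivative_apply[OF S Ys Xs]
          smooth_on_scaleR[OF S smooth_on_const[OF S] smooth_on_frechet_derivative_apply[OF S Xs Ys]]])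
  then show "smooth_on (chart_map c ` chart_dom c)
      (\<lambda>x. chart_components A c (chart_inv c x) (bracket A X Y (chart_inv c x)))"
    by (rule smooth_on_cong[OF S, rotated])
      (simp add: chart_components_bracket[OF X Y c chart_inv_dom[OF c]] chart_map_inv[OF c])
qed

lemma vfield_eqI:
  assumes "\<And>h. smooth_fun A h \<Longrightarrow> vderiv A X h p = vderiv A Y h p"
  shows "X p = Y p"
  using tangent_eqI[of p "X p" "Y p"] assms by (simp add: vderiv_def)

lemma bracket_skew:
  assumes "smooth_vfield A X" "smooth_vfield A Y"
  shows "bracket A X Y p = - bracket A Y X p"
proof (rule vfield_eqI[where Y = "\<lambda>q. - bracket A Y X q"])
  fix h assume h: "smooth_fun A h"
  have "vderiv A (\<lambda>q. - bracket A Y X q) h p = - vderiv A (bracket A Y X) h p"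
    using vderiv_field_scaleR[OF h, of "\<lambda>q. -1"] by simp
  then show "vderiv A (bracket A X Y) h p = vderiv A (\<lambda>q. - bracket A Y X q) h p"
    using h assms by (simp add: vderiv_bracket)
qed

text \<open>On functions, fields act as operators and the bracket as their commutator. The Leibniz
  form says that \<open>bracket A X\<close> is a derivation of the bracket, which is how it is used
  for Lie derivatives.\<close>

lemma bracket_jacobi:
  assumes X: "smooth_vfield A X" and Y: "smooth_vfield A Y" and Z: "smooth_vfield A Z"
  shows "bracket A X (bracket A Y Z) p = bracket A (bracket A X Y) Z p + bracket A Y (bracket A X Z) p"
proof (rule vfield_eqI[where Y = "\<lambda>q. bracket A (bracket A X Y) Z q + bracket A Y (bracket A X Z) q"])
  fix h assume h: "smooth_fun A h"
  have b: "vderiv A (bracket A U W) k = (\<lambda>q. vderiv A U (vderiv A W k) q - vderiv A W (vderiv A U k) q)"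
    if "smooth_vfield A U" "smooth_vfield A W" "smooth_fun A k" for U W k
    using vderiv_bracket[OF that] by blast
  show "vderiv A (bracket A X (bracket A Y Z)) h p
      = vderiv A (\<lambda>q. bracket A (bracket A X Y) Z q + bracket A Y (bracket A X Z) q) h p"
    using assms h
    by (simp add: vderiv_field_add b vderiv_diff smooth_fun_vderiv smooth_vfield_bracket)
qed

section \<open>Tensoriality\<close>


declare smooth_fun_vderiv [simp] smooth_fun_const [simp] smooth_fun_add [simp] smooth_fun_mult [simp]
  smooth_fun_uminus [simp] smooth_fun_diff [simp] smooth_fun_sum [simp]
  smooth_vfield_scaleR [simp] smooth_vfield_add [simp] smooth_vfield_zero [simp]
  smooth_vfield_scaleR_const [simp] smooth_vfield_uminus [simp] smooth_vfield_diff [simp]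
  smooth_vfield_sum [simp] smooth_vfield_bracket [simp] smooth_extend [simp]

definition tensorial :: "'a \<Rightarrow> (('a, 'm) vfield \<Rightarrow> 'b::real_vector) \<Rightarrow> bool" where
  "tensorial p T \<longleftrightarrow>
    (\<forall>X Y. smooth_vfield A X \<longrightarrow> smooth_vfield A Y \<longrightarrow> T (\<lambda>q. X q + Y q) = T X + T Y) \<and>
    (\<forall>h X. smooth_fun A h \<longrightarrow> smooth_vfield A X \<longrightarrow> T (\<lambda>q. h q *\<^sub>R X q) = h p *\<^sub>R T X)"

lemma tensorial_add: "tensorial p T \<Longrightarrow> smooth_vfield A X \<Longrightarrow> smooth_vfield A Y \<Longrightarrow>
    T (\<lambda>q. X q + Y q) = T X + T Y"
  and tensorial_scaleR: "tensorial p T \<Longrightarrow> smooth_fun A h \<Longrightarrow> smooth_vfield A X \<Longrightarrow>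
    T (\<lambda>q. h q *\<^sub>R X q) = h p *\<^sub>R T X"
  by (simp_all add: tensorial_def)

lemma tensorial_sum:
  assumes T: "tensorial p T" and "finite I" "\<And>i. i \<in> I \<Longrightarrow> smooth_vfield A (X i)"
  shows "T (\<lambda>q. \<Sum>i\<in>I. X i q) = (\<Sum>i\<in>I. T (X i))"
  using assms(2,3)
proof (induction I rule: finite_induct)
  case empty
  then show ?case using tensorial_scaleR[OF T smooth_fun_const[of 0] smooth_vfield_zero] by simp
next
  case (insert i I)
  then show ?case by (simp add: tensorial_add[OF T])
qed

text \<open>After multiplication by a bump the field is a global combination of frame fields whose
  smooth coefficients vanish at \<open>p\<close>.\<close>

lemma tensorial_zero:
  assumes T: "tensorial p T" and Z: "smooth_vfield A Z" "Z p = 0"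
  shows "T Z = 0"
proof -
  obtain W E u where p: "p \<in> W" and F: "local_frame W E u" using exists_local_frame by blast
  note W = local_frameD(1)[OF F] p and E = local_frameD(2)[OF F] and u = local_frameD(3)[OF F]
    and e = local_frameD(5)[OF F]
  obtain b where b: "smooth_fun A b" "b p = 1" "\<And>q. q \<notin> W \<Longrightarrow> b q = 0"
    using bump_function[OF W] by blast
  have "b q *\<^sub>R Z q = (\<Sum>j\<in>UNIV. (b q * vderiv A Z (u j) q) *\<^sub>R E j q)" for q
  proof (cases "q \<in> W")
    case True
    have "b q *\<^sub>R Z q = b q *\<^sub>R (\<Sum>j\<in>UNIV. vderiv A Z (u j) q *\<^sub>R E j q)"
      unfolding vderiv_def by (rule arg_cong[OF e[OF True]])
    then show ?thesis by (simp add: scaleR_sum_right)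
  qed (simp add: b)
  then have "(\<lambda>q. b q *\<^sub>R Z q) = (\<lambda>q. \<Sum>j\<in>UNIV. (b q * vderiv A Z (u j) q) *\<^sub>R E j q)" by blast
  then have "T (\<lambda>q. b q *\<^sub>R Z q) = T (\<lambda>q. \<Sum>j\<in>UNIV. (b q * vderiv A Z (u j) q) *\<^sub>R E j q)" by simp
  also have "\<dots> = (\<Sum>j\<in>UNIV. T (\<lambda>q. (b q * vderiv A Z (u j) q) *\<^sub>R E j q))"
    by (rule tensorial_sum[OF T]) (simp_all add: b Z E u)
  also have "\<dots> = (\<Sum>j\<in>UNIV. (b p * vderiv A Z (u j) p) *\<^sub>R T (E j))"
    by (intro sum.cong refl tensorial_scaleR[OF T, where h = "\<lambda>q. b q * vderiv A Z (u _) q"]) (simp_all add: b Z E u)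
  also have "\<dots> = 0"
    using Z(2) linear_0[OF linear_tangent_deriv[OF u]] by (simp add: vderiv_def)
  finally show ?thesis using tensorial_scaleR[OF T b(1) Z(1)] b(2) by simp
qed

lemma tensorial_cong:
  assumes T: "tensorial p T" and "smooth_vfield A X" "smooth_vfield A Y" "X p = Y p"
  shows "T X = T Y"
proof -
  have "T (\<lambda>q. X q - Y q) = 0" by (rule tensorial_zero[OF T]) (use assms in auto)
  then have "T (\<lambda>q. (X q - Y q) + Y q) = T Y" using tensorial_add[OF T, of "\<lambda>q. X q - Y q" Y] assms by simp
  then show ?thesis by simp
qed

lemma tensorial_linear:
  assumes T: "tensorial p T"
  shows "linear (\<lambda>v. T (extend A p v))"
proof (rule linearI)
  show "T (extend A p (v + w)) = T (extend A p v) + T (extend A p w)" for v w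
    unfolding tensorial_add[OF T smooth_extend smooth_extend, symmetric]
    by (rule tensorial_cong[OF T]) auto
  show "T (extend A p (k *\<^sub>R v)) = k *\<^sub>R T (extend A p v)" for k v
    unfolding tensorial_scaleR[OF T smooth_fun_const smooth_extend, symmetric]
    by (rule tensorial_cong[OF T]) auto
qed

section \<open>The Lie derivative of a trace\<close>

text \<open>Contraction commutes with the Lie derivative: \<open>L\<close> is the Lie derivative of
  \<open>t\<close> along \<open>W\<close> at \<open>p\<close>. It is needed because star-Ricci is a
  trace.\<close>

lemma vderiv_trace:
  assumes W: "smooth_vfield A W" and t: "endo_field A t"
    and L: "linear L" "\<And>Z. smooth_vfield A Z \<Longrightarrow>
      L (Z p) = bracket A W (\<lambda>q. t q (Z q)) p - t p (bracket A W Z p)"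
  shows "vderiv A W (\<lambda>q. endo_trace (t q)) p = endo_trace L"
proof -
  obtain U E u where p: "p \<in> U" and F: "local_frame U E u" using exists_local_frame by blast
  note U = local_frameD(1)[OF F] p and E = local_frameD(2)[OF F] and u = local_frameD(3)[OF F]
    and d = local_frameD(4)[OF F] and e = local_frameD(5)[OF F]
  have tl: "linear (t q)" for q using t by (simp add: endo_field_def)
  have ts: "smooth_vfield A (\<lambda>q. t q (Z q))" if "smooth_vfield A Z" for Z
    using t that by (simp add: endo_field_def)
  have lin: "linear (\<lambda>v. tangent_deriv A q v (u k))" for q k by (rule linear_tangent_deriv[OF u])
  have lin': "linear (\<lambda>v. tangent_deriv A q v (vderiv A W (u k)))" for q k
    by (rule linear_tangent_deriv) (simp add: W u)
  let ?tE = "\<lambda>k q. t q (E k q)"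
  \<comment> \<open>In coordinates \<open>a\<close> is the matrix of \<open>t\<close> at
    \<open>p\<close> and \<open>b\<close> is the Jacobian of the components of
    \<open>W\<close>.\<close>
  define a where "a = (\<lambda>k j. tangent_deriv A p (?tE k p) (u j))"
  define b where "b = (\<lambda>k j. vderiv A (E k) (vderiv A W (u j)) p)"
  have "endo_trace (t q) = (\<Sum>k\<in>UNIV. vderiv A (?tE k) (u k) q)" if "q \<in> U" for q
    unfolding endo_trace_dual[OF tl lin e[OF that]] by (simp add: vderiv_def)
  then have "vderiv A W (\<lambda>q. endo_trace (t q)) p = vderiv A W (\<lambda>q. \<Sum>k\<in>UNIV. vderiv A (?tE k) (u k) q) p"
    unfolding vderiv_def[of A W] by (rule tangent_deriv_cong[OF U])
  also have "\<dots> = (\<Sum>k\<in>UNIV. vderiv A W (vderiv A (?tE k) (u k)) p)"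
    by (rule vderiv_sum) (simp add: ts E u)
  also have "\<dots> = (\<Sum>k\<in>UNIV. tangent_deriv A p (bracket A W (?tE k) p) (u k)
      + vderiv A (?tE k) (vderiv A W (u k)) p)"
    by (simp add: tangent_deriv_bracket[OF W ts[OF E] u])
  finally have 1: "vderiv A W (\<lambda>q. endo_trace (t q)) p = (\<Sum>k\<in>UNIV. tangent_deriv A p (bracket A W (?tE k) p) (u k)
      + vderiv A (?tE k) (vderiv A W (u k)) p)" .
  have 2: "vderiv A (?tE k) (vderiv A W (u k)) p = (\<Sum>j\<in>UNIV. a k j * b j k)" for k
  proof -
    have "?tE k p = (\<Sum>j\<in>UNIV. a k j *\<^sub>R E j p)" unfolding a_def by (rule e[OF U(2)])
    then have "vderiv A (?tE k) (vderiv A W (u k)) p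
        = tangent_deriv A p (\<Sum>j\<in>UNIV. a k j *\<^sub>R E j p) (vderiv A W (u k))"
      by (simp only: vderiv_def)
    then show ?thesis by (simp add: linear_sum[OF lin'] linear_scale[OF lin'] b_def vderiv_def)
  qed
  have 3: "tangent_deriv A p (t p (bracket A W (E k) p)) (u k) = - (\<Sum>j\<in>UNIV. b k j * a j k)" for k
  proof -
    have bk: "tangent_deriv A p (bracket A W (E k) p) (u j) = - b k j" for j
    proof -
      \<comment> \<open>The functions \<open>E k (u j)\<close> are constant near \<open>p\<close>,
        so one of the two terms of the bracket drops out.\<close>
      have "vderiv A W (vderiv A (E k) (u j)) p = vderiv A W (\<lambda>q. if k = j then 1 else 0) p"
        unfolding vderiv_def[of A W] by (rule tangent_deriv_cong[OF U]) (simp add: vderiv_def d)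
      then show ?thesis by (simp add: tangent_deriv_bracket[OF W E u] b_def)
    qed
    have "bracket A W (E k) p = (\<Sum>j\<in>UNIV. tangent_deriv A p (bracket A W (E k) p) (u j) *\<^sub>R E j p)"
      by (rule e[OF U(2)])
    then have "bracket A W (E k) p = (\<Sum>j\<in>UNIV. (- b k j) *\<^sub>R E j p)" by (simp only: bk)
    then have "t p (bracket A W (E k) p) = (\<Sum>j\<in>UNIV. (- b k j) *\<^sub>R ?tE j p)"
      by (simp only: linear_sum[OF tl] linear_scale[OF tl])
    then show ?thesis
      by (simp only: linear_sum[OF lin] linear_scale[OF lin]) (simp add: a_def sum_negf)
  qed
  \<comment> \<open>The corrections from both sides are the traces of \<open>a b\<close> and
    \<open>b a\<close>, which agree.\<close>
  have swap: "(\<Sum>k\<in>UNIV. \<Sum>j\<in>UNIV. b k j * a j k) = (\<Sum>k\<in>UNIV. \<Sum>j\<in>UNIV. a k j * b j k)"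
    by (subst sum.swap) (simp add: mult.commute)
  have "endo_trace L = (\<Sum>k\<in>UNIV. tangent_deriv A p (L (E k p)) (u k))"
    by (rule endo_trace_dual[OF L(1) lin e[OF U(2)]])
  also have "\<dots> = (\<Sum>k\<in>UNIV. tangent_deriv A p (bracket A W (?tE k) p) (u k) + (\<Sum>j\<in>UNIV. b k j * a j k))"
    by (simp add: L(2)[OF E] linear_diff[OF lin] 3)
  also have "\<dots> = vderiv A W (\<lambda>q. endo_trace (t q)) p"
    by (simp only: 1 2 sum.distrib swap)
  finally show ?thesis by simp
qed

end

section \<open>The Levi-Civita connection and the pointwise symmetries of its curvature\<close>

section \<open>Curvature of a Riemannian metric\<close>

locale riemannian_manifold = smooth_manifold A
  for A :: "('a::t2_space, 'm::finite) chart set" +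
  fixes g :: "'a \<Rightarrow> real ^ 'm \<Rightarrow> real ^ 'm \<Rightarrow> real"
    and D :: "('a, 'm) vfield \<Rightarrow> ('a, 'm) vfield \<Rightarrow> ('a, 'm) vfield"
  assumes metric: "riemannian_metric A g" and levi_civita: "levi_civita A g D"
begin

lemma smooth_D [simp]: "smooth_vfield A X \<Longrightarrow> smooth_vfield A Y \<Longrightarrow> smooth_vfield A (D X Y)"
  and D_add_left: "smooth_vfield A X \<Longrightarrow> smooth_vfield A Y \<Longrightarrow> smooth_vfield A Z \<Longrightarrow>
    D (\<lambda>q. X q + Y q) Z p = D X Z p + D Y Z p"
  and D_add_right: "smooth_vfield A X \<Longrightarrow> smooth_vfield A Y \<Longrightarrow> smooth_vfield A Z \<Longrightarrow>
    D X (\<lambda>q. Y q + Z q) p = D X Y p + D X Z p"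
  and D_scaleR_left: "smooth_fun A h \<Longrightarrow> smooth_vfield A X \<Longrightarrow> smooth_vfield A Y \<Longrightarrow>
    D (\<lambda>q. h q *\<^sub>R X q) Y p = h p *\<^sub>R D X Y p"
  and D_scaleR_right: "smooth_fun A h \<Longrightarrow> smooth_vfield A X \<Longrightarrow> smooth_vfield A Y \<Longrightarrow>
    D X (\<lambda>q. h q *\<^sub>R Y q) p = vderiv A X h p *\<^sub>R Y p + h p *\<^sub>R D X Y p"
  and bracket_eq_D: "smooth_vfield A X \<Longrightarrow> smooth_vfield A Y \<Longrightarrow> bracket A X Y p = D X Y p - D Y X p"
  and D_metric: "smooth_vfield A X \<Longrightarrow> smooth_vfield A Y \<Longrightarrow> smooth_vfield A Z \<Longrightarrow>
    vderiv A X (\<lambda>q. g q (Y q) (Z q)) p = g p (D X Y p) (Z p) + g p (Y p) (D X Z p)"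
  using levi_civita unfolding levi_civita_def affine_connection_def by metis+

lemma D_cscaleR_left: "smooth_vfield A X \<Longrightarrow> smooth_vfield A Y \<Longrightarrow> D (\<lambda>q. k *\<^sub>R X q) Y p = k *\<^sub>R D X Y p"
  and D_cscaleR_right: "smooth_vfield A X \<Longrightarrow> smooth_vfield A Y \<Longrightarrow> D X (\<lambda>q. k *\<^sub>R Y q) p = k *\<^sub>R D X Y p"
  using D_scaleR_left[of "\<lambda>q. k"] D_scaleR_right[of "\<lambda>q. k"] by simp_all

lemma D_uminus_left: "smooth_vfield A X \<Longrightarrow> smooth_vfield A Y \<Longrightarrow> D (\<lambda>q. - X q) Y p = - D X Y p"
  and D_uminus_right: "smooth_vfield A X \<Longrightarrow> smooth_vfield A Y \<Longrightarrow> D X (\<lambda>q. - Y q) p = - D X Y p"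
  using D_cscaleR_left[of X Y "-1"] D_cscaleR_right[of X Y "-1"] by simp_all

lemma D_diff_left: "smooth_vfield A X \<Longrightarrow> smooth_vfield A Y \<Longrightarrow> smooth_vfield A Z \<Longrightarrow>
    D (\<lambda>q. X q - Y q) Z p = D X Z p - D Y Z p"
  and D_diff_right: "smooth_vfield A X \<Longrightarrow> smooth_vfield A Y \<Longrightarrow> smooth_vfield A Z \<Longrightarrow>
    D X (\<lambda>q. Y q - Z q) p = D X Y p - D X Z p"
  using D_add_left[of X "\<lambda>q. - Y q" Z] D_add_right[of X Y "\<lambda>q. - Z q"]
  by (simp_all add: D_uminus_left D_uminus_right)

lemma D_zero_left: "smooth_vfield A Y \<Longrightarrow> D (\<lambda>q. 0) Y p = 0"
  and D_zero_right: "smooth_vfield A X \<Longrightarrow> D X (\<lambda>q. 0) p = 0"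
  using D_cscaleR_left[of "\<lambda>q. 0" Y 0] D_cscaleR_right[of X "\<lambda>q. 0" 0] by simp_all

lemma D_sum_right: "finite I \<Longrightarrow> smooth_vfield A X \<Longrightarrow> (\<And>i. i \<in> I \<Longrightarrow> smooth_vfield A (Y i)) \<Longrightarrow>
    D X (\<lambda>q. \<Sum>i\<in>I. Y i q) p = (\<Sum>i\<in>I. D X (Y i) p)"
  by (induction I rule: finite_induct) (simp_all add: D_zero_right D_add_right)

lemmas D_expand = D_add_left D_add_right D_scaleR_left D_scaleR_right D_diff_left D_diff_right

lemma bilinear_metric: "bilinear (g p)"
  and metric_sym: "g p v w = g p w v"
  and metric_pos: "v \<noteq> 0 \<Longrightarrow> g p v v > 0"
  and smooth_metric [simp]: "smooth_vfield A X \<Longrightarrow> smooth_vfield A Y \<Longrightarrow> smooth_fun A (\<lambda>q. g q (X q) (Y q))"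
  using metric unfolding riemannian_metric_def by blast+

sublocale tangent: pos_def_form "g p" for p
  by (intro pos_def_form.intro bilinear_metric metric_sym metric_pos)

lemmas metric_expand = tangent.form_expand
  and metric_eqI = tangent.form_eqI

lemma curvature_smooth [simp]:
  "smooth_vfield A X \<Longrightarrow> smooth_vfield A Y \<Longrightarrow> smooth_vfield A Z \<Longrightarrow> smooth_vfield A (curvature A D X Y Z)"
  unfolding curvature_def[abs_def] by simp

lemma D_bracket:
  "smooth_vfield A X \<Longrightarrow> smooth_vfield A Y \<Longrightarrow> smooth_vfield A Z \<Longrightarrow>
    D (bracket A X Y) Z p = D (D X Y) Z p - D (D Y X) Z p"
proof -
  assume "smooth_vfield A X" "smooth_vfield A Y" "smooth_vfield A Z"
  moreover from this have "bracket A X Y = (\<lambda>q. D X Y q - D Y X q)" by (simp add: bracket_eq_D fun_eq_iff)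
  ultimately show ?thesis by (simp add: D_diff_left)
qed

text \<open>Torsion-freeness removes the bracket, so the later computations need only the rules for
  \<open>D\<close>.\<close>

lemma curvature_alt:
  "smooth_vfield A X \<Longrightarrow> smooth_vfield A Y \<Longrightarrow> smooth_vfield A Z \<Longrightarrow>
    curvature A D X Y Z p = D X (D Y Z) p - D Y (D X Z) p - D (D X Y) Z p + D (D Y X) Z p"
  by (simp add: curvature_def D_bracket)

lemma curvature_skew:
  "smooth_vfield A X \<Longrightarrow> smooth_vfield A Y \<Longrightarrow> smooth_vfield A Z \<Longrightarrow>
    curvature A D X Y Z p = - curvature A D Y X Z p"
  by (simp add: curvature_alt)

lemma D_ext_rules:
  "smooth_vfield A X \<Longrightarrow> smooth_vfield A Y \<Longrightarrow> smooth_vfield A Z \<Longrightarrow> D (\<lambda>q. X q + Y q) Z = (\<lambda>q. D X Z q + D Y Z q)"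
  "smooth_vfield A X \<Longrightarrow> smooth_vfield A Y \<Longrightarrow> smooth_vfield A Z \<Longrightarrow> D X (\<lambda>q. Y q + Z q) = (\<lambda>q. D X Y q + D X Z q)"
  "smooth_fun A h \<Longrightarrow> smooth_vfield A X \<Longrightarrow> smooth_vfield A Y \<Longrightarrow> D (\<lambda>q. h q *\<^sub>R X q) Y = (\<lambda>q. h q *\<^sub>R D X Y q)"
  "smooth_fun A h \<Longrightarrow> smooth_vfield A X \<Longrightarrow> smooth_vfield A Y \<Longrightarrow>
    D X (\<lambda>q. h q *\<^sub>R Y q) = (\<lambda>q. vderiv A X h q *\<^sub>R Y q + h q *\<^sub>R D X Y q)"
  by (simp_all add: D_expand fun_eq_iff)

lemma curvature_tensorial_1:
  assumes "smooth_vfield A Y" "smooth_vfield A Z"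
  shows "tensorial p (\<lambda>X. curvature A D X Y Z p)"
  unfolding tensorial_def
proof (intro conjI allI impI)
  fix X X' assume "smooth_vfield A X" "smooth_vfield A X'"
  with assms show "curvature A D (\<lambda>q. X q + X' q) Y Z p = curvature A D X Y Z p + curvature A D X' Y Z p"
    by (simp add: curvature_alt D_ext_rules algebra_simps)
next
  fix h X assume "smooth_fun A h" "smooth_vfield A X"
  with assms show "curvature A D (\<lambda>q. h q *\<^sub>R X q) Y Z p = h p *\<^sub>R curvature A D X Y Z p"
    by (simp add: curvature_alt D_ext_rules algebra_simps)
qed

lemma curvature_tensorial_2:
  assumes "smooth_vfield A X" "smooth_vfield A Z"
  shows "tensorial p (\<lambda>Y. curvature A D X Y Z p)"
  unfolding tensorial_def
proof (intro conjI allI impI)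
  fix Y Y' assume "smooth_vfield A Y" "smooth_vfield A Y'"
  with assms show "curvature A D X (\<lambda>q. Y q + Y' q) Z p = curvature A D X Y Z p + curvature A D X Y' Z p"
    by (simp add: curvature_alt D_ext_rules algebra_simps)
next
  fix h Y assume "smooth_fun A h" "smooth_vfield A Y"
  with assms show "curvature A D X (\<lambda>q. h q *\<^sub>R Y q) Z p = h p *\<^sub>R curvature A D X Y Z p"
    by (simp add: curvature_alt D_ext_rules algebra_simps)
qed

lemma curvature_tensorial_3:
  assumes X: "smooth_vfield A X" and Y: "smooth_vfield A Y"
  shows "tensorial p (\<lambda>Z. curvature A D X Y Z p)"
  unfolding tensorial_def
proof (intro conjI allI impI)
  fix Z Z' assume "smooth_vfield A Z" "smooth_vfield A Z'"
  with assms show "curvature A D X Y (\<lambda>q. Z q + Z' q) p = curvature A D X Y Z p + curvature A D X Y Z' p"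
    by (simp add: curvature_alt D_ext_rules algebra_simps)
next
  fix h Z assume h: "smooth_fun A h" and Z: "smooth_vfield A Z"
  \<comment> \<open>The terms differentiating \<open>h\<close> twice leave \<open>[X, Y] h\<close>,
    which the term with the bracket compensates.\<close>
  have "vderiv A X (vderiv A Y h) p - vderiv A Y (vderiv A X h) p
      = vderiv A (D X Y) h p - vderiv A (D Y X) h p"
    using vderiv_bracket[OF X Y h, of p] linear_diff[OF linear_tangent_deriv[OF h]]
    by (simp add: vderiv_def[of A "bracket A X Y"] bracket_eq_D X Y vderiv_def[of A "D X Y"] vderiv_def[of A "D Y X"])
  then have e: "vderiv A X (vderiv A Y h) p = vderiv A Y (vderiv A X h) p
      + vderiv A (D X Y) h p - vderiv A (D Y X) h p" by simp
  show "curvature A D X Y (\<lambda>q. h q *\<^sub>R Z q) p = h p *\<^sub>R curvature A D X Y Z p"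
    using assms h Z by (simp add: curvature_alt D_ext_rules algebra_simps e)
qed

lemma curvature_at_eq:
  assumes X: "smooth_vfield A X" and Y: "smooth_vfield A Y" and Z: "smooth_vfield A Z"
  shows "curvature_at A D p (X p) (Y p) (Z p) = curvature A D X Y Z p"
proof -
  have "curvature_at A D p (X p) (Y p) (Z p) = curvature A D X (extend A p (Y p)) (extend A p (Z p)) p"
    unfolding curvature_at_def
    by (rule tensorial_cong[OF curvature_tensorial_1]) (simp_all add: X)
  also have "\<dots> = curvature A D X Y (extend A p (Z p)) p"
    by (rule tensorial_cong[OF curvature_tensorial_2]) (simp_all add: X Y)
  also have "\<dots> = curvature A D X Y Z p"
    by (rule tensorial_cong[OF curvature_tensorial_3]) (simp_all add: X Y Z)
  finally show ?thesis .
qed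

lemma curvature_at_linear:
  "linear (\<lambda>u. curvature_at A D p u v w)"
  "linear (\<lambda>v. curvature_at A D p u v w)"
  "linear (\<lambda>w. curvature_at A D p u v w)"
  unfolding curvature_at_def
  by (rule tensorial_linear[OF curvature_tensorial_1] tensorial_linear[OF curvature_tensorial_2]
      tensorial_linear[OF curvature_tensorial_3]; simp)+

lemma curvature_at_skew: "curvature_at A D p u v w = - curvature_at A D p v u w"
  unfolding curvature_at_def by (rule curvature_skew) simp_all

text \<open>This is the Jacobi identity with every bracket expanded by torsion-freeness.\<close>

lemma curvature_at_bianchi:
  "curvature_at A D p u v w + curvature_at A D p v w u + curvature_at A D p w u v = 0"
proof -
  define X Y Z where "X = extend A p u" "Y = extend A p v" "Z = extend A p w"
  have s: "smooth_vfield A X" "smooth_vfield A Y" "smooth_vfield A Z" by (simp_all add: X_Y_Z_def)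
  have b: "bracket A U V = (\<lambda>q. D U V q - D V U q)" if "smooth_vfield A U" "smooth_vfield A V" for U V
    using that by (simp add: bracket_eq_D fun_eq_iff)
  have "bracket A X (bracket A Y Z) p = bracket A (bracket A X Y) Z p + bracket A Y (bracket A X Z) p"
    by (rule bracket_jacobi[OF s])
  then have "D X (D Y Z) p - D X (D Z Y) p - (D (D Y Z) X p - D (D Z Y) X p)
      = D (D X Y) Z p - D (D Y X) Z p - (D Z (D X Y) p - D Z (D Y X) p)
        + (D Y (D X Z) p - D Y (D Z X) p - (D (D X Z) Y p - D (D Z X) Y p))"
    using s by (simp add: b D_diff_left D_diff_right)
  then have "curvature A D X Y Z p + curvature A D Y Z X p + curvature A D Z X Y p = 0"
    using s by (simp add: curvature_alt algebra_simps)
  then show ?thesis by (simp add: curvature_at_def X_Y_Z_def)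
qed

text \<open>Metric compatibility is applied twice to the function \<open>g(Z, W)\<close>, on which
  \<open>[X, Y]\<close> acts as the commutator of derivations; mixed first derivatives
  cancel.\<close>

lemma curvature_at_skew_metric: "g p (curvature_at A D p u v w) z = - g p (curvature_at A D p u v z) w"
proof -
  define X Y Z W where "X = extend A p u" "Y = extend A p v" "Z = extend A p w" "W = extend A p z"
  have s: "smooth_vfield A X" "smooth_vfield A Y" "smooth_vfield A Z" "smooth_vfield A W"
    by (simp_all add: X_Y_Z_W_def)
  have ext: "vderiv A U (\<lambda>q. g q (Z q) (W q)) = (\<lambda>q. g q (D U Z q) (W q) + g q (Z q) (D U W q))"
    if "smooth_vfield A U" for U using D_metric[OF that s(3,4)] by blast
  have two: "vderiv A U (vderiv A U' (\<lambda>q. g q (Z q) (W q))) p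
      = g p (D U (D U' Z) p) (W p) + g p (D U' Z p) (D U W p)
        + g p (D U Z p) (D U' W p) + g p (Z p) (D U (D U' W) p)"
    if "smooth_vfield A U" "smooth_vfield A U'" for U U'
    using that s by (simp add: ext vderiv_add D_metric)
  have "vderiv A (bracket A X Y) (\<lambda>q. g q (Z q) (W q)) p
      = vderiv A X (vderiv A Y (\<lambda>q. g q (Z q) (W q))) p - vderiv A Y (vderiv A X (\<lambda>q. g q (Z q) (W q))) p"
    by (rule vderiv_bracket) (simp_all add: s)
  then have "g p (curvature A D X Y Z p) (W p) + g p (Z p) (curvature A D X Y W p) = 0"
    using s by (simp add: two D_metric curvature_def metric_expand)
  moreover have "W p = z" "Z p = w" by (simp_all add: X_Y_Z_W_def)
  ultimately have "g p (curvature A D X Y Z p) z = - g p (curvature A D X Y W p) w"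
    using metric_sym[of p w "curvature A D X Y W p"] by simp
  then show ?thesis by (simp only: curvature_at_def X_Y_Z_W_def)
qed

sublocale curv: algebraic_curvature "g p" "curvature_at A D p" for p
proof (intro algebraic_curvature.intro algebraic_curvature_axioms.intro tangent.pos_def_form_axioms)
  show "linear (\<lambda>u. curvature_at A D p u v w)" for v w by (rule curvature_at_linear(1))
  show "linear (\<lambda>v. curvature_at A D p u v w)" for u w by (rule curvature_at_linear(2))
  show "linear (\<lambda>w. curvature_at A D p u v w)" for u v by (rule curvature_at_linear(3))
  show "curvature_at A D p u v w = - curvature_at A D p v u w" for u v w by (rule curvature_at_skew)
  show "curvature_at A D p u v w + curvature_at A D p v w u + curvature_at A D p w u v = 0" for u v w
    by (rule curvature_at_bianchi)
  show "g p (curvature_at A D p u v w) z = - g p (curvature_at A D p u v z) w" for u v w z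
    by (rule curvature_at_skew_metric)
qed

end

section \<open>Geometry of the structure: covariant derivatives, curvature, comparison with the
  model\<close>

section \<open>Weak beta-f-Kenmotsu manifolds\<close>

locale weak_Kenmotsu_manifold = riemannian_manifold A g D
  for A :: "('a::t2_space, 'm::finite) chart set" and g D +
  fixes n s :: nat and f Q :: "'a \<Rightarrow> real ^ 'm \<Rightarrow> real ^ 'm"
    and \<xi> :: "nat \<Rightarrow> ('a, 'm) vfield" and \<eta> :: "nat \<Rightarrow> 'a \<Rightarrow> real ^ 'm \<Rightarrow> real" and \<beta> :: real
  assumes kenmotsu: "weak_beta_f_Kenmotsu A n s f Q \<xi> \<eta> g D (\<lambda>_. \<beta>)"
begin

(* Keeps membership in the index set {1..s} atomic for the simplifier. *)
declare One_nat_def [simp del] atLeastAtMost_iff [simp del]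

lemma weak_structure: "weak_metric_f_structure A n s f Q \<xi> \<eta> g"
  using kenmotsu unfolding weak_beta_f_Kenmotsu_def by blast

lemma s_gt_1: "s > 1" and dimension: "CARD('m) = 2 * n + s"
  and f_endo: "endo_field A f" and Q_endo: "endo_field A Q"
  and smooth_xi [simp]: "i \<in> {1..s} \<Longrightarrow> smooth_vfield A (\<xi> i)"
  and eta_form: "i \<in> {1..s} \<Longrightarrow> one_form A (\<eta> i)"
  and f_skew: "g p (f p v) w = - g p v (f p w)"
  and Q_bij: "bij (Q p)"
  and xi_orthonormal: "i \<in> {1..s} \<Longrightarrow> j \<in> {1..s} \<Longrightarrow> g p (\<xi> i p) (\<xi> j p) = (if i = j then 1 else 0)"
  and eta_xi: "i \<in> {1..s} \<Longrightarrow> j \<in> {1..s} \<Longrightarrow> \<eta> i p (\<xi> j p) = (if i = j then 1 else 0)"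
  and Q_xi: "i \<in> {1..s} \<Longrightarrow> Q p (\<xi> i p) = \<xi> i p"
  and f_f: "f p (f p v) = - Q p v + (\<Sum>i=1..s. \<eta> i p v *\<^sub>R \<xi> i p)"
  and f_compatible: "g p (f p v) (f p w) = g p v (Q p w) - (\<Sum>i=1..s. \<eta> i p v * \<eta> i p w)"
  using weak_structure unfolding weak_metric_f_structure_def by blast+

lemma s_pos: "real s \<noteq> 0" using s_gt_1 by simp

lemma linear_f: "linear (f p)" and smooth_f [simp]: "smooth_vfield A X \<Longrightarrow> smooth_vfield A (\<lambda>q. f q (X q))"
  using f_endo by (simp_all add: endo_field_def)

lemma linear_Q: "linear (Q p)" using Q_endo by (simp add: endo_field_def)

lemma linear_eta: "i \<in> {1..s} \<Longrightarrow> linear (\<eta> i p)"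
  and smooth_eta [simp]: "i \<in> {1..s} \<Longrightarrow> smooth_vfield A X \<Longrightarrow> smooth_fun A (\<lambda>q. \<eta> i q (X q))"
  using eta_form by (simp_all add: one_form_def)

lemmas f_linear = linear_add[OF linear_f] linear_diff[OF linear_f] linear_scale[OF linear_f]
  linear_neg[OF linear_f] linear_0[OF linear_f]

text \<open>\<open>Q\<close> fixes \<xi>_j, so \<open>f f\<close> kills it; skewness then makes the
  norm of \<open>f\<close> \<xi>_j zero.\<close>

lemma f_xi: "f p (\<xi> j p) = 0" if j: "j \<in> {1..s}"
proof -
  have "(\<Sum>i=1..s. \<eta> i p (\<xi> j p) *\<^sub>R \<xi> i p) = (\<Sum>i=1..s. if i = j then \<xi> i p else 0)"
    by (rule sum.cong) (use j in \<open>auto simp: eta_xi\<close>)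
  then have "f p (f p (\<xi> j p)) = 0" using j by (simp add: f_f Q_xi)
  then have "g p (f p (\<xi> j p)) (f p (\<xi> j p)) = 0" by (simp add: f_skew metric_expand)
  then show ?thesis using metric_pos[of "f p (\<xi> j p)" p] by (cases "f p (\<xi> j p) = 0") auto
qed

lemma eta_eq_metric: "\<eta> j p v = g p v (\<xi> j p)" if j: "j \<in> {1..s}"
proof -
  have "(\<Sum>i=1..s. \<eta> i p v * \<eta> i p (\<xi> j p)) = (\<Sum>i=1..s. if i = j then \<eta> i p v else 0)"
    by (rule sum.cong) (use j in \<open>auto simp: eta_xi\<close>)
  then show ?thesis using f_compatible[of p v "\<xi> j p"] j by (simp add: Q_xi f_xi metric_expand)
qed

lemma eta_f: "i \<in> {1..s} \<Longrightarrow> \<eta> i p (f p v) = 0"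
  by (simp add: eta_eq_metric f_skew f_xi metric_expand)

definition hor :: "'a \<Rightarrow> real ^ 'm \<Rightarrow> real ^ 'm" where
  "hor p v = v - (\<Sum>i=1..s. \<eta> i p v *\<^sub>R \<xi> i p)"

abbreviation eb where "eb \<equiv> eta_bar s \<eta>"
abbreviation xb where "xb \<equiv> xi_bar s \<xi>"

lemma linear_eb: "linear (eb p)"
  unfolding eta_bar_def[abs_def] by (rule linear_compose_sum) (use linear_eta in auto)

lemma linear_hor: "linear (hor p)"
proof (rule linearI)
  show "hor p (v + w) = hor p v + hor p w" for v w
    unfolding hor_def by (simp add: linear_add[OF linear_eta] scaleR_add_left sum.distrib cong: sum.cong)
  show "hor p (k *\<^sub>R v) = k *\<^sub>R hor p v" for k v
    unfolding hor_def by (simp add: linear_scale[OF linear_eta] scaleR_diff_right scaleR_sum_right cong: sum.cong)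
qed

lemmas eb_linear = linear_add[OF linear_eb] linear_diff[OF linear_eb] linear_scale[OF linear_eb]
  linear_neg[OF linear_eb] linear_0[OF linear_eb]
lemmas hor_linear = linear_add[OF linear_hor] linear_diff[OF linear_hor] linear_scale[OF linear_hor]
  linear_neg[OF linear_hor] linear_0[OF linear_hor]

lemma smooth_hor [simp]: "smooth_vfield A X \<Longrightarrow> smooth_vfield A (\<lambda>q. hor q (X q))"
  unfolding hor_def by simp

lemma smooth_eb [simp]: "smooth_vfield A X \<Longrightarrow> smooth_fun A (\<lambda>q. eb q (X q))"
  unfolding eta_bar_def by simp

lemma smooth_xb [simp]: "smooth_vfield A xb"
  unfolding xi_bar_def[abs_def] by simp

lemma eb_eq_metric: "eb p v = g p v (xb p)"
  unfolding eta_bar_def xi_bar_def linear_sum[of "g p v", OF conjunct1[OF bilinear_metric[unfolded bilinear_def], THEN spec]]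
  by (rule sum.cong) (simp_all add: eta_eq_metric)

lemma metric_sum_right: "g p v (\<Sum>i\<in>I. w i) = (\<Sum>i\<in>I. g p v (w i))"
  using bilinear_metric[of p] by (simp add: bilinear_def linear_sum)

lemma metric_sum_left: "g p (\<Sum>i\<in>I. w i) v = (\<Sum>i\<in>I. g p (w i) v)"
  by (simp add: metric_sym[of p _ v] metric_sum_right)

lemma eta_hor: "j \<in> {1..s} \<Longrightarrow> \<eta> j p (hor p v) = 0"
proof -
  assume j: "j \<in> {1..s}"
  have "(\<Sum>i=1..s. \<eta> i p v * g p (\<xi> i p) (\<xi> j p)) = (\<Sum>i=1..s. if i = j then \<eta> i p v else 0)"
    by (rule sum.cong) (use j in \<open>auto simp: xi_orthonormal\<close>)
  then show ?thesis using j
    by (simp add: eta_eq_metric[OF j] hor_def metric_expand metric_sum_left)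
qed

lemma hor_xi: "hor p (\<xi> j p) = 0" if j: "j \<in> {1..s}"
proof -
  have "(\<Sum>i=1..s. \<eta> i p (\<xi> j p) *\<^sub>R \<xi> i p) = (\<Sum>i=1..s. if i = j then \<xi> i p else 0)"
    by (rule sum.cong) (use j in \<open>auto simp: eta_xi\<close>)
  then show ?thesis using j by (simp add: hor_def)
qed

lemma hor_hor [simp]: "hor p (hor p v) = hor p v"
  using eta_hor[of _ p v] unfolding hor_def[of p "hor p v"] by simp

lemma hor_f [simp]: "hor p (f p v) = f p v"
  using eta_f[of _ p v] unfolding hor_def by simp

lemma f_hor [simp]: "f p (hor p v) = f p v"
  unfolding hor_def by (simp add: f_linear linear_sum[OF linear_f] f_xi)

lemma hor_xb [simp]: "hor p (xb p) = 0"
  unfolding xi_bar_def by (simp add: linear_sum[OF linear_hor] hor_xi)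

lemma f_xb [simp]: "f p (xb p) = 0"
  unfolding xi_bar_def by (simp add: linear_sum[OF linear_f] f_xi)

lemma eb_f [simp]: "eb p (f p v) = 0"
  by (simp add: eta_bar_def eta_f)

lemma eb_hor [simp]: "eb p (hor p v) = 0"
  by (simp add: eta_bar_def eta_hor)

lemma eb_xi: "j \<in> {1..s} \<Longrightarrow> eb p (\<xi> j p) = 1"
  by (simp add: eta_bar_def eta_xi)

lemma eb_xb [simp]: "eb p (xb p) = real s"
  unfolding xi_bar_def by (simp add: linear_sum[OF linear_eb] eb_xi)

lemma metric_hor: "g p (hor p v) w = g p v (hor p w)"
proof -
  have "(\<Sum>i=1..s. \<eta> i p v * g p (\<xi> i p) w) = (\<Sum>i=1..s. \<eta> i p w * g p v (\<xi> i p))"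
    by (rule sum.cong) (auto simp: eta_eq_metric metric_sym[of p _ w])
  then show ?thesis
    by (simp add: hor_def metric_expand metric_sum_left metric_sum_right)
qed

lemma metric_hor_self: "g p (hor p v) w = g p v w - (\<Sum>i=1..s. \<eta> i p v * \<eta> i p w)"
  unfolding hor_def by (simp add: metric_expand metric_sum_left eta_eq_metric metric_sym[of p _ w])

text \<open>On the kernel of \<open>f\<close> the vector \<open>Q v\<close> is a combination of the
  \<xi>_i, all fixed by \<open>Q\<close>; injectivity of \<open>Q\<close> shows that
  \<open>v\<close> is the same combination.\<close>

lemma f_eq_0_imp: "f p v = 0 \<Longrightarrow> hor p v = 0"
proof -
  assume "f p v = 0"
  then have "Q p v = (\<Sum>i=1..s. \<eta> i p v *\<^sub>R \<xi> i p)" using f_f[of p v] by (simp add: f_linear)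
  also have "\<dots> = Q p (\<Sum>i=1..s. \<eta> i p v *\<^sub>R \<xi> i p)"
    by (simp add: linear_sum[OF linear_Q] linear_scale[OF linear_Q] Q_xi)
  finally have "v = (\<Sum>i=1..s. \<eta> i p v *\<^sub>R \<xi> i p)" using Q_bij by (meson bij_is_inj injD)
  then show ?thesis by (simp add: hor_def)
qed

section \<open>The covariant derivatives of the structure\<close>

lemma D_f:
  assumes "smooth_vfield A X" "smooth_vfield A Y"
  shows "D X (\<lambda>q. f q (Y q)) p = f p (D X Y p)
    + \<beta> *\<^sub>R (g p (f p (X p)) (Y p) *\<^sub>R xb p - eb p (Y p) *\<^sub>R f p (X p))"
proof -
  have "D X (\<lambda>q. f q (Y q)) p - f p (D X Y p)
      = \<beta> *\<^sub>R (g p (f p (X p)) (Y p) *\<^sub>R xb p - eb p (Y p) *\<^sub>R f p (X p))"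
    using kenmotsu assms unfolding weak_beta_f_Kenmotsu_def by blast
  then show ?thesis by (simp add: algebra_simps)
qed

text \<open>Differentiating \<open>f\<close> \<xi>_i = 0 determines \<nabla>\<xi>_i up to the kernel
  of \<open>f\<close>; the vertical part has to come from normality.\<close>

lemma hor_D_xi:
  assumes X: "smooth_vfield A X" and i: "i \<in> {1..s}"
  shows "hor p (D X (\<xi> i) p) = \<beta> *\<^sub>R hor p (X p)"
proof -
  have "(\<lambda>q. f q (\<xi> i q)) = (\<lambda>q. 0)" using f_xi[OF i] by simp
  then have "f p (D X (\<xi> i) p) + \<beta> *\<^sub>R (g p (f p (X p)) (\<xi> i p) *\<^sub>R xb p - eb p (\<xi> i p) *\<^sub>R f p (X p)) = 0"
    using D_f[OF X smooth_xi[OF i], of p] by (simp add: D_zero_right X)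
  then have "f p (D X (\<xi> i) p - \<beta> *\<^sub>R X p) = 0"
    using i by (simp add: f_skew f_xi eb_xi metric_expand f_linear)
  then have "hor p (D X (\<xi> i) p - \<beta> *\<^sub>R X p) = 0" by (rule f_eq_0_imp)
  then show ?thesis by (simp add: hor_linear)
qed

lemma D_xi_skew:
  assumes "smooth_vfield A X" "i \<in> {1..s}" "j \<in> {1..s}"
  shows "g p (D X (\<xi> i) p) (\<xi> j p) = - g p (D X (\<xi> j) p) (\<xi> i p)"
proof -
  have "(\<lambda>q. g q (\<xi> i q) (\<xi> j q)) = (\<lambda>q. if i = j then 1 else 0)" using assms xi_orthonormal by simp
  then show ?thesis
    using D_metric[OF assms(1) smooth_xi[OF assms(2)] smooth_xi[OF assms(3)], of p]
      metric_sym[of p "\<xi> i p" "D X (\<xi> j) p"] by simp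
qed

text \<open>The \<eta>^k component of normality on the pair X, \<xi>_i. Each Nijenhuis term lies in
  the range of \<open>f\<close> or contains \<open>f\<close> \<xi>_i, so what remains is
  d\<eta>^k(X, \<xi>_i) = 0, expressed through \<nabla>.\<close>

lemma D_xi_normal:
  assumes X: "smooth_vfield A X" and i: "i \<in> {1..s}" and k: "k \<in> {1..s}"
  shows "g p (D X (\<xi> i) p) (\<xi> k p) = - g p (X p) (D (\<xi> i) (\<xi> k) p)"
proof -
  have z: "(\<lambda>q. f q (\<xi> i q)) = (\<lambda>q. 0)" using f_xi[OF i] by simp
  have b0: "bracket A Y (\<lambda>q. 0) p = 0" if "smooth_vfield A Y" for Y
    using that by (simp add: bracket_eq_D D_zero_left D_zero_right)
  have "nijenhuis A f X (\<xi> i) p + 2 *\<^sub>R (\<Sum>j=1..s. d_form A (\<eta> j) X (\<xi> i) p *\<^sub>R \<xi> j p) = 0"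
    using kenmotsu X smooth_xi[OF i] unfolding weak_beta_f_Kenmotsu_def normal_structure_def by blast
  then have "\<eta> k p (nijenhuis A f X (\<xi> i) p + 2 *\<^sub>R (\<Sum>j=1..s. d_form A (\<eta> j) X (\<xi> i) p *\<^sub>R \<xi> j p)) = 0"
    by (simp only: linear_0[OF linear_eta[OF k]])
  then have "\<eta> k p (nijenhuis A f X (\<xi> i) p)
      + 2 * (\<Sum>j=1..s. d_form A (\<eta> j) X (\<xi> i) p * \<eta> k p (\<xi> j p)) = 0"
    by (simp only: linear_add[OF linear_eta[OF k]] linear_scale[OF linear_eta[OF k]]
        linear_sum[OF linear_eta[OF k]] real_scaleR_def)
  moreover have "\<eta> k p (nijenhuis A f X (\<xi> i) p) = 0"
    unfolding nijenhuis_def z b0[OF X] b0[OF smooth_f[OF X]]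
    using k by (simp add: linear_add[OF linear_eta[OF k]] linear_diff[OF linear_eta[OF k]] eta_f
        linear_0[OF linear_eta[OF k]] f_linear)
  moreover have "(\<Sum>j=1..s. d_form A (\<eta> j) X (\<xi> i) p * \<eta> k p (\<xi> j p))
      = (\<Sum>j=1..s. if j = k then d_form A (\<eta> j) X (\<xi> i) p else 0)"
    by (rule sum.cong) (use k in \<open>auto simp: eta_xi\<close>)
  ultimately have "d_form A (\<eta> k) X (\<xi> i) p = 0"
    using k by simp
  moreover have "(\<lambda>q. \<eta> k q (\<xi> i q)) = (\<lambda>q. if k = i then 1 else 0)" using i k eta_xi by simp
  moreover have "(\<lambda>q. \<eta> k q (X q)) = (\<lambda>q. g q (X q) (\<xi> k q))" using eta_eq_metric[OF k] by simp
  ultimately show ?thesis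
    using X i k D_xi_skew[OF X i k, of p] metric_sym[of p "\<xi> i p" "D X (\<xi> k) p"]
    by (simp add: d_form_def D_metric bracket_eq_D eta_eq_metric metric_expand)
qed

text \<open>A cyclic shift of the indices changes the sign, and three shifts give back the same
  number.\<close>

lemma D_xi_xi_vertical:
  assumes "i \<in> {1..s}" "j \<in> {1..s}" "k \<in> {1..s}"
  shows "g p (D (\<xi> i) (\<xi> j) p) (\<xi> k p) = 0"
proof -
  define a where "a = (\<lambda>i j k. g p (D (\<xi> i) (\<xi> j) p) (\<xi> k p))"
  have 1: "a i j k = - a i k j" if "i \<in> {1..s}" "j \<in> {1..s}" "k \<in> {1..s}" for i j k
    unfolding a_def using that by (intro D_xi_skew) simp_all
  have 2: "a i j k = - a j k i" if "i \<in> {1..s}" "j \<in> {1..s}" "k \<in> {1..s}" for i j k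
    unfolding a_def using D_xi_normal[OF smooth_xi[OF that(1)] that(2,3), of p]
    by (simp add: metric_sym[of p "\<xi> i p"])
  show ?thesis
    using 1[OF assms] 2[OF assms] 1[OF assms(2,3,1)] 2[OF assms(2,3,1)] 1[OF assms(3,1,2)] 2[OF assms(3,1,2)]
    by (simp add: a_def)
qed

text \<open>Normality reduces the vertical part to \<nabla> of \<xi>_k along \<xi>_i. That vanishes,
  having no vertical part and horizontal part \<beta> times that of \<xi>_i.\<close>

lemma D_xi:
  assumes X: "smooth_vfield A X" and i: "i \<in> {1..s}"
  shows "D X (\<xi> i) p = \<beta> *\<^sub>R hor p (X p)"
proof -
  have hor_id: "v = hor p v" if "\<And>k. k \<in> {1..s} \<Longrightarrow> g p v (\<xi> k p) = 0" for v
    unfolding hor_def using that by (simp add: eta_eq_metric)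
  have 0: "D (\<xi> i) (\<xi> k) p = 0" if k: "k \<in> {1..s}" for k
  proof -
    have "D (\<xi> i) (\<xi> k) p = hor p (D (\<xi> i) (\<xi> k) p)"
      by (rule hor_id) (use i k D_xi_xi_vertical in blast)
    then show ?thesis using hor_D_xi[OF smooth_xi[OF i] k, of p] i by (simp add: hor_xi)
  qed
  have "D X (\<xi> i) p = hor p (D X (\<xi> i) p)"
    by (rule hor_id) (use D_xi_normal[OF X i] 0 in \<open>simp add: metric_expand\<close>)
  then show ?thesis using hor_D_xi[OF X i, of p] by simp
qed

lemma D_xb: "smooth_vfield A X \<Longrightarrow> D X xb p = (real s * \<beta>) *\<^sub>R hor p (X p)"
  unfolding xi_bar_def[abs_def] by (simp add: D_sum_right D_xi sum_constant_scaleR del: sum_constant)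

lemma vderiv_eta:
  assumes "smooth_vfield A X" "smooth_vfield A Y" "i \<in> {1..s}"
  shows "vderiv A X (\<lambda>q. \<eta> i q (Y q)) p = \<eta> i p (D X Y p) + \<beta> * g p (hor p (X p)) (Y p)"
proof -
  have "(\<lambda>q. \<eta> i q (Y q)) = (\<lambda>q. g q (Y q) (\<xi> i q))" using eta_eq_metric[OF assms(3)] by simp
  then show ?thesis
    using assms by (simp add: D_metric D_xi eta_eq_metric metric_expand metric_sym[of p "Y p"])
qed

lemma vderiv_eb:
  assumes "smooth_vfield A X" "smooth_vfield A Y"
  shows "vderiv A X (\<lambda>q. eb q (Y q)) p = eb p (D X Y p) + real s * \<beta> * g p (hor p (X p)) (Y p)"
  unfolding eta_bar_def using assms by (simp add: vderiv_sum vderiv_eta sum.distrib)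

lemma D_hor:
  assumes X: "smooth_vfield A X" and Y: "smooth_vfield A Y"
  shows "D X (\<lambda>q. hor q (Y q)) p = hor p (D X Y p)
    - (\<beta> * g p (hor p (X p)) (Y p)) *\<^sub>R xb p - (\<beta> * eb p (Y p)) *\<^sub>R hor p (X p)"
proof -
  have "D X (\<lambda>q. \<Sum>i=1..s. \<eta> i q (Y q) *\<^sub>R \<xi> i q) p
      = (\<Sum>i=1..s. (\<eta> i p (D X Y p) + \<beta> * g p (hor p (X p)) (Y p)) *\<^sub>R \<xi> i p
        + \<eta> i p (Y p) *\<^sub>R \<beta> *\<^sub>R hor p (X p))"
    using X Y by (simp add: D_sum_right D_scaleR_right vderiv_eta D_xi)
  also have "\<dots> = (\<Sum>i=1..s. \<eta> i p (D X Y p) *\<^sub>R \<xi> i p)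
      + (\<beta> * g p (hor p (X p)) (Y p)) *\<^sub>R xb p + (\<beta> * eb p (Y p)) *\<^sub>R hor p (X p)"
    by (simp add: scaleR_add_left sum.distrib xi_bar_def eta_bar_def scaleR_sum_right scaleR_sum_left
        sum_distrib_left mult.commute)
  finally show ?thesis
    unfolding hor_def[of _ "Y _"] hor_def[of p "D X Y p"] using X Y by (simp add: D_diff_right)
qed

section \<open>The curvature of the structure\<close>

lemma curvature_xi:
  assumes X: "smooth_vfield A X" and Y: "smooth_vfield A Y" and i: "i \<in> {1..s}"
  shows "curvature A D X Y (\<xi> i) p = \<beta>\<^sup>2 *\<^sub>R (eb p (X p) *\<^sub>R hor p (Y p) - eb p (Y p) *\<^sub>R hor p (X p))"
proof -
  have e: "D Z (\<xi> i) = (\<lambda>q. \<beta> *\<^sub>R hor q (Z q))" if "smooth_vfield A Z" for Z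
    using D_xi[OF that i] by blast
  show ?thesis
    using X Y i
    by (simp add: curvature_alt e D_cscaleR_right D_hor metric_hor metric_sym[of p "Y p"] hor_linear)
      (simp add: algebra_simps power2_eq_square)
qed

lemma curvature_f:
  fixes p :: 'a
  assumes X: "smooth_vfield A X" and Y: "smooth_vfield A Y" and Z: "smooth_vfield A Z"
  defines "x \<equiv> X p" and "y \<equiv> Y p" and "z \<equiv> Z p"
  shows "curvature A D X Y (\<lambda>q. f q (Z q)) p = f p (curvature A D X Y Z p)
    + \<beta>\<^sup>2 *\<^sub>R ((eb p x * g p (f p y) z - eb p y * g p (f p x) z) *\<^sub>R xb p
      + (real s * g p (f p y) z) *\<^sub>R hor p x - (real s * g p (f p x) z) *\<^sub>R hor p y
      - (real s * g p (hor p x) z) *\<^sub>R f p y + (real s * g p (hor p y) z) *\<^sub>R f p x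
      + (eb p z * eb p y) *\<^sub>R f p x - (eb p z * eb p x) *\<^sub>R f p y)"
proof -
  have e: "D U (\<lambda>q. f q (Z q)) = (\<lambda>q. f q (D U Z q)
      + \<beta> *\<^sub>R (g q (f q (U q)) (Z q) *\<^sub>R xb q - eb q (Z q) *\<^sub>R f q (U q)))" if "smooth_vfield A U" for U
    using D_f[OF that Z] by blast
  \<comment> \<open>The first-derivative formula is differentiated once more. Terms in
    \<open>D U Z\<close> and \<open>D V Z\<close> are symmetric in \<open>U\<close> and
    \<open>V\<close> and cancel in the commutator; those in \<open>D U V\<close> cancel against
    \<open>D1\<close>.\<close>
  have two: "D U (D V (\<lambda>q. f q (Z q))) p = f p (D U (D V Z) p)
      + \<beta> *\<^sub>R (g p (f p (U p)) (D V Z p) *\<^sub>R xb p - eb p (D V Z p) *\<^sub>R f p (U p))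
      + \<beta> *\<^sub>R ((g p (f p (D U V p)) z + \<beta> * g p (f p (U p)) (V p) * eb p z - \<beta> * eb p (V p) * g p (f p (U p)) z
            + g p (f p (V p)) (D U Z p)) *\<^sub>R xb p
          + (g p (f p (V p)) z * (real s * \<beta>)) *\<^sub>R hor p (U p)
          - (eb p (D U Z p) + real s * \<beta> * g p (hor p (U p)) z) *\<^sub>R f p (V p)
          - eb p z *\<^sub>R (f p (D U V p)
              + \<beta> *\<^sub>R (g p (f p (U p)) (V p) *\<^sub>R xb p - eb p (V p) *\<^sub>R f p (U p))))"
    if U: "smooth_vfield A U" and V: "smooth_vfield A V" for U V
  proof -
    have xz: "g p (xb p) w = eb p w" for w by (simp add: eb_eq_metric metric_sym[of p w])
    have 1: "D U (\<lambda>q. f q (D V Z q)) p = f p (D U (D V Z) p)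
      + \<beta> *\<^sub>R (g p (f p (U p)) (D V Z p) *\<^sub>R xb p - eb p (D V Z p) *\<^sub>R f p (U p))"
      using U V Z by (simp add: D_f)
    have 2: "vderiv A U (\<lambda>q. g q (f q (V q)) (Z q)) p
      = g p (f p (D U V p)) z + \<beta> * g p (f p (U p)) (V p) * eb p z - \<beta> * eb p (V p) * g p (f p (U p)) z
            + g p (f p (V p)) (D U Z p)"
      using U V Z by (simp add: D_metric D_f metric_expand xz z_def algebra_simps)
    show ?thesis
      unfolding e[OF V] using U V Z 2
      by (simp add: D_add_right D_cscaleR_right D_diff_right D_scaleR_right 1 D_xb vderiv_eb D_f z_def)
  qed
  have skew: "g p (f p y) x = - g p (f p x) y" by (simp add: f_skew[of p y] metric_sym[of p y])
  have D1: "D (D U V) (\<lambda>q. f q (Z q)) p = f p (D (D U V) Z p)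
      + \<beta> *\<^sub>R (g p (f p (D U V p)) z *\<^sub>R xb p - eb p z *\<^sub>R f p (D U V p))"
    if "smooth_vfield A U" "smooth_vfield A V" for U V
    using that Z by (simp add: D_f z_def)
  show ?thesis
    using X Y Z
    by (simp add: curvature_alt two D1 f_linear flip: x_def y_def z_def)
      (simp add: skew algebra_simps power2_eq_square)
qed

lemma curvature_at_xi:
  assumes "i \<in> {1..s}"
  shows "curvature_at A D p u v (\<xi> i p) = \<beta>\<^sup>2 *\<^sub>R (eb p u *\<^sub>R hor p v - eb p v *\<^sub>R hor p u)"
  using curvature_at_eq[of "extend A p u" "extend A p v" "\<xi> i" p]
    curvature_xi[of "extend A p u" "extend A p v" i p] assms
  by simp

lemma curvature_at_f:
  "curvature_at A D p x y (f p z) = f p (curvature_at A D p x y z)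
    + \<beta>\<^sup>2 *\<^sub>R ((eb p x * g p (f p y) z - eb p y * g p (f p x) z) *\<^sub>R xb p
      + (real s * g p (f p y) z) *\<^sub>R hor p x - (real s * g p (f p x) z) *\<^sub>R hor p y
      - (real s * g p (hor p x) z) *\<^sub>R f p y + (real s * g p (hor p y) z) *\<^sub>R f p x
      + (eb p z * eb p y) *\<^sub>R f p x - (eb p z * eb p x) *\<^sub>R f p y)"
  using curvature_at_eq[of "extend A p x" "extend A p y" "\<lambda>q. f q (extend A p z q)" p]
    curvature_at_eq[of "extend A p x" "extend A p y" "extend A p z" p]
    curvature_f[of "extend A p x" "extend A p y" "extend A p z" p]
  by simp

section \<open>The model curvature\<close>

text \<open>
  \<open>kap p / s\<close> is the orthogonal projection onto the sum of the range of \<open>f p\<close> and the line spanned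
  by \<open>xb p\<close>, and \<open>model p\<close> is the curvature tensor of constant curvature \<open>- s \<beta>\<^sup>2\<close> on that subspace.
\<close>

definition kap :: "'a \<Rightarrow> real ^ 'm \<Rightarrow> real ^ 'm" where
  "kap p v = real s *\<^sub>R hor p v + eb p v *\<^sub>R xb p"

definition model :: "'a \<Rightarrow> real ^ 'm \<Rightarrow> real ^ 'm \<Rightarrow> real ^ 'm \<Rightarrow> real ^ 'm" where
  "model p u v w = (\<beta>\<^sup>2 / real s) *\<^sub>R (g p (kap p u) w *\<^sub>R kap p v - g p (kap p v) w *\<^sub>R kap p u)"

lemma linear_kap: "linear (kap p)"
  unfolding kap_def by (rule linearI) (simp_all add: hor_linear eb_linear algebra_simps)

lemmas kap_linear = linear_add[OF linear_kap] linear_diff[OF linear_kap] linear_scale[OF linear_kap]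
  linear_neg[OF linear_kap] linear_0[OF linear_kap]

lemma metric_kap: "g p (kap p v) w = real s * g p (hor p v) w + eb p v * eb p w"
  by (simp add: kap_def metric_expand eb_eq_metric[of p w] metric_sym[of p "xb p"])

lemma kap_sym: "g p (kap p v) w = g p (kap p w) v"
  by (simp add: metric_kap metric_hor metric_sym[of p v] mult.commute)

lemma kap_f: "kap p (f p v) = real s *\<^sub>R f p v"
  by (simp add: kap_def)

lemma f_kap: "f p (kap p v) = real s *\<^sub>R f p v"
  by (simp add: kap_def f_linear)

lemma kap_kap: "kap p (kap p v) = real s *\<^sub>R kap p v"
  by (simp add: kap_def hor_linear eb_linear algebra_simps)

text \<open>\<open>s\<close> times the rank 2n + 1 of the projection \<open>kap p / s\<close>; the
  same factor appears in the scalar curvature.\<close>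

lemma endo_trace_kap: "endo_trace (kap p) = real s * (2 * real n + 1)"
proof -
  have "endo_trace (\<lambda>v. \<Sum>i=1..s. \<eta> i p v *\<^sub>R \<xi> i p) = (\<Sum>i=1..s. 1)"
    unfolding endo_trace_sum
    by (rule sum.cong[OF refl]) (simp add: endo_trace_rank_one[OF linear_eta] eta_xi)
  then have "endo_trace (hor p) = 2 * real n"
    unfolding hor_def[abs_def] endo_trace_diff endo_trace_ident dimension by simp
  then show ?thesis
    unfolding kap_def[abs_def] endo_trace_add endo_trace_scaleR endo_trace_rank_one[OF linear_eb]
    by (simp add: algebra_simps)
qed

definition residual :: "'a \<Rightarrow> real ^ 'm \<Rightarrow> real ^ 'm \<Rightarrow> real ^ 'm \<Rightarrow> real ^ 'm" where
  "residual p u v w = curvature_at A D p u v w - model p u v w"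

sublocale residual: algebraic_curvature "g p" "residual p" for p
proof (intro algebraic_curvature.intro algebraic_curvature_axioms.intro tangent.pos_def_form_axioms)
  have l: "linear (\<lambda>u. model p u v w)" "linear (\<lambda>u. model p v u w)" "linear (\<lambda>u. model p v w u)" for v w
    unfolding model_def by (rule linearI; simp add: kap_linear metric_expand algebra_simps)+
  show "linear (\<lambda>u. residual p u v w)" for v w
    unfolding residual_def by (rule linear_compose_sub[OF curvature_at_linear(1) l(1)])
  show "linear (\<lambda>v. residual p u v w)" for u w
    unfolding residual_def by (rule linear_compose_sub[OF curvature_at_linear(2) l(2)])
  show "linear (\<lambda>w. residual p u v w)" for u v
    unfolding residual_def by (rule linear_compose_sub[OF curvature_at_linear(3) l(3)])
  have m1: "model p u v w = - model p v u w" for u v w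
    by (simp add: model_def algebra_simps)
  show "residual p u v w = - residual p v u w" for u v w
    using curvature_at_skew[of p u v w] m1[of u v w] by (simp add: residual_def)
  \<comment> \<open>For a tensor of this shape the Bianchi identity is the symmetry of
    \<open>kap\<close> with respect to \<open>g\<close>.\<close>
  have "model p u v w + model p v w u + model p w u v = 0" for u v w
    using kap_sym[of p u v] kap_sym[of p u w] kap_sym[of p v w]
    by (simp add: model_def flip: scaleR_add_right)
  then have "residual p u v w + residual p v w u + residual p w u v
      = curvature_at A D p u v w + curvature_at A D p v w u + curvature_at A D p w u v" for u v w
    by (simp add: residual_def algebra_simps)
  then show "residual p u v w + residual p v w u + residual p w u v = 0" for u v w
    by (simp only: curvature_at_bianchi)
  have m2: "g p (model p u v w) z = - g p (model p u v z) w" for u v w z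
    by (simp add: model_def metric_expand algebra_simps)
  show "g p (residual p u v w) z = - g p (residual p u v z) w" for u v w z
    using curvature_at_skew_metric[of p u v w z] m2[of u v w z] by (simp add: residual_def metric_expand)
qed

text \<open>Pairing with \<xi>_i turns \<open>g p (kap p u)\<close> into \<open>eb p u\<close>. The
  \<open>xb\<close> parts of \<open>kap\<close> then cancel, and the factor \<open>1 / s\<close>
  leaves exactly the curvature on \<xi>_i.\<close>

lemma residual_xi: "i \<in> {1..s} \<Longrightarrow> residual p u v (\<xi> i p) = 0"
  using s_pos unfolding residual_def curvature_at_xi model_def metric_kap metric_hor
  by (simp add: hor_xi eb_xi metric_expand kap_def algebra_simps)

text \<open>The correction in \<open>curvature_at_f\<close> is precisely the commutator of the model
  with \<open>f\<close>, because composing \<open>kap\<close> with \<open>f\<close> on either side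
  gives \<open>s\<close> times \<open>f\<close>.\<close>

lemma residual_f: "residual p u v (f p w) = f p (residual p u v w)"
proof -
  have a: "g p (hor p v) (f p w) = - g p (f p v) w" for v
    by (simp add: metric_hor f_skew[of p v])
  show ?thesis
    using s_pos unfolding residual_def curvature_at_f model_def metric_kap
    by (simp add: f_linear f_kap a) (simp add: kap_def algebra_simps)
qed

text \<open>Since \<open>kap\<close> squared is \<open>s * kap\<close>, tracing the model gives the
  factor (\<beta>^2 / s) (s - s(2n + 1)) = -2n \<beta>^2.\<close>

lemma ricci_eq: "ricci A D p v w = residual.ric p v w - 2 * real n * \<beta>\<^sup>2 * g p (kap p v) w"
proof -
  have "endo_trace (\<lambda>z. model p z v w)
      = (\<beta>\<^sup>2 / real s) * (endo_trace (\<lambda>z. g p (kap p z) w *\<^sub>R kap p v) - g p (kap p v) w * endo_trace (kap p))"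
    unfolding model_def by (simp add: endo_trace_scaleR endo_trace_diff)
  also have "endo_trace (\<lambda>z. g p (kap p z) w *\<^sub>R kap p v) = g p (kap p (kap p v)) w"
    by (rule endo_trace_rank_one)
      (rule linearI; simp add: kap_linear metric_expand)
  also have "(\<beta>\<^sup>2 / real s) * (g p (kap p (kap p v)) w - g p (kap p v) w * endo_trace (kap p))
      = - 2 * real n * \<beta>\<^sup>2 * g p (kap p v) w"
    using s_pos by (simp add: kap_kap endo_trace_kap metric_expand field_simps)
  finally have m: "endo_trace (\<lambda>z. model p z v w) = - 2 * real n * \<beta>\<^sup>2 * g p (kap p v) w" .
  have "ricci A D p v w = endo_trace (\<lambda>z. residual p z v w + model p z v w)"
    by (simp add: ricci_def residual_def)
  then show ?thesis by (simp only: endo_trace_add m residual.ric_def)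
qed

text \<open>The model contributes two rank-one traces, -s^2 and s^2 times
  \<open>g p (f p v) (f p w)\<close>, entering with opposite signs; the residual contributes the
  Kaehler identity.\<close>

lemma star_ricci_eq:
  "star_ricci A D f p v w = - residual.ric p v (f p (f p w)) - real s * \<beta>\<^sup>2 * g p (f p v) (f p w)"
proof -
  have "endo_trace (\<lambda>z. model p v (f p w) (f p z))
      = (\<beta>\<^sup>2 / real s) * (endo_trace (\<lambda>z. g p (kap p v) (f p z) *\<^sub>R kap p (f p w))
        - endo_trace (\<lambda>z. g p (kap p (f p w)) (f p z) *\<^sub>R kap p v))"
    unfolding model_def by (simp add: endo_trace_scaleR endo_trace_diff)
  also have "endo_trace (\<lambda>z. g p (kap p v) (f p z) *\<^sub>R kap p (f p w)) = g p (kap p v) (f p (kap p (f p w)))"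
    by (rule endo_trace_rank_one) (rule linearI; simp add: f_linear metric_expand)
  also have "endo_trace (\<lambda>z. g p (kap p (f p w)) (f p z) *\<^sub>R kap p v) = g p (kap p (f p w)) (f p (kap p v))"
    by (rule endo_trace_rank_one) (rule linearI; simp add: f_linear metric_expand)
  also have "g p (kap p v) (f p (kap p (f p w))) = - (real s)\<^sup>2 * g p (f p v) (f p w)"
  proof -
    have "g p (kap p v) (f p (f p w)) = - (real s * g p (f p v) (f p w))"
      using f_skew[of p "kap p v" "f p w"] by (simp add: f_kap metric_expand)
    then show ?thesis by (simp add: kap_f f_linear metric_expand power2_eq_square)
  qed
  also have "g p (kap p (f p w)) (f p (kap p v)) = (real s)\<^sup>2 * g p (f p v) (f p w)"
    by (simp add: kap_f f_kap metric_expand power2_eq_square metric_sym[of p "f p w"])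
  finally have m: "endo_trace (\<lambda>z. model p v (f p w) (f p z)) = - 2 * real s * \<beta>\<^sup>2 * g p (f p v) (f p w)"
    using s_pos by (simp add: field_simps power2_eq_square)
  have "star_ricci A D f p v w
      = (1/2) * endo_trace (\<lambda>z. residual p v (f p w) (f p z) + model p v (f p w) (f p z))"
    by (simp add: star_ricci_def residual_def)
  also have "\<dots> = (1/2) * (- 2 * residual.ric p v (f p (f p w)) - 2 * real s * \<beta>\<^sup>2 * g p (f p v) (f p w))"
    unfolding endo_trace_add m residual.star_trace[OF linear_f f_skew residual_f] by simp
  finally show ?thesis by simp
qed

text \<open>The hypothesis kills the Ricci contraction of the residual on the range of
  \<open>f f\<close>, and the residual kills every \<xi>_i. Together these span the range of
  \<open>Q\<close>, which is the whole tangent space.\<close>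

lemma ricci_of_star_ricci:
  assumes "\<And>v w. star_ricci A D f p v w = - real s * \<beta>\<^sup>2 * g p (f p v) (f p w)"
  shows "ricci A D p v w = - 2 * real n * \<beta>\<^sup>2 * g p (kap p v) w"
proof -
  have xi: "residual.ric p v (\<xi> i p) = 0" if "i \<in> {1..s}" for i
    using residual_xi[OF that] endo_trace_scaleR[of 0 "\<lambda>v. 0"] by (simp add: residual.ric_def)
  obtain u where u: "w = Q p u" using Q_bij by (metis bij_pointE)
  have "residual.ric p v (f p (f p u)) = 0" using assms[of v u] star_ricci_eq[of p v u] by simp
  moreover have "f p (f p u) = - Q p u + (\<Sum>i=1..s. \<eta> i p u *\<^sub>R \<xi> i p)" by (rule f_f)
  ultimately have "residual.ric p v (- Q p u) + (\<Sum>i=1..s. \<eta> i p u *\<^sub>R residual.ric p v (\<xi> i p)) = 0"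
    by (simp only: linear_add[OF residual.linear_ric] linear_sum[OF residual.linear_ric]
        linear_scale[OF residual.linear_ric])
  then have "residual.ric p v w = 0" by (simp add: u linear_neg[OF residual.linear_ric] xi)
  then show ?thesis by (simp add: ricci_eq)
qed

section \<open>Rigidity: the flow of \<xi>_1 against the soliton equation\<close>

section \<open>Lie derivatives along the Reeb field\<close>

lemma one_index [simp]: "1 \<in> {1..s}"
  using s_gt_1 by (simp add: atLeastAtMost_iff)

text \<open>All \<xi>_i have the same covariant derivative, so \<xi>_1 stands for any of
  them.\<close>

abbreviation lie :: "('a, 'm) vfield \<Rightarrow> ('a, 'm) vfield" where "lie \<equiv> bracket A (\<xi> 1)"

lemma lie_eq: "smooth_vfield A Z \<Longrightarrow> lie Z = (\<lambda>q. D (\<xi> 1) Z q - \<beta> *\<^sub>R hor q (Z q))"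
  by (simp add: bracket_eq_D D_xi fun_eq_iff)

text \<open>Pair symmetry carries \<xi>_i from the first argument to the third, where the curvature
  is known.\<close>

lemma curvature_at_xi_left:
  assumes i: "i \<in> {1..s}"
  shows "curvature_at A D p (\<xi> i p) x y = \<beta>\<^sup>2 *\<^sub>R (eb p y *\<^sub>R hor p x - g p (hor p x) y *\<^sub>R xb p)"
proof (rule metric_eqI)
  fix z
  have "g p (curvature_at A D p (\<xi> i p) x y) z = g p (curvature_at A D p y z (\<xi> i p)) x"
    by (rule curv.pair_symmetry)
  then show "g p (curvature_at A D p (\<xi> i p) x y) z
      = g p (\<beta>\<^sup>2 *\<^sub>R (eb p y *\<^sub>R hor p x - g p (hor p x) y *\<^sub>R xb p)) z"
    using metric_sym[of p x "hor p z"] metric_sym[of p y "hor p x"]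
    by (simp add: curvature_at_xi[OF i] metric_expand metric_hor eb_eq_metric[of p z] metric_sym[of p "xb p" z]
        algebra_simps)
qed

text \<open>The Lie derivative of a connection along \<xi> is the second covariant derivative of
  \<xi> plus R(\<xi>, X)Y. The \<open>eb\<close> terms of the two cancel and the \<open>xb\<close>
  terms add up, hence the factor 2.\<close>

lemma lie_D:
  assumes X: "smooth_vfield A X" and Y: "smooth_vfield A Y"
  shows "lie (D X Y) p = D (lie X) Y p + D X (lie Y) p - (2 * \<beta>\<^sup>2 * g p (hor p (X p)) (Y p)) *\<^sub>R xb p"
proof -
  have e: "D X (\<xi> 1) = (\<lambda>q. \<beta> *\<^sub>R hor q (X q))" using D_xi[OF X one_index] by blast
  have "curvature A D (\<xi> 1) X Y p = \<beta>\<^sup>2 *\<^sub>R (eb p (Y p) *\<^sub>R hor p (X p) - g p (hor p (X p)) (Y p) *\<^sub>R xb p)"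
    using curvature_at_xi_left[OF one_index, of p "X p" "Y p"] curvature_at_eq[OF smooth_xi[OF one_index] X Y, of p]
    by simp
  then have "D (\<xi> 1) (D X Y) p = D X (D (\<xi> 1) Y) p + D (D (\<xi> 1) X) Y p - \<beta> *\<^sub>R D (\<lambda>q. hor q (X q)) Y p
      + \<beta>\<^sup>2 *\<^sub>R (eb p (Y p) *\<^sub>R hor p (X p) - g p (hor p (X p)) (Y p) *\<^sub>R xb p)"
    using X Y by (simp add: curvature_alt e D_cscaleR_left algebra_simps)
  moreover have dbl: "(2 * \<beta>\<^sup>2 * c) *\<^sub>R w = (\<beta>\<^sup>2 * c) *\<^sub>R w + (\<beta>\<^sup>2 * c) *\<^sub>R w" for c and w :: "real ^ 'm"
    by (simp flip: scaleR_add_left)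
  ultimately show ?thesis
    unfolding dbl using X Y by (simp add: lie_eq D_diff_left D_diff_right D_cscaleR_left D_cscaleR_right D_hor)
      (simp add: algebra_simps power2_eq_square)
qed

lemma lie_f: "smooth_vfield A Z \<Longrightarrow> lie (\<lambda>q. f q (Z q)) p = f p (lie Z p)"
  by (simp add: lie_eq D_f f_linear f_xi metric_expand)

lemma bracket_diff_right: "smooth_vfield A X \<Longrightarrow> smooth_vfield A Y \<Longrightarrow> smooth_vfield A Z \<Longrightarrow>
    bracket A X (\<lambda>q. Y q - Z q) p = bracket A X Y p - bracket A X Z p"
  by (simp add: bracket_eq_D D_diff_left D_diff_right)

text \<open>The Lie derivative of the curvature is the skew-symmetrised covariant derivative of the
  tensor found in \<open>lie_D\<close>. The \<open>xb\<close> terms come from \<nabla> of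
  \<open>hor\<close>, those with the factor \<open>s\<close> from \<nabla> of
  \<open>xb\<close>.\<close>

lemma lie_curvature:
  assumes X: "smooth_vfield A X" and Y: "smooth_vfield A Y" and Z: "smooth_vfield A Z"
  shows "lie (curvature A D X Y Z) p = curvature A D (lie X) Y Z p + curvature A D X (lie Y) Z p
    + curvature A D X Y (lie Z) p
    - (2 * \<beta> ^ 3) *\<^sub>R ((eb p (X p) * g p (hor p (Y p)) (Z p) - eb p (Y p) * g p (hor p (X p)) (Z p)) *\<^sub>R xb p
      + (real s * g p (hor p (Y p)) (Z p)) *\<^sub>R hor p (X p) - (real s * g p (hor p (X p)) (Z p)) *\<^sub>R hor p (Y p))"
proof -
  have second: "lie (D U (D W Z)) p = D (lie U) (D W Z) p + D U (D (lie W) Z) p + D U (D W (lie Z)) p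
      - (2 * \<beta>\<^sup>2) *\<^sub>R ((g p (hor p (U p)) (D W Z p) + g p (hor p (D U W p)) (Z p)
          - \<beta> * g p (hor p (U p)) (W p) * eb p (Z p) - \<beta> * eb p (W p) * g p (hor p (U p)) (Z p)
          + g p (hor p (W p)) (D U Z p)) *\<^sub>R xb p
        + (real s * \<beta> * g p (hor p (W p)) (Z p)) *\<^sub>R hor p (U p))"
    if U: "smooth_vfield A U" and W: "smooth_vfield A W" for U W
  proof -
    have in1: "lie (D W Z) = (\<lambda>q. D (lie W) Z q + D W (lie Z) q - (2 * \<beta>\<^sup>2) *\<^sub>R (g q (hor q (W q)) (Z q) *\<^sub>R xb q))"
      using lie_D[OF W Z] by (simp add: fun_eq_iff)
    have xz: "g p (xb p) (Z p) = eb p (Z p)" by (simp add: eb_eq_metric metric_sym[of p "xb p"])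
    have a: "D U (lie (D W Z)) p = D U (D (lie W) Z) p + D U (D W (lie Z)) p
      - (2 * \<beta>\<^sup>2) *\<^sub>R (vderiv A U (\<lambda>q. g q (hor q (W q)) (Z q)) p *\<^sub>R xb p
        + (real s * \<beta> * g p (hor p (W p)) (Z p)) *\<^sub>R hor p (U p))"
      unfolding in1 using U W Z
      by (simp add: D_diff_right D_add_right D_scaleR_right D_xb vderiv_cmult scaleR_add_right mult_ac)
    have b: "vderiv A U (\<lambda>q. g q (hor q (W q)) (Z q)) p = g p (hor p (D U W p)) (Z p)
          - \<beta> * g p (hor p (U p)) (W p) * eb p (Z p) - \<beta> * eb p (W p) * g p (hor p (U p)) (Z p)
          + g p (hor p (W p)) (D U Z p)"
      using U W Z by (simp add: D_metric D_hor metric_expand xz)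
    show ?thesis
      unfolding lie_D[OF U smooth_D[OF W Z]] a b by (simp add: algebra_simps)
  qed
  have third: "lie (D (bracket A X Y) Z) p = D (bracket A (lie X) Y) Z p + D (bracket A X (lie Y)) Z p
      + D (bracket A X Y) (lie Z) p - (2 * \<beta>\<^sup>2 * (g p (hor p (D X Y p)) (Z p) - g p (hor p (D Y X p)) (Z p))) *\<^sub>R xb p"
  proof -
    have "lie (bracket A X Y) = (\<lambda>q. bracket A (lie X) Y q + bracket A X (lie Y) q)"
      using bracket_jacobi[OF smooth_xi[OF one_index] X Y] by blast
    then have "D (lie (bracket A X Y)) Z p = D (bracket A (lie X) Y) Z p + D (bracket A X (lie Y)) Z p"
      using X Y Z by (simp add: D_add_left)
    moreover have "g p (hor p (bracket A X Y p)) (Z p) = g p (hor p (D X Y p)) (Z p) - g p (hor p (D Y X p)) (Z p)"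
      using X Y by (simp add: bracket_eq_D hor_linear metric_expand)
    ultimately show ?thesis using lie_D[OF smooth_vfield_bracket[OF X Y] Z, of p] by simp
  qed
  have c: "curvature A D X Y Z = (\<lambda>q. (D X (D Y Z) q - D Y (D X Z) q) - D (bracket A X Y) Z q)"
    by (simp add: curvature_def fun_eq_iff)
  have "lie (curvature A D X Y Z) p = lie (D X (D Y Z)) p - lie (D Y (D X Z)) p - lie (D (bracket A X Y) Z) p"
    unfolding c using X Y Z by (simp add: bracket_diff_right)
  moreover have "g p (hor p (Y p)) (X p) = g p (hor p (X p)) (Y p)"
    by (simp add: metric_hor metric_sym[of p "Y p"])
  ultimately show ?thesis
    unfolding second[OF X Y] second[OF Y X] third curvature_def
    by (simp add: algebra_simps power2_eq_square power3_eq_cube)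
qed

text \<open>\<xi>_1 preserves \<open>f\<close> and contraction commutes with the Lie derivative, so
  the deviation is half the trace of the deviation \<open>K\<close> of the curvature.\<close>

lemma lie_star_ricci:
  assumes X: "smooth_vfield A X" and Y: "smooth_vfield A Y"
  shows "vderiv A (\<xi> 1) (\<lambda>q. star_ricci A D f q (X q) (Y q)) p
    = star_ricci A D f p (lie X p) (Y p) + star_ricci A D f p (X p) (lie Y p)
      - 2 * real s * \<beta> ^ 3 * g p (f p (X p)) (f p (Y p))"
proof -
  define t where "t = (\<lambda>q z. (1/2) *\<^sub>R curvature_at A D q (X q) (f q (Y q)) (f q z))"
  define K where "K = (\<lambda>z. - (2 * \<beta> ^ 3) *\<^sub>R ((eb p (X p) * g p (f p (Y p)) (f p z)) *\<^sub>R xb p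
      + (real s * g p (f p (Y p)) (f p z)) *\<^sub>R hor p (X p) - (real s * g p (hor p (X p)) (f p z)) *\<^sub>R f p (Y p)))"
  define L where "L = (\<lambda>z. (1/2) *\<^sub>R (curvature_at A D p (lie X p) (f p (Y p)) (f p z)
      + curvature_at A D p (X p) (f p (lie Y p)) (f p z) + K z))"
  have ts: "(\<lambda>q. t q (Z q)) = (\<lambda>q. (1/2) *\<^sub>R curvature A D X (\<lambda>q. f q (Y q)) (\<lambda>q. f q (Z q)) q)"
    if "smooth_vfield A Z" for Z
    unfolding t_def using curvature_at_eq[of X "\<lambda>q. f q (Y q)" "\<lambda>q. f q (Z q)"] X Y that by simp
  have tl: "linear (\<lambda>z. curvature_at A D q x y (f q z))" for q x y
    using linear_compose[OF linear_f curvature_at_linear(3)] by (simp add: comp_def)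
  have "endo_field A t"
    unfolding endo_field_def
  proof (intro conjI allI impI)
    show "linear (t q)" for q unfolding t_def by (rule linear_compose_scale_right[OF tl])
    show "smooth_vfield A (\<lambda>q. t q (Z q))" if "smooth_vfield A Z" for Z
      unfolding ts[OF that] using X Y that by simp
  qed
  moreover have "linear K"
    unfolding K_def by (rule linearI) (simp_all add: f_linear metric_expand algebra_simps)
  then have "linear L"
    unfolding L_def by (intro linear_compose_scale_right linear_compose_add tl)
  moreover have "L (Z p) = lie (\<lambda>q. t q (Z q)) p - t p (lie Z p)" if Z: "smooth_vfield A Z" for Z
  proof -
    let ?fY = "\<lambda>q. f q (Y q)" and ?fZ = "\<lambda>q. f q (Z q)"
    have fY: "lie ?fY = (\<lambda>q. f q (lie Y q))" using lie_f[OF Y] by blast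
    have fZ: "lie ?fZ = (\<lambda>q. f q (lie Z q))" using lie_f[OF Z] by blast
    have "lie (\<lambda>q. (1/2) *\<^sub>R curvature A D X ?fY ?fZ q) p = (1/2) *\<^sub>R lie (curvature A D X ?fY ?fZ) p"
      using X Y Z by (simp add: bracket_eq_D D_cscaleR_left D_cscaleR_right flip: scaleR_diff_right)
    moreover have "lie (curvature A D X ?fY ?fZ) p = curvature_at A D p (lie X p) (f p (Y p)) (f p (Z p))
        + curvature_at A D p (X p) (f p (lie Y p)) (f p (Z p))
        + curvature_at A D p (X p) (f p (Y p)) (f p (lie Z p)) + K (Z p)"
      using lie_curvature[of X ?fY ?fZ p] curvature_at_eq[of "lie X" ?fY ?fZ p]
        curvature_at_eq[of X "lie ?fY" ?fZ p] curvature_at_eq[of X ?fY "lie ?fZ" p] X Y Z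
      unfolding fY fZ by (simp add: K_def)
    ultimately show ?thesis
      unfolding ts[OF Z] by (simp add: L_def t_def algebra_simps)
  qed
  ultimately have "vderiv A (\<xi> 1) (\<lambda>q. endo_trace (t q)) p = endo_trace L"
    by (intro vderiv_trace smooth_xi one_index)
  moreover have "endo_trace (t q) = star_ricci A D f q (X q) (Y q)" for q
    unfolding t_def star_ricci_def by (rule endo_trace_scaleR)
  \<comment> \<open>The \<open>xb\<close> term has trace zero because \<open>f\<close> kills
    \<open>xb\<close>; the other two contribute equally by skewness of \<open>f\<close>.\<close>
  moreover have "endo_trace K = - 4 * real s * \<beta> ^ 3 * g p (f p (X p)) (f p (Y p))"
  proof -
    have lin: "linear (\<lambda>z. g p w (f p z))" "linear (\<lambda>z. k * g p w (f p z))" for w k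
      by (rule linearI; simp add: f_linear metric_expand algebra_simps)+
    show ?thesis
      unfolding K_def endo_trace_scaleR endo_trace_add endo_trace_diff endo_trace_rank_one[OF lin(2)]
      using f_skew[of p "X p" "f p (Y p)"] metric_sym[of p "f p (X p)" "f p (Y p)"]
      by (simp add: metric_expand metric_hor)
  qed
  ultimately show ?thesis
    by (simp add: L_def endo_trace_scaleR endo_trace_add star_ricci_def)
qed

section \<open>Solitons with contact potential\<close>

lemma star_ricci_xi: "i \<in> {1..s} \<Longrightarrow> star_ricci A D f p v (\<xi> i p) = 0"
  by (simp add: star_ricci_def f_xi linear_0[OF curvature_at_linear(2)] endo_trace_alt)

context
  fixes V :: "('a, 'm) vfield" and l \<mu> :: real and \<sigma> :: "'a \<Rightarrow> real"
  assumes soliton: "star_eta_ricci_soliton A s f \<eta> g D V l \<mu>"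
    and contact: "contact_vfield A s \<eta> V \<sigma>"
begin

lemma smooth_V [simp]: "smooth_vfield A V"
  using contact by (simp add: contact_vfield_def)

lemma lie_metric_V:
  "smooth_vfield A X \<Longrightarrow> smooth_vfield A Y \<Longrightarrow> (1/2) * lie_metric A V g X Y p + star_ricci A D f p (X p) (Y p)
    = l * g p (hor p (X p)) (Y p) + (l + \<mu>) * (eb p (X p) * eb p (Y p))"
  using soliton unfolding star_eta_ricci_soliton_def metric_hor_self by blast

lemma vderiv_V_eta:
  assumes "i \<in> {1..s}" "smooth_vfield A X"
  shows "vderiv A V (\<lambda>q. \<eta> i q (X q)) p = \<eta> i p (bracket A V X p) + \<sigma> p * \<eta> i p (X p)"
proof -
  have "lie_one_form A V (\<eta> i) X p = \<sigma> p * \<eta> i p (X p)"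
    using contact assms unfolding contact_vfield_def by blast
  then show ?thesis by (simp add: lie_one_form_def)
qed

text \<open>The contact condition gives \<eta>^i([V, \<xi>_j]) = -\<sigma> \<delta>_ij, so half the
  Lie derivative of \<open>g\<close> is \<sigma> \<delta>_ij. The other terms vanish on \<xi>_i,
  \<xi>_j except for the product of the two \<open>eb\<close> values, which is 1.\<close>

lemma sigma_delta:
  assumes i: "i \<in> {1..s}" and j: "j \<in> {1..s}"
  shows "\<sigma> p * (if i = j then 1 else 0) = l + \<mu>"
proof -
  have c: "(\<lambda>q. \<eta> a q (\<xi> b q)) = (\<lambda>q. if a = b then 1 else 0)"
    "(\<lambda>q. g q (\<xi> a q) (\<xi> b q)) = (\<lambda>q. if a = b then 1 else 0)"
    if "a \<in> {1..s}" "b \<in> {1..s}" for a b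
    using that by (simp_all add: eta_xi xi_orthonormal)
  have e: "\<eta> a p (bracket A V (\<xi> b) p) = - \<sigma> p * (if a = b then 1 else 0)"
    if "a \<in> {1..s}" "b \<in> {1..s}" for a b
    using vderiv_V_eta[OF that(1) smooth_xi[OF that(2)], of p] that unfolding c(1)[OF that]
    by (simp add: eta_xi)
  have "lie_metric A V g (\<xi> i) (\<xi> j) p = 2 * \<sigma> p * (if i = j then 1 else 0)"
    using e[OF i j] e[OF j i] unfolding lie_metric_def c(2)[OF i j]
    by (simp add: eta_eq_metric i j metric_sym[of p "\<xi> i p"])
  then show ?thesis
    using lie_metric_V[OF smooth_xi[OF i] smooth_xi[OF j], of p] i j
    by (simp add: star_ricci_xi hor_xi metric_expand eb_xi)
qed

lemma two_index: "2 \<in> {1..s}"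
  using s_gt_1 by (simp add: atLeastAtMost_iff)

lemma l_mu: "l + \<mu> = 0"
  \<comment> \<open>An off-diagonal pair, available since s > 1; the diagonal then gives
    \<sigma>.\<close>
  using sigma_delta[OF one_index two_index] by simp

lemma sigma_eq_0: "\<sigma> p = 0"
  using sigma_delta[OF one_index one_index] l_mu by simp

text \<open>With l + \<mu> = 0 the soliton equation gives (L_V g)(X, \<xi>_1) = 0. As
  \<open>\<eta> 1\<close> is the metric dual of \<xi>_1 and is now invariant under V, the term g(X,
  [V, \<xi>_1]) must vanish for every X.\<close>

lemma lie_V: "lie V = (\<lambda>q. 0)"
proof
  fix p
  have "g p (bracket A V (\<xi> 1) p) w = g p 0 w" for w
  proof -
    let ?X = "extend A p w"
    have e: "(\<lambda>q. g q (?X q) (\<xi> 1 q)) = (\<lambda>q. \<eta> 1 q (?X q))" by (simp add: eta_eq_metric[OF one_index])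
    have "lie_metric A V g ?X (\<xi> 1) p = 0"
      using lie_metric_V[of ?X "\<xi> 1" p] l_mu by (simp add: star_ricci_xi hor_xi metric_hor metric_expand)
    then have "g p w (bracket A V (\<xi> 1) p) = 0"
      unfolding lie_metric_def e using vderiv_V_eta[OF one_index smooth_extend, of p w p]
      by (simp add: sigma_eq_0 eta_eq_metric)
    then show ?thesis by (simp add: metric_sym[of p w] metric_expand)
  qed
  then have "bracket A V (\<xi> 1) p = 0" by (rule metric_eqI)
  then show "lie V p = 0" using bracket_skew[of "\<xi> 1" V p] by simp
qed

lemma lie_bracket_V: "smooth_vfield A X \<Longrightarrow> lie (bracket A V X) p = bracket A V (lie X) p"
  using bracket_jacobi[of "\<xi> 1" V X p] by (simp add: lie_V bracket_eq_D[of "\<lambda>q. 0"] D_zero_left D_zero_right)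

lemma vderiv_xi_V: "smooth_fun A h \<Longrightarrow> vderiv A (\<xi> 1) (vderiv A V h) p = vderiv A V (vderiv A (\<xi> 1) h) p"
  using vderiv_bracket[of "\<xi> 1" V h p] linear_0[OF linear_tangent_deriv, of h p]
  by (simp add: lie_V vderiv_def[of A "\<lambda>q. 0"])

lemma vderiv_xi_metric:
  assumes "smooth_vfield A X" "smooth_vfield A Y"
  shows "vderiv A (\<xi> 1) (\<lambda>q. g q (X q) (Y q)) p
    = g p (lie X p) (Y p) + g p (X p) (lie Y p) + 2 * \<beta> * g p (hor p (X p)) (Y p)"
  using assms by (simp add: D_metric lie_eq metric_expand metric_hor algebra_simps)

text \<open>In contrast to \<open>g\<close>, whose Lie derivative involves only its horizontal part,
  the horizontal metric is an eigentensor with eigenvalue 2\<beta>.\<close>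

lemma vderiv_xi_metric_hor:
  assumes "smooth_vfield A X" "smooth_vfield A Y"
  shows "vderiv A (\<xi> 1) (\<lambda>q. g q (hor q (X q)) (Y q)) p
    = g p (hor p (lie X p)) (Y p) + g p (hor p (X p)) (lie Y p) + 2 * \<beta> * g p (hor p (X p)) (Y p)"
  using assms
  by (simp add: D_metric D_hor lie_eq metric_expand metric_hor hor_linear hor_xi algebra_simps)

text \<open>As \<sigma> = 0, V preserves every \<eta>^i and hence the vertical part of
  \<open>g\<close>; only the horizontal part contributes to L_V g.\<close>

lemma lie_metric_V_hor:
  assumes X: "smooth_vfield A X" and Y: "smooth_vfield A Y"
  shows "lie_metric A V g X Y p = vderiv A V (\<lambda>q. g q (hor q (X q)) (Y q)) p
    - g p (hor p (bracket A V X p)) (Y p) - g p (hor p (X p)) (bracket A V Y p)"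
proof -
  have "vderiv A V (\<lambda>q. g q (hor q (X q)) (Y q)) p
      = vderiv A V (\<lambda>q. g q (X q) (Y q)) p - (\<Sum>i=1..s. vderiv A V (\<lambda>q. \<eta> i q (X q) * \<eta> i q (Y q)) p)"
    unfolding metric_hor_self using X Y by (simp add: vderiv_diff vderiv_sum)
  also have "(\<Sum>i=1..s. vderiv A V (\<lambda>q. \<eta> i q (X q) * \<eta> i q (Y q)) p)
      = (\<Sum>i=1..s. \<eta> i p (bracket A V X p) * \<eta> i p (Y p)) + (\<Sum>i=1..s. \<eta> i p (X p) * \<eta> i p (bracket A V Y p))"
    unfolding sum.distrib[symmetric]
    by (rule sum.cong[OF refl]) (simp add: vderiv_mult vderiv_V_eta sigma_eq_0 X Y)
  finally show ?thesis
    by (simp add: lie_metric_def metric_hor_self)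
qed

text \<open>Commuting the two Lie derivatives turns this into L_V of 2\<beta> times the horizontal
  metric, which is 2\<beta> L_V g.\<close>

lemma vderiv_xi_lie_metric_V:
  assumes X: "smooth_vfield A X" and Y: "smooth_vfield A Y"
  shows "vderiv A (\<xi> 1) (lie_metric A V g X Y) p
    = lie_metric A V g (lie X) Y p + lie_metric A V g X (lie Y) p + 2 * \<beta> * lie_metric A V g X Y p"
proof -
  have e: "vderiv A (\<xi> 1) (\<lambda>q. g q (X q) (Y q))
      = (\<lambda>q. g q (lie X q) (Y q) + g q (X q) (lie Y q) + (2 * \<beta>) * g q (hor q (X q)) (Y q))"
    by (rule ext) (rule vderiv_xi_metric[OF X Y])
  have 1: "vderiv A (\<xi> 1) (vderiv A V (\<lambda>q. g q (X q) (Y q))) p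
      = vderiv A V (\<lambda>q. g q (lie X q) (Y q)) p + vderiv A V (\<lambda>q. g q (X q) (lie Y q)) p
        + 2 * \<beta> * vderiv A V (\<lambda>q. g q (hor q (X q)) (Y q)) p"
    using X Y by (subst vderiv_xi_V) (simp_all add: e vderiv_add vderiv_cmult)
  have l: "lie_metric A V g X Y = (\<lambda>q. vderiv A V (\<lambda>q. g q (X q) (Y q)) q
      - g q (bracket A V X q) (Y q) - g q (X q) (bracket A V Y q))"
    by (simp add: lie_metric_def[abs_def])
  have 2: "vderiv A (\<xi> 1) (lie_metric A V g X Y) p = vderiv A (\<xi> 1) (vderiv A V (\<lambda>q. g q (X q) (Y q))) p
      - vderiv A (\<xi> 1) (\<lambda>q. g q (bracket A V X q) (Y q)) p - vderiv A (\<xi> 1) (\<lambda>q. g q (X q) (bracket A V Y q)) p"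
    unfolding l using X Y by (simp add: vderiv_diff)
  have 3: "vderiv A V (\<lambda>q. g q (hor q (X q)) (Y q)) p = lie_metric A V g X Y p
      + g p (hor p (bracket A V X p)) (Y p) + g p (hor p (X p)) (bracket A V Y p)"
    using lie_metric_V_hor[OF X Y, of p] by simp
  show ?thesis
    unfolding 2 1 3 using X Y
    by (simp add: vderiv_xi_metric lie_bracket_V lie_metric_def[of A V g "lie X" Y]
        lie_metric_def[of A V g X "lie Y"] algebra_simps)
qed

text \<open>The soliton equation writes star-Ricci through the horizontal metric and L_V g, both of
  weight 2\<beta> along \<xi>_1. Equating this with the value computed from the curvature leaves an
  equation that can be divided by 2\<beta>.\<close>

lemma star_ricci_contact_soliton:
  assumes "\<beta> \<noteq> 0"
  shows "star_ricci A D f p v w = - real s * \<beta>\<^sup>2 * g p (f p v) (f p w)"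
proof -
  define X Y where "X = extend A p v" "Y = extend A p w"
  have X: "smooth_vfield A X" and Y: "smooth_vfield A Y" by (simp_all add: X_Y_def)
  have S: "star_ricci A D f q (U q) (W q) = l * g q (hor q (U q)) (W q) - (1/2) * lie_metric A V g U W q"
    if "smooth_vfield A U" "smooth_vfield A W" for U W q
    using lie_metric_V[OF that, of q] l_mu by simp
  have lm: "smooth_fun A (lie_metric A V g X Y)"
    unfolding lie_metric_def[abs_def] using X Y by simp
  have "vderiv A (\<xi> 1) (\<lambda>q. star_ricci A D f q (X q) (Y q)) p
      = l * vderiv A (\<xi> 1) (\<lambda>q. g q (hor q (X q)) (Y q)) p - (1/2) * vderiv A (\<xi> 1) (lie_metric A V g X Y) p"
  proof -
    have a: "smooth_fun A (\<lambda>q. g q (hor q (X q)) (Y q))" using X Y by simp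
    show ?thesis
      unfolding S[OF X Y] vderiv_diff[OF smooth_fun_mult[OF smooth_fun_const a] smooth_fun_mult[OF smooth_fun_const lm]]
        vderiv_cmult[OF a] vderiv_cmult[OF lm] by (rule refl)
  qed
  also have "\<dots> = star_ricci A D f p (lie X p) (Y p) + star_ricci A D f p (X p) (lie Y p)
      + 2 * \<beta> * star_ricci A D f p (X p) (Y p)"
    using X Y by (simp add: S vderiv_xi_metric_hor vderiv_xi_lie_metric_V algebra_simps)
  finally have "2 * \<beta> * star_ricci A D f p (X p) (Y p) = - 2 * real s * \<beta> ^ 3 * g p (f p (X p)) (f p (Y p))"
    using lie_star_ricci[OF X Y, of p] by simp
  then have eq: "2 * \<beta> * star_ricci A D f p v w = - 2 * real s * \<beta> ^ 3 * g p (f p v) (f p w)"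
    by (simp only: X_Y_def extend_at)
  have "2 * \<beta> * (star_ricci A D f p v w + real s * \<beta>\<^sup>2 * g p (f p v) (f p w)) = 0"
    unfolding distrib_left eq by (simp add: power2_eq_square power3_eq_cube)
  then show ?thesis using assms by simp
qed

lemma ricci_contact_soliton:
  assumes "\<beta> \<noteq> 0"
  shows "ricci A D p v w = - 2 * real n * \<beta>\<^sup>2 * g p (kap p v) w"
  by (rule ricci_of_star_ricci) (rule star_ricci_contact_soliton[OF assms])

lemma eta_Einstein_contact_soliton:
  assumes "\<beta> \<noteq> 0"
  shows "eta_Einstein A s \<eta> g D (\<lambda>_. - 2 * real s * real n * \<beta>\<^sup>2) (\<lambda>_. 2 * (real s - 1) * real n * \<beta>\<^sup>2)"
  unfolding eta_Einstein_def
  by (simp add: ricci_contact_soliton[OF assms] metric_kap metric_hor_self algebra_simps)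

lemma scalar_curvature_contact_soliton:
  assumes "\<beta> \<noteq> 0"
  shows "scalar_curvature A g D p = - 2 * real s * real n * (2 * real n + 1) * \<beta>\<^sup>2"
proof -
  have "ricci A D p = (\<lambda>v w. g p v ((- 2 * real n * \<beta>\<^sup>2) *\<^sub>R kap p w))"
  proof (intro ext)
    fix v w
    show "ricci A D p v w = g p v ((- 2 * real n * \<beta>\<^sup>2) *\<^sub>R kap p w)"
      using metric_sym[of p v "kap p w"] kap_sym[of p v w]
      by (simp add: ricci_contact_soliton[OF assms] metric_expand)
  qed
  moreover have "linear (\<lambda>w. (- 2 * real n * \<beta>\<^sup>2) *\<^sub>R kap p w)"
    by (rule linear_compose_scale_right[OF linear_kap])
  ultimately have "scalar_curvature A g D p = endo_trace (\<lambda>w. (- 2 * real n * \<beta>\<^sup>2) *\<^sub>R kap p w)"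
    unfolding scalar_curvature_def by (simp only: tangent.metric_trace_endo)
  then show ?thesis unfolding endo_trace_scaleR endo_trace_kap by simp
qed

end

end

theorem theorem6:
  fixes A :: "('a::{t2_space, second_countable_topology}, 'm::finite) chart set"
    and n s :: nat
    and f Q :: "'a \<Rightarrow> real ^ 'm \<Rightarrow> real ^ 'm"
    and \<xi> :: "nat \<Rightarrow> ('a, 'm) vfield"
    and \<eta> :: "nat \<Rightarrow> 'a \<Rightarrow> real ^ 'm \<Rightarrow> real"
    and g :: "'a \<Rightarrow> real ^ 'm \<Rightarrow> real ^ 'm \<Rightarrow> real"
    and D :: "('a, 'm) vfield \<Rightarrow> ('a, 'm) vfield \<Rightarrow> ('a, 'm) vfield"
    and V :: "('a, 'm) vfield"
    and \<sigma> :: "'a \<Rightarrow> real"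
    and \<beta> l \<mu> :: real
  assumes "smooth_atlas A"
    and "weak_beta_f_Kenmotsu A n s f Q \<xi> \<eta> g D (\<lambda>_. \<beta>)"
    and "\<beta> \<noteq> 0"
    and "star_eta_ricci_soliton A s f \<eta> g D V l \<mu>"
    and "contact_vfield A s \<eta> V \<sigma>"
  shows "(\<forall>p. \<sigma> p = 0) \<and>
    eta_Einstein A s \<eta> g D (\<lambda>_. - 2 * real s * real n * \<beta>\<^sup>2) (\<lambda>_. 2 * (real s - 1) * real n * \<beta>\<^sup>2) \<and>
    (\<forall>p. scalar_curvature A g D p = - 2 * real s * real n * (2 * real n + 1) * \<beta>\<^sup>2)"
proof -
  have "riemannian_metric A g" "levi_civita A g D"
    using assms(2) by (simp_all add: weak_beta_f_Kenmotsu_def weak_metric_f_structure_def)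
  with assms interpret weak_Kenmotsu_manifold A g D n s f Q \<xi> \<eta> \<beta>
    by unfold_locales
  show ?thesis
    using sigma_eq_0[OF assms(4,5)] eta_Einstein_contact_soliton[OF assms(4,5,3)]
      scalar_curvature_contact_soliton[OF assms(4,5,3)] by blast
qed

end
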